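(* Let $M$ be an orientable closed aspherical $3$-manifold and $S$ a closed essentially immersed subsurface of $M$, with almost fiber part $\Phi(S)$ dual to the graph $\Phi(\Lambda)$. Choose setup data $(S'_v,\phi'_v,\{c'_\delta\}_{\delta|v})$ for the vertices $v$ of $\Phi(\Lambda)$, with associated numbers $h_\delta$ and $s_\delta=h_{\bar\delta}/h_\delta$, and let $\mathscr{H}\to\Phi(S)$ be the principal $\mathbb{Q}^\times$-bundle constructed from these data (as described in the context), with spirality character $s(\mathscr{H})\in H^1(\Phi(S);\mathbb{Q}^\times)$. For any directed $1$-cycle $\alpha$ of $\Phi(S)$ dual to a cycle of directed edges $e_1,\dots,e_n$ of $\Phi(\Lambda)$, $$|\langle s(\mathscr{H}),[\alpha]\rangle|=\prod_{i=1}^n s_{\mathtt{ter}(e_i)}=\prod_{i=1}^n s_{\mathtt{ini}(e_i)}^{-1}=\prod_{i=1}^n\frac{h_{\mathtt{ini}(e_i)}}{h_{\mathtt{ter}(e_i)}},$$ where $\mathtt{ini}(e_i)$ and $\mathtt{ter}(e_i)$ are the initial and terminal ends of the directed edge $e_i$, and the sign of $\langle s(\mathscr{H}),[\alpha]\rangle$ is the value of the orientation character of $\Phi(S)$ on $[\alpha]$.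
   Context: Conventions. Closed surfaces and closed $3$-manifolds are connected. A closed surface $S$ is essentially immersed in $M$ if it is locally flatly immersed, not a sphere, and no homotopically nontrivial loop in $S$ is contractible in $M$. $\mathbb{Q}^\times$ is the multiplicative group of nonzero rationals with the discrete topology. $[-:-]$ denotes covering degree. Induced JSJ decomposition and almost fiber part. Up to homotopy, $S$ meets the JSJ tori of $M$ in a minimal finite (possibly empty) collection of disjoint essential curves of $S$ (JSJ curves), cutting $S$ into JSJ subsurfaces, each carried by a JSJ piece of $M$. A piece is nonelementary if its fundamental group is not virtually solvable. A properly immersed subsurface of a compact orientable $3$-manifold is a virtual fiber if it lifts, up to homotopy relative to boundary, to a fiber of a surface bundle structure over a $1$-orbifold of some finite cover. The virtual-fiber JSJ subsurfaces are those in elementary pieces, the geometrically infinite ones in nonelementary atoroidal (hyperbolic) pieces, and the horizontal ones in nonelementary Seifert fibered pieces. Let $\Lambda$ be the dual graph of the decomposition of $S$ (vertices $v$ correspond to JSJ subsurfaces $S_v$, edges to JSJ curves), let $\Phi(\Lambda)$ be the complete (full) subgraph spanned by the virtual-fiber vertices, and let $\Phi(S)\subset S$ be the essential subsurface dual to $\Phi(\Lambda)$. For an end-of-edge $\delta$, $\bar\delta$ denotes the opposite end of the same edge. Setup data. For each vertex $v$ of $\Phi(\Lambda)$, with $S_v$ carried by the JSJ piece $J_v$: $S'_v$ is an orientable finite cover of $S_v$; $\phi'_v$ is an automorphism (orientation-preserving self-homeomorphism) of $S'_v$ fixing $\partial S'_v$, such that the mapping torus $J'_v=S'_v\times[0,1]/(x,0)\sim(\phi'_v(x),1)$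 is equipped with a finite covering projection to $J_v$ taking $S'_v\times\{0\}$ to $S_v$; and for each end-of-edge $\delta$ adjacent to $v$, $c'_\delta$ is an elevation in $\partial S'_v$ of the boundary component $c_\delta$ of $S_v$ corresponding to $\delta$. Let $T'_\delta$ be the boundary component of $J'_v$ containing $c'_\delta$, and $T_\delta$ the boundary component of $J_v$ that it covers. Define the nonzero integer $h_\delta=[T'_\delta:T_\delta]/[c'_\delta:c_\delta]$ and the positive rational $s_\delta=h_{\bar\delta}/h_\delta$, so that $s_{\bar\delta}=s_\delta^{-1}$. Construction of $\mathscr{H}$. Take the trivialized principal $\mathbb{Q}^\times$-bundle $\mathscr{H}^+_v=S_v\times\mathbb{Q}^\times$ over $S_v$ for each vertex $v$ of $\Phi(\Lambda)$. For each end-of-edge $\delta$ of $\Phi(\Lambda)$, glue the bundles along the corresponding JSJ curve by the homeomorphism $c_{\bar\delta}\times\mathbb{Q}^\times\to c_\delta\times\mathbb{Q}^\times$ that naturally identifies the first factors and multiplies the second factor by $s_\delta$ (the maps for $\delta$ and $\bar\delta$ are mutually inverse). This gives a principal $\mathbb{Q}^\times$-bundle $\mathscr{H}^+\to\Phi(S)$. Let $\tilde S\to S$ be the orientable double cover corresponding to the kernel of the orientation character of $S$, regarded, restricted over $\Phi(S)$, as a principal $\{\pm1\}$-bundle over $\Phi(S)$. Then $\mathscr{H}=\mathscr{H}^+\times_{\Phi(S)}\tilde S$, the fiber product twisting $\mathscr{H}^+$ by $\tilde S$ via $\{\pm1\}\subset\mathbb{Q}^\times$; it is regarded as a principal $\mathbb{Q}^\times$-bundle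 over $\Phi(S)$ (its holonomy is the product of the holonomies of the two factors). Spirality character. For a principal $\mathbb{Q}^\times$-bundle $P\to X$ over a CW space, $s(P)\in H^1(X;\mathbb{Q}^\times)$ is given by the holonomy: for a closed path $\alpha:[0,1]\to X$ and any lift $\tilde\alpha:[0,1]\to P$, $\langle s(P),[\alpha]\rangle=\tilde\alpha(1)/\tilde\alpha(0)\in\mathbb{Q}^\times$, which depends only on $[\alpha]\in H_1(X;\mathbb{Z})$. *)

theory Defs
  imports "HOL-Analysis.Analysis" "HOL-Homology.Homology"
begin

section \<open>Topological manifolds\<close>

definition locally_Euclidean_at :: "nat \<Rightarrow> 'a topology \<Rightarrow> 'a \<Rightarrow> bool" where
  "locally_Euclidean_at n X x \<longleftrightarrow>
     (\<exists>U W. openin X U \<and> x \<in> U \<and> openin (Euclidean_space n) W \<and>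
        subtopology X U homeomorphic_space subtopology (Euclidean_space n) W)"

definition manifold_interior :: "nat \<Rightarrow> 'a topology \<Rightarrow> 'a set" where
  "manifold_interior n X = {x \<in> topspace X. locally_Euclidean_at n X x}"

definition manifold_boundary :: "nat \<Rightarrow> 'a topology \<Rightarrow> 'a set" where
  "manifold_boundary n X = topspace X - manifold_interior n X"

definition half_space :: "nat \<Rightarrow> (nat \<Rightarrow> real) topology" where
  "half_space n = subtopology (Euclidean_space n) {y. y 0 \<ge> 0}"

definition manifold_with_boundary :: "nat \<Rightarrow> 'a topology \<Rightarrow> bool" where
  "manifold_with_boundary n X \<longleftrightarrow>
     Hausdorff_space X \<and> second_countable X \<and>
     (\<forall>x \<in> topspace X. locally_Euclidean_at n X x \<or>
        (\<exists>U \<phi>. openin X U \<and> x \<in> U \<and>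
           homeomorphic_map (subtopology X U) (half_space n) \<phi> \<and> \<phi> x 0 = 0))"

definition closed_manifold :: "nat \<Rightarrow> 'a topology \<Rightarrow> bool" where
  "closed_manifold n X \<longleftrightarrow>
     manifold_with_boundary n X \<and> manifold_boundary n X = {} \<and>
     compact_space X \<and> connected_space X \<and> topspace X \<noteq> {}"

definition boundary_components :: "nat \<Rightarrow> 'a topology \<Rightarrow> 'a set set" where
  "boundary_components n X = connected_components_of (subtopology X (manifold_boundary n X))"


section \<open>Orientations\<close>

text \<open>Local orientations at interior points are generators of local homology groups. A boundary
  point carries no local homology of its own; there an orientation is described by its values at
  the nearby interior points.\<close>

definition local_homology :: "nat \<Rightarrow> 'a topology \<Rightarrow> 'a set \<Rightarrow> 'a chain set monoid" where
  "local_homology n X A = relative_homology_group (int n) X (topspace X - A)"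

definition orientation_on ::
    "nat \<Rightarrow> 'a topology \<Rightarrow> 'a set \<Rightarrow> ('a \<Rightarrow> 'a chain set) \<Rightarrow> bool" where
  "orientation_on n X U \<omega> \<longleftrightarrow>
     (\<forall>x \<in> U \<inter> manifold_interior n X.
        \<omega> x \<in> carrier (local_homology n X {x}) \<and>
        generate (local_homology n X {x}) {\<omega> x} = carrier (local_homology n X {x}) \<and>
        (\<exists>V \<mu>. openin X V \<and> x \<in> V \<and> V \<subseteq> U \<inter> manifold_interior n X \<and>
           \<mu> \<in> carrier (local_homology n X V) \<and>
           (\<forall>y \<in> V. hom_induced (int n) X (topspace X - V) X (topspace X - {y}) id \<mu> = \<omega> y)))"

definition orientable :: "nat \<Rightarrow> 'a topology \<Rightarrow> bool" where
  "orientable n X \<longleftrightarrow> (\<exists>\<omega>. orientation_on n X (topspace X) \<omega>)"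

definition orientation_preserving_homeo :: "nat \<Rightarrow> 'a topology \<Rightarrow> ('a \<Rightarrow> 'a) \<Rightarrow> bool" where
  "orientation_preserving_homeo n X \<phi> \<longleftrightarrow>
     homeomorphic_map X X \<phi> \<and>
     (\<forall>\<omega>. orientation_on n X (topspace X) \<omega> \<longrightarrow>
        (\<forall>x \<in> manifold_interior n X.
           hom_induced (int n) X (topspace X - {x}) X (topspace X - {\<phi> x}) \<phi> (\<omega> x) = \<omega> (\<phi> x)))"

definition loop_in :: "'a topology \<Rightarrow> (real \<Rightarrow> 'a) \<Rightarrow> bool" where
  "loop_in X \<alpha> \<longleftrightarrow> pathin X \<alpha> \<and> \<alpha> 0 = \<alpha> 1"

definition agree_near ::
    "nat \<Rightarrow> 'a topology \<Rightarrow> 'a \<Rightarrow> ('a \<Rightarrow> 'a chain set) \<Rightarrow> ('a \<Rightarrow> 'a chain set) \<Rightarrow> bool" where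
  "agree_near n X x \<omega> \<omega>' \<longleftrightarrow>
     (\<exists>W. openin X W \<and> x \<in> W \<and> (\<forall>y \<in> W \<inter> manifold_interior n X. \<omega> y = \<omega>' y))"

definition orientation_along ::
    "nat \<Rightarrow> 'a topology \<Rightarrow> (real \<Rightarrow> 'a) \<Rightarrow> (real \<Rightarrow> 'a \<Rightarrow> 'a chain set) \<Rightarrow> bool" where
  "orientation_along n X \<alpha> \<omega> \<longleftrightarrow>
     (\<forall>t \<in> {0..1}. \<exists>\<epsilon>>0. \<exists>U. openin X U \<and> orientation_on n X U (\<omega> t) \<and>
        (\<forall>r \<in> {0..1}. \<bar>r - t\<bar> < \<epsilon> \<longrightarrow> \<alpha> r \<in> U \<and> agree_near n X (\<alpha> r) (\<omega> r) (\<omega> t)))"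

definition orientation_character :: "nat \<Rightarrow> 'a topology \<Rightarrow> (real \<Rightarrow> 'a) \<Rightarrow> rat" where
  "orientation_character n X \<alpha> =
     (if \<exists>\<omega>. orientation_along n X \<alpha> \<omega> \<and> agree_near n X (\<alpha> 0) (\<omega> 0) (\<omega> 1) then 1 else - 1)"


section \<open>Coverings, mapping tori and surface bundles\<close>

definition finite_covering :: "'a topology \<Rightarrow> 'b topology \<Rightarrow> ('a \<Rightarrow> 'b) \<Rightarrow> bool" where
  "finite_covering X Y p \<longleftrightarrow>
     continuous_map X Y p \<and>
     (\<forall>y \<in> topspace Y. \<exists>U \<V>. openin Y U \<and> y \<in> U \<and> finite \<V> \<and> \<V> \<noteq> {} \<and> disjoint \<V> \<and>
        \<Union>\<V> = {x \<in> topspace X. p x \<in> U} \<and>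
        (\<forall>V \<in> \<V>. openin X V \<and> homeomorphic_map (subtopology X V) (subtopology Y U) p))"

text \<open>The number of sheets of the covering of \<open>p ` A\<close> by \<open>A\<close>; when \<open>p ` A\<close> is connected it does
  not depend on the fiber.\<close>

definition covering_degree :: "'a set \<Rightarrow> ('a \<Rightarrow> 'b) \<Rightarrow> nat" where
  "covering_degree A p = card {x \<in> A. p x = p (SOME a. a \<in> A)}"

definition mapping_torus ::
    "'a topology \<Rightarrow> ('a \<Rightarrow> 'a) \<Rightarrow> 'b topology \<Rightarrow> ('a \<times> real \<Rightarrow> 'b) \<Rightarrow> bool" where
  "mapping_torus F \<phi> N q \<longleftrightarrow>
     quotient_map (prod_topology F (top_of_set {0..1})) N q \<and>
     (\<forall>x \<in> topspace F. \<forall>y \<in> topspace F. \<forall>s \<in> {0..1}. \<forall>t \<in> {0..1}.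
        q (x, s) = q (y, t) \<longleftrightarrow>
          x = y \<and> s = t \<or> s = 0 \<and> t = 1 \<and> y = \<phi> x \<or> s = 1 \<and> t = 0 \<and> x = \<phi> y)"

text \<open>A surface bundle over an interval regarded as a \<open>1\<close>-orbifold: an end of the interval is a
  mirror point when the corresponding involution is free, and an ordinary boundary point when that
  involution is the identity.\<close>

definition end_involution :: "'a topology \<Rightarrow> ('a \<Rightarrow> 'a) \<Rightarrow> bool" where
  "end_involution F \<tau> \<longleftrightarrow>
     homeomorphic_map F F \<tau> \<and> (\<forall>x \<in> topspace F. \<tau> (\<tau> x) = x) \<and>
     ((\<forall>x \<in> topspace F. \<tau> x = x) \<or> (\<forall>x \<in> topspace F. \<tau> x \<noteq> x))"

definition interval_bundle ::
    "'a topology \<Rightarrow> ('a \<Rightarrow> 'a) \<Rightarrow> ('a \<Rightarrow> 'a) \<Rightarrow> 'b topology \<Rightarrow> ('a \<times> real \<Rightarrow> 'b) \<Rightarrow> bool" where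
  "interval_bundle F \<tau> \<tau>' N q \<longleftrightarrow>
     quotient_map (prod_topology F (top_of_set {0..1})) N q \<and>
     (\<forall>x \<in> topspace F. \<forall>y \<in> topspace F. \<forall>s \<in> {0..1}. \<forall>t \<in> {0..1}.
        q (x, s) = q (y, t) \<longleftrightarrow>
          s = t \<and> (x = y \<or> s = 0 \<and> y = \<tau> x \<or> s = 1 \<and> y = \<tau>' x))"

text \<open>The model fiber may be taken with points in \<open>nat \<Rightarrow> real\<close>, since every compact manifold embeds
  in a Euclidean space. The same remark applies to the other existentially quantified compact
  manifolds below.\<close>

definition surface_bundle_over_1_orbifold ::
    "'b topology \<Rightarrow> ((nat \<Rightarrow> real) \<times> real \<Rightarrow> 'b) \<Rightarrow> (nat \<Rightarrow> real) topology \<Rightarrow> bool" where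
  "surface_bundle_over_1_orbifold N q F \<longleftrightarrow>
     manifold_with_boundary 2 F \<and> compact_space F \<and> connected_space F \<and> topspace F \<noteq> {} \<and>
     ((\<exists>\<phi>. homeomorphic_map F F \<phi> \<and> mapping_torus F \<phi> N q) \<or>
      (\<exists>\<tau> \<tau>'. end_involution F \<tau> \<and> end_involution F \<tau>' \<and> interval_bundle F \<tau> \<tau>' N q))"

text \<open>For properly mapped surfaces in \<open>3\<close>-manifolds, homotopy relative to the boundary is homotopy
  through maps of pairs. Pointwise fixed boundary curves would be too restrictive: a fiber has
  embedded boundary, whereas the boundary curves of an immersed surface may be arbitrary loops in
  the boundary tori.\<close>

definition properly_homotopic :: "'a topology \<Rightarrow> 'b topology \<Rightarrow> ('a \<Rightarrow> 'b) \<Rightarrow> ('a \<Rightarrow> 'b) \<Rightarrow> bool" where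
  "properly_homotopic F J f g \<longleftrightarrow>
     homotopic_with (\<lambda>k. k ` manifold_boundary 2 F \<subseteq> manifold_boundary 3 J) F J f g"

definition virtual_fiber :: "'a topology \<Rightarrow> 'b topology \<Rightarrow> ('a \<Rightarrow> 'b) \<Rightarrow> bool" where
  "virtual_fiber F J g \<longleftrightarrow>
     (\<exists>(N :: (nat \<Rightarrow> real) topology) p q F0 t l.
        connected_space N \<and> finite_covering N J p \<and>
        surface_bundle_over_1_orbifold N q F0 \<and> t \<in> {0..1} \<and>
        embedding_map F N l \<and> l ` topspace F = q ` (topspace F0 \<times> {t}) \<and>
        properly_homotopic F J g (p \<circ> l))"


section \<open>Surfaces and tori in 3-manifolds\<close>

definition aspherical :: "'a topology \<Rightarrow> bool" where
  "aspherical X \<longleftrightarrow>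
     (\<forall>k\<ge>2. \<forall>c. continuous_map (nsphere k) X c \<longrightarrow>
        (\<exists>a. homotopic_with (\<lambda>_. True) (nsphere k) X c (\<lambda>_. a)))"

abbreviation circle :: "complex topology" where
  "circle \<equiv> top_of_set (sphere 0 1)"

abbreviation torus :: "(complex \<times> complex) topology" where
  "torus \<equiv> prod_topology circle circle"

definition null_homotopic :: "'a topology \<Rightarrow> (complex \<Rightarrow> 'a) \<Rightarrow> bool" where
  "null_homotopic X c \<longleftrightarrow> (\<exists>a. homotopic_with (\<lambda>_. True) circle X c (\<lambda>_. a))"

definition pi1_injective :: "'a topology \<Rightarrow> 'b topology \<Rightarrow> ('a \<Rightarrow> 'b) \<Rightarrow> bool" where
  "pi1_injective X Y f \<longleftrightarrow>
     (\<forall>c. continuous_map circle X c \<and> null_homotopic Y (f \<circ> c) \<longrightarrow> null_homotopic X c)"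

text \<open>The plane \<open>Euclidean_space 2\<close> is literally a subset of \<open>Euclidean_space 3\<close>.\<close>

definition locally_flat_immersion :: "'a topology \<Rightarrow> 'b topology \<Rightarrow> ('a \<Rightarrow> 'b) \<Rightarrow> bool" where
  "locally_flat_immersion S M f \<longleftrightarrow>
     continuous_map S M f \<and>
     (\<forall>x \<in> topspace S. \<exists>U \<phi> V \<psi>.
        openin S U \<and> x \<in> U \<and> homeomorphic_map (subtopology S U) (Euclidean_space 2) \<phi> \<and>
        openin M V \<and> homeomorphic_map (subtopology M V) (Euclidean_space 3) \<psi> \<and>
        f ` U \<subseteq> V \<and> (\<forall>u \<in> U. \<psi> (f u) = \<phi> u))"

definition essentially_immersed :: "'a topology \<Rightarrow> 'b topology \<Rightarrow> ('a \<Rightarrow> 'b) \<Rightarrow> bool" where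
  "essentially_immersed S M f \<longleftrightarrow>
     locally_flat_immersion S M f \<and> \<not> S homeomorphic_space nsphere 2 \<and> pi1_injective S M f"

definition locally_flat_surface :: "'a topology \<Rightarrow> 'a set \<Rightarrow> bool" where
  "locally_flat_surface M K \<longleftrightarrow>
     K \<subseteq> topspace M \<and>
     (\<forall>x \<in> K. \<exists>V \<psi>. openin M V \<and> x \<in> V \<and>
        homeomorphic_map (subtopology M V) (Euclidean_space 3) \<psi> \<and>
        \<psi> ` (V \<inter> K) = {y \<in> topspace (Euclidean_space 3). y 0 = 0})"

definition incompressible_torus :: "'a topology \<Rightarrow> 'a set \<Rightarrow> bool" where
  "incompressible_torus M K \<longleftrightarrow>
     locally_flat_surface M K \<and> subtopology M K homeomorphic_space torus \<and>
     pi1_injective (subtopology M K) M id"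

definition boundary_parallel :: "'a topology \<Rightarrow> 'a set \<Rightarrow> bool" where
  "boundary_parallel J K \<longleftrightarrow>
     (\<exists>e. embedding_map (prod_topology torus (top_of_set {0..1::real})) J e \<and>
        e ` (topspace torus \<times> {0}) = K \<and> e ` (topspace torus \<times> {1}) \<in> boundary_components 3 J)"

definition atoroidal :: "'a topology \<Rightarrow> bool" where
  "atoroidal J \<longleftrightarrow> (\<forall>K. incompressible_torus J K \<longrightarrow> boundary_parallel J K)"

text \<open>The fibered solid torus of type \<open>(p, q)\<close> is the product of the unit disk and the unit circle,
  fibered by the orbits of the circle action \<open>w \<cdot> (z, u) = (w\<^sup>q z, w\<^sup>p u)\<close>.\<close>

definition model_fibers :: "nat \<Rightarrow> nat \<Rightarrow> (complex \<times> complex) set set" where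
  "model_fibers p q =
     (\<lambda>(z, u). (\<lambda>w. (w ^ q * z, w ^ p * u)) ` sphere 0 1) ` (cball 0 1 \<times> sphere 0 1)"

definition Seifert_fibered :: "'a topology \<Rightarrow> bool" where
  "Seifert_fibered J \<longleftrightarrow>
     (\<exists>\<F>. \<Union>\<F> = topspace J \<and> disjoint \<F> \<and>
        (\<forall>c \<in> \<F>. subtopology J c homeomorphic_space circle \<and>
           (\<exists>W U p q h. openin J U \<and> c \<subseteq> U \<and> U \<subseteq> W \<and> closedin J W \<and> p \<ge> 1 \<and> coprime p q \<and>
              homeomorphic_map (subtopology J W) (top_of_set (cball 0 1 \<times> sphere 0 1)) h \<and>
              (\<forall>x \<in> W. \<exists>d \<in> \<F>. x \<in> d \<and> d \<subseteq> W \<and> h ` d \<in> model_fibers p q))))"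


section \<open>Cutting and the JSJ decomposition\<close>

text \<open>\<open>C\<close> with \<open>\<kappa>\<close> is the manifold obtained by cutting the closed \<open>n\<close>-manifold \<open>X\<close> along the two-sided
  hypersurface \<open>T\<close>: each component of \<open>T\<close> gives rise to two boundary components of \<open>C\<close>. The pieces
  of the decomposition are the components of \<open>C\<close>, so that a piece may be adjacent to itself.\<close>

definition cut_along ::
    "nat \<Rightarrow> 'a topology \<Rightarrow> 'a set \<Rightarrow> 'b topology \<Rightarrow> ('b \<Rightarrow> 'a) \<Rightarrow> bool" where
  "cut_along n X T C \<kappa> \<longleftrightarrow>
     compact_space C \<and> manifold_with_boundary n C \<and>
     continuous_map C X \<kappa> \<and> \<kappa> ` topspace C = topspace X \<and>
     manifold_boundary n C = {x \<in> topspace C. \<kappa> x \<in> T} \<and>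
     homeomorphic_map (subtopology C (manifold_interior n C))
       (subtopology X (topspace X - T)) \<kappa> \<and>
     (\<forall>K \<in> connected_components_of (subtopology X T).
        \<exists>A B. A \<noteq> B \<and> {D \<in> boundary_components n C. \<kappa> ` D \<subseteq> K} = {A, B} \<and>
          homeomorphic_map (subtopology C A) (subtopology X K) \<kappa> \<and>
          homeomorphic_map (subtopology C B) (subtopology X K) \<kappa>)"

definition torus_decomposition :: "'a topology \<Rightarrow> 'a set \<Rightarrow> bool" where
  "torus_decomposition M T \<longleftrightarrow>
     closedin M T \<and> finite (connected_components_of (subtopology M T)) \<and>
     (\<forall>K \<in> connected_components_of (subtopology M T). incompressible_torus M K) \<and>
     (\<exists>(C :: (nat \<Rightarrow> real) topology) \<kappa>. cut_along 3 M T C \<kappa> \<and>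
        (\<forall>J \<in> connected_components_of C.
           Seifert_fibered (subtopology C J) \<or> atoroidal (subtopology C J)))"

definition JSJ_tori :: "'a topology \<Rightarrow> 'a set \<Rightarrow> bool" where
  "JSJ_tori M T \<longleftrightarrow>
     torus_decomposition M T \<and>
     (\<forall>T'. torus_decomposition M T' \<longrightarrow>
        card (connected_components_of (subtopology M T))
          \<le> card (connected_components_of (subtopology M T')))"

definition transverse :: "'a topology \<Rightarrow> 'b topology \<Rightarrow> 'b set \<Rightarrow> ('a \<Rightarrow> 'b) \<Rightarrow> bool" where
  "transverse S M T g \<longleftrightarrow>
     (\<forall>x \<in> topspace S. g x \<in> T \<longrightarrow> (\<exists>U \<phi> V \<psi>.
        openin S U \<and> x \<in> U \<and> homeomorphic_map (subtopology S U) (Euclidean_space 2) \<phi> \<and>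
        openin M V \<and> homeomorphic_map (subtopology M V) (Euclidean_space 3) \<psi> \<and>
        \<psi> ` (V \<inter> T) = {y \<in> topspace (Euclidean_space 3). y 0 = 0} \<and>
        g ` U \<subseteq> V \<and> (\<forall>u \<in> U. \<psi> (g u) 0 = \<phi> u 0)))"

definition JSJ_curves :: "'a topology \<Rightarrow> 'b set \<Rightarrow> ('a \<Rightarrow> 'b) \<Rightarrow> 'a set" where
  "JSJ_curves S T g = {x \<in> topspace S. g x \<in> T}"

definition essential_curve :: "'a topology \<Rightarrow> 'a set \<Rightarrow> bool" where
  "essential_curve S c \<longleftrightarrow>
     (\<exists>h. homeomorphic_map circle (subtopology S c) h \<and> \<not> null_homotopic S h)"

definition JSJ_position ::
    "'a topology \<Rightarrow> 'b topology \<Rightarrow> 'b set \<Rightarrow> ('a \<Rightarrow> 'b) \<Rightarrow> ('a \<Rightarrow> 'b) \<Rightarrow> bool" where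
  "JSJ_position S M T f g \<longleftrightarrow>
     homotopic_with (\<lambda>_. True) S M f g \<and> transverse S M T g \<and>
     finite (connected_components_of (subtopology S (JSJ_curves S T g))) \<and>
     (\<forall>c \<in> connected_components_of (subtopology S (JSJ_curves S T g)). essential_curve S c) \<and>
     (\<forall>g'. homotopic_with (\<lambda>_. True) S M f g' \<and> transverse S M T g' \<longrightarrow>
        card (connected_components_of (subtopology S (JSJ_curves S T g)))
          \<le> card (connected_components_of (subtopology S (JSJ_curves S T g'))))"

text \<open>A surface \<open>f : S \<rightarrow> M\<close> together with its induced JSJ decomposition: \<open>g\<close> is \<open>f\<close> put in
  minimal position with respect to the JSJ tori \<open>T\<close>, the pieces of \<open>M\<close> and \<open>S\<close> are the components of
  \<open>CM\<close> and \<open>CS\<close>, and \<open>gc\<close> is the map of cut manifolds induced by \<open>g\<close>.\<close>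

definition induced_JSJ_decomposition ::
    "'m topology \<Rightarrow> 'm set \<Rightarrow> 'd topology \<Rightarrow> ('d \<Rightarrow> 'm) \<Rightarrow>
     's topology \<Rightarrow> ('s \<Rightarrow> 'm) \<Rightarrow> ('s \<Rightarrow> 'm) \<Rightarrow> 'c topology \<Rightarrow> ('c \<Rightarrow> 's) \<Rightarrow> ('c \<Rightarrow> 'd) \<Rightarrow> bool" where
  "induced_JSJ_decomposition M T CM \<kappa>M S f g CS \<kappa>S gc \<longleftrightarrow>
     JSJ_tori M T \<and> cut_along 3 M T CM \<kappa>M \<and>
     JSJ_position S M T f g \<and> cut_along 2 S (JSJ_curves S T g) CS \<kappa>S \<and>
     continuous_map CS CM gc \<and> (\<forall>x \<in> topspace CS. \<kappa>M (gc x) = g (\<kappa>S x))"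


section \<open>The dual graph and the almost fiber part\<close>

text \<open>Vertices of the dual graph are the components of \<open>CS\<close>. An end-of-edge is the
  corresponding boundary component of \<open>CS\<close>; the two ends of one edge are the two boundary components
  lying over the same JSJ curve.\<close>

definition ends :: "'c topology \<Rightarrow> 'c set set" where
  "ends CS = boundary_components 2 CS"

definition opp :: "'c topology \<Rightarrow> ('c \<Rightarrow> 's) \<Rightarrow> 'c set \<Rightarrow> 'c set" where
  "opp CS \<kappa>S \<delta> = (THE \<delta>'. \<delta>' \<in> ends CS \<and> \<delta>' \<noteq> \<delta> \<and> \<kappa>S ` \<delta>' = \<kappa>S ` \<delta>)"

definition vertex_of :: "'c topology \<Rightarrow> 'c set \<Rightarrow> 'c set" where
  "vertex_of CS \<delta> = (THE v. v \<in> connected_components_of CS \<and> \<delta> \<subseteq> v)"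

definition carrier_piece :: "'d topology \<Rightarrow> ('c \<Rightarrow> 'd) \<Rightarrow> 'c set \<Rightarrow> 'd set" where
  "carrier_piece CM gc v = (THE J. J \<in> connected_components_of CM \<and> gc ` v \<subseteq> J)"

definition fiber_vertices ::
    "'d topology \<Rightarrow> 'c topology \<Rightarrow> ('c \<Rightarrow> 'd) \<Rightarrow> 'c set set" where
  "fiber_vertices CM CS gc =
     {v \<in> connected_components_of CS.
        virtual_fiber (subtopology CS v) (subtopology CM (carrier_piece CM gc v)) gc}"

definition fiber_ends :: "'c topology \<Rightarrow> ('c \<Rightarrow> 's) \<Rightarrow> 'c set set \<Rightarrow> 'c set set" where
  "fiber_ends CS \<kappa>S \<Phi> =
     {\<delta> \<in> ends CS. vertex_of CS \<delta> \<in> \<Phi> \<and> vertex_of CS (opp CS \<kappa>S \<delta>) \<in> \<Phi>}"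

definition almost_fiber_part ::
    "'s topology \<Rightarrow> ('c \<Rightarrow> 's) \<Rightarrow> 'c set set \<Rightarrow> 's topology" where
  "almost_fiber_part S \<kappa>S \<Phi> = subtopology S (\<kappa>S ` \<Union>\<Phi>)"

text \<open>A directed edge is the pair of its initial and terminal ends.\<close>

definition directed_edges ::
    "'c topology \<Rightarrow> ('c \<Rightarrow> 's) \<Rightarrow> 'c set set \<Rightarrow> ('c set \<times> 'c set) set" where
  "directed_edges CS \<kappa>S \<Phi> = {(\<delta>, opp CS \<kappa>S \<delta>) | \<delta>. \<delta> \<in> fiber_ends CS \<kappa>S \<Phi>}"

definition directed_edge_cycle ::
    "'c topology \<Rightarrow> ('c \<Rightarrow> 's) \<Rightarrow> 'c set set \<Rightarrow> ('c set \<times> 'c set) list \<Rightarrow> bool" where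
  "directed_edge_cycle CS \<kappa>S \<Phi> es \<longleftrightarrow>
     set es \<subseteq> directed_edges CS \<kappa>S \<Phi> \<and>
     (\<forall>i < length es.
        vertex_of CS (snd (es ! i)) = vertex_of CS (fst (es ! (Suc i mod length es))))"

text \<open>The loop \<open>\<alpha>\<close> is cut into subpaths \<open>a 0, \<dots>, a n\<close> lying in JSJ subsurfaces, such that between
  \<open>a i\<close> and \<open>a (Suc i)\<close> it crosses the JSJ curve of the edge \<open>es ! i\<close> from the initial to the
  terminal side; the last and the first subpath fit together in one subsurface. (A constant
  \<open>a n\<close> is allowed, for loops based on the last JSJ curve.)\<close>

definition dual_to_edges ::
    "'c topology \<Rightarrow> ('c \<Rightarrow> 's) \<Rightarrow> 'c set set \<Rightarrow> (real \<Rightarrow> 's) \<Rightarrow> ('c set \<times> 'c set) list \<Rightarrow> bool" where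
  "dual_to_edges CS \<kappa>S \<Phi> \<alpha> es \<longleftrightarrow>
     (\<exists>(t :: nat \<Rightarrow> real) a. t 0 = 0 \<and> t (Suc (length es)) = 1 \<and>
        (\<forall>i \<le> length es. t i \<le> t (Suc i) \<and>
           continuous_map (top_of_set {t i..t (Suc i)}) (subtopology CS (\<Union>\<Phi>)) (a i) \<and>
           (\<forall>r \<in> {t i..t (Suc i)}. \<kappa>S (a i r) = \<alpha> r)) \<and>
        (\<forall>i < length es. a i (t (Suc i)) \<in> fst (es ! i) \<and>
           a (Suc i) (t (Suc i)) \<in> snd (es ! i)) \<and>
        a (length es) 1 = a 0 0)"


section \<open>Setup data\<close>

record ('c, 'd, 'p, 'j) setup_data =
  cover :: "'c set \<Rightarrow> 'p topology"
  cover_proj :: "'c set \<Rightarrow> 'p \<Rightarrow> 'c"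
  monodromy :: "'c set \<Rightarrow> 'p \<Rightarrow> 'p"
  mtorus :: "'c set \<Rightarrow> 'j topology"
  mtorus_quot :: "'c set \<Rightarrow> 'p \<times> real \<Rightarrow> 'j"
  mtorus_proj :: "'c set \<Rightarrow> 'j \<Rightarrow> 'd"
  elevation :: "'c set \<Rightarrow> 'p set"

definition valid_setup_data ::
    "'d topology \<Rightarrow> 'c topology \<Rightarrow> ('c \<Rightarrow> 's) \<Rightarrow> ('c \<Rightarrow> 'd) \<Rightarrow> 'c set set \<Rightarrow>
     ('c, 'd, 'p, 'j) setup_data \<Rightarrow> bool" where
  "valid_setup_data CM CS \<kappa>S gc \<Phi> D \<longleftrightarrow>
     (\<forall>v \<in> \<Phi>.
        let S' = cover D v; p = cover_proj D v; J' = mtorus D v; q = mtorus_quot D v;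
            J = subtopology CM (carrier_piece CM gc v); P = mtorus_proj D v in
        connected_space S' \<and> orientable 2 S' \<and> finite_covering S' (subtopology CS v) p \<and>
        orientation_preserving_homeo 2 S' (monodromy D v) \<and>
        (\<forall>x \<in> manifold_boundary 2 S'. monodromy D v x = x) \<and>
        mapping_torus S' (monodromy D v) J' q \<and>
        finite_covering J' J P \<and>
        properly_homotopic S' J (gc \<circ> p) (\<lambda>x. P (q (x, 0)))) \<and>
     (\<forall>\<delta> \<in> fiber_ends CS \<kappa>S \<Phi>.
        let v = vertex_of CS \<delta> in
        elevation D \<delta> \<in> connected_components_of
          (subtopology (cover D v) {x \<in> topspace (cover D v). cover_proj D v x \<in> \<delta>}))"

definition boundary_torus ::
    "'c topology \<Rightarrow> ('c, 'd, 'p, 'j) setup_data \<Rightarrow> 'c set \<Rightarrow> 'j set" where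
  "boundary_torus CS D \<delta> =
     (THE T. T \<in> boundary_components 3 (mtorus D (vertex_of CS \<delta>)) \<and>
        mtorus_quot D (vertex_of CS \<delta>) ` (elevation D \<delta> \<times> {0}) \<subseteq> T)"

definition h_number :: "'c topology \<Rightarrow> ('c, 'd, 'p, 'j) setup_data \<Rightarrow> 'c set \<Rightarrow> rat" where
  "h_number CS D \<delta> =
     of_nat (covering_degree (boundary_torus CS D \<delta>) (mtorus_proj D (vertex_of CS \<delta>))) /
     of_nat (covering_degree (elevation D \<delta>) (cover_proj D (vertex_of CS \<delta>)))"

definition s_number ::
    "'c topology \<Rightarrow> ('c \<Rightarrow> 's) \<Rightarrow> ('c, 'd, 'p, 'j) setup_data \<Rightarrow> 'c set \<Rightarrow> rat" where
  "s_number CS \<kappa>S D \<delta> = h_number CS D (opp CS \<kappa>S \<delta>) / h_number CS D \<delta>"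


section \<open>Principal bundles with discrete structure group and the spirality character\<close>

record ('e, 'x) Q_bundle =
  total :: "'e topology"
  proj :: "'e \<Rightarrow> 'x"
  act :: "rat \<Rightarrow> 'e \<Rightarrow> 'e"

definition Qx :: "rat monoid" where
  "Qx = \<lparr>carrier = {q. q \<noteq> 0}, mult = (*), one = 1\<rparr>"

definition principal_bundle :: "rat set \<Rightarrow> 'x topology \<Rightarrow> ('e, 'x) Q_bundle \<Rightarrow> bool" where
  "principal_bundle G X P \<longleftrightarrow>
     continuous_map (total P) X (proj P) \<and>
     (\<forall>x \<in> topspace X. \<exists>U \<theta>. openin X U \<and> x \<in> U \<and>
        homeomorphic_map (prod_topology (subtopology X U) (discrete_topology G))
          (subtopology (total P) {e \<in> topspace (total P). proj P e \<in> U}) \<theta> \<and>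
        (\<forall>u \<in> U. \<forall>a \<in> G. proj P (\<theta> (u, a)) = u \<and>
           (\<forall>c \<in> G. act P c (\<theta> (u, a)) = \<theta> (u, c * a))))"

definition is_lift :: "('e, 'x) Q_bundle \<Rightarrow> (real \<Rightarrow> 'x) \<Rightarrow> (real \<Rightarrow> 'e) \<Rightarrow> bool" where
  "is_lift P \<alpha> \<beta> \<longleftrightarrow> pathin (total P) \<beta> \<and> (\<forall>t \<in> {0..1}. proj P (\<beta> t) = \<alpha> t)"

text \<open>The class in singular homology of a loop, viewed as a singular \<open>1\<close>-simplex running from the
  zeroth to the first vertex.\<close>

definition loop_class :: "'x topology \<Rightarrow> (real \<Rightarrow> 'x) \<Rightarrow> 'x chain set" where
  "loop_class X \<alpha> =
     homologous_rel_set 1 X {} (frag_of (restrict (\<lambda>y. \<alpha> (y 1)) (standard_simplex 1)))"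

text \<open>An element of \<open>H\<^sup>1(X; \<rat>\<^sup>\<times>) = Hom(H\<^sub>1(X; \<int>), \<rat>\<^sup>\<times>)\<close>. It is determined by the holonomy condition because
  the classes of loops generate the first homology group.\<close>

definition spirality_character :: "'x topology \<Rightarrow> ('e, 'x) Q_bundle \<Rightarrow> 'x chain set \<Rightarrow> rat" where
  "spirality_character X P =
     (SOME \<sigma>. \<sigma> \<in> hom (homology_group 1 X) Qx \<and>
        (\<forall>\<alpha> \<beta> c. loop_in X \<alpha> \<and> is_lift P \<alpha> \<beta> \<and> c \<noteq> 0 \<and> \<beta> 1 = act P c (\<beta> 0) \<longrightarrow>
           \<sigma> (loop_class X \<alpha>) = c))"

definition orientation_double_cover :: "'s topology \<Rightarrow> ('o, 's) Q_bundle \<Rightarrow> bool" where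
  "orientation_double_cover S P \<longleftrightarrow>
     principal_bundle {1, - 1} S P \<and>
     (\<forall>\<alpha> \<beta>. loop_in S \<alpha> \<and> is_lift P \<alpha> \<beta> \<longrightarrow> \<beta> 1 = act P (orientation_character 2 S \<alpha>) (\<beta> 0))"

definition quotient_topology :: "'a topology \<Rightarrow> ('a \<times> 'a) set \<Rightarrow> 'a set topology" where
  "quotient_topology X r =
     topology (\<lambda>U. U \<subseteq> topspace X // r \<and> openin X {x \<in> topspace X. r `` {x} \<in> U})"

lemma openin_quotient_topology:
  "openin (quotient_topology X r) U \<longleftrightarrow>
     U \<subseteq> topspace X // r \<and> openin X {x \<in> topspace X. r `` {x} \<in> U}"
proof -
  let ?P = "\<lambda>U. U \<subseteq> topspace X // r \<and> openin X {x \<in> topspace X. r `` {x} \<in> U}"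
  have "istopology ?P"
    unfolding istopology_def
  proof (intro conjI allI impI)
    fix U V assume "?P U" "?P V"
    moreover have "{x \<in> topspace X. r `` {x} \<in> U \<inter> V} =
        {x \<in> topspace X. r `` {x} \<in> U} \<inter> {x \<in> topspace X. r `` {x} \<in> V}" by auto
    ultimately show "U \<inter> V \<subseteq> topspace X // r" "openin X {x \<in> topspace X. r `` {x} \<in> U \<inter> V}"
      by auto
  next
    fix \<K> assume K: "\<forall>U \<in> \<K>. ?P U"
    have "{x \<in> topspace X. r `` {x} \<in> \<Union>\<K>} = (\<Union>U \<in> \<K>. {x \<in> topspace X. r `` {x} \<in> U})" by auto
    with K show "\<Union>\<K> \<subseteq> topspace X // r" "openin X {x \<in> topspace X. r `` {x} \<in> \<Union>\<K>}"
      by auto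
  qed
  then show ?thesis
    by (simp add: quotient_topology_def topology_inverse')
qed

text \<open>The bundle \<open>\<H>\<^sup>+\<close>, the quotient of the disjoint union of the trivial bundles over the \<open>S\<^sub>v\<close> by the
  gluing maps; an element of its total space is an equivalence class.\<close>

definition gluing_rel ::
    "'c topology \<Rightarrow> ('c \<Rightarrow> 's) \<Rightarrow> 'c set set \<Rightarrow> ('c, 'd, 'p, 'j) setup_data \<Rightarrow>
     (('c \<times> rat) \<times> ('c \<times> rat)) set" where
  "gluing_rel CS \<kappa>S \<Phi> D =
     {((x, a), (y, b)). (x, a) = (y, b) \<or>
        (\<exists>\<delta> \<in> fiber_ends CS \<kappa>S \<Phi>. x \<in> opp CS \<kappa>S \<delta> \<and> y \<in> \<delta> \<and> \<kappa>S x = \<kappa>S y \<and>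
           b = s_number CS \<kappa>S D \<delta> * a)}"

definition H_plus ::
    "'c topology \<Rightarrow> ('c \<Rightarrow> 's) \<Rightarrow> 'c set set \<Rightarrow> ('c, 'd, 'p, 'j) setup_data \<Rightarrow>
     (('c \<times> rat) set, 's) Q_bundle" where
  "H_plus CS \<kappa>S \<Phi> D =
     \<lparr>total = quotient_topology
        (prod_topology (subtopology CS (\<Union>\<Phi>)) (discrete_topology {q. q \<noteq> 0}))
        (gluing_rel CS \<kappa>S \<Phi> D),
      proj = (\<lambda>e. \<kappa>S (fst (SOME z. z \<in> e))),
      act = (\<lambda>c e. (\<lambda>(x, a). (x, c * a)) ` e)\<rparr>"

text \<open>Fiber product of a principal \<open>\<rat>\<^sup>\<times>\<close>-bundle with (the restriction to its base of) a principal
  \<open>{\<plusminus>1}\<close>-bundle, made into a principal \<open>\<rat>\<^sup>\<times>\<close>-bundle by identifying \<open>(a, b)\<close> with \<open>(-a, -b)\<close>.\<close>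

definition twisted_product ::
    "('e, 'x) Q_bundle \<Rightarrow> ('o, 'x) Q_bundle \<Rightarrow> (('e \<times> 'o) set, 'x) Q_bundle" where
  "twisted_product P Q =
     \<lparr>total = quotient_topology
        (subtopology (prod_topology (total P) (total Q)) {(a, b). proj P a = proj Q b})
        {((a, b), (act P \<epsilon> a, act Q \<epsilon> b)) | a b \<epsilon>. \<epsilon> \<in> {1, - 1}},
      proj = (\<lambda>e. proj P (fst (SOME z. z \<in> e))),
      act = (\<lambda>c e. (\<lambda>(a, b). (act P c a, b)) ` e)\<rparr>"

end

theory Submission
  imports Defs
begin

text \<open>Following the loop through the pieces, the fiber coordinate of a lift to \<open>\<H>\<^sup>+\<close> is constant on each
  piece and is multiplied by \<open>s\<^sub>\<delta>\<close> when the loop crosses into the end \<open>\<delta>\<close>; a lift to the orientation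
  double cover contributes the sign. That the holonomy is a character of the first homology group
  follows by lifting singular 2-simplices. The sign is a priori the orientation character of the
  ambient surface; it equals the one of the subsurface because orientations restrict by excision, and
  because near every point of the subsurface the interior is connected, so that an orientation along
  a path is unique up to sign.\<close>

section \<open>Locally trivial bundles\<close>

text \<open>\<open>spirality_character\<close> is picked by a choice operator, so nothing is known
  about it until a single homomorphism on the first homology group realizes all holonomies at once.
  This is why holonomy is studied for arbitrary bundles, before the loop \<alpha> is looked at.
  \<open>orientation_character\<close> is delicate in another way: -1 is also its value on paths
  along which no orientation can be carried, so its values for \<Phi>(S) and for S can only be
  compared once some orientation along \<alpha> exists; the double cover provides it. From the setup
  data the positivity of h has to be extracted: covering degrees are cardinalities, which vanish for
  infinite sets, and the boundary torus is a definite description, so finite fibers and a unique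
  boundary component are needed. Positivity makes the gluing invertible and keeps the absolute value
  of the holonomy apart from its sign. A boundary point is by definition one without Euclidean
  neighborhood, and the connectedness arguments near the boundary are arranged so that invariance of
  domain is never called upon.\<close>

text \<open>A trivialization is recorded by its local sections and its fiber coordinate, which are easier
  to produce for quotient spaces than a homeomorphism.\<close>

definition local_trivialization ::
    "rat set \<Rightarrow> 'x topology \<Rightarrow> ('e, 'x) Q_bundle \<Rightarrow> 'x set \<Rightarrow> (rat \<Rightarrow> 'x \<Rightarrow> 'e) \<Rightarrow> ('e \<Rightarrow> rat) \<Rightarrow> bool"
where
  "local_trivialization G X P U sec crd \<longleftrightarrow>
     openin X U \<and>
     (\<forall>g \<in> G. continuous_map (subtopology X U) (total P) (sec g)) \<and>
     (\<forall>g \<in> G. openin (total P) {e \<in> topspace (total P). proj P e \<in> U \<and> crd e = g}) \<and>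
     (\<forall>u \<in> U. \<forall>g \<in> G. proj P (sec g u) = u \<and> crd (sec g u) = g \<and>
        (\<forall>c \<in> G. act P c (sec g u) = sec (c * g) u)) \<and>
     (\<forall>e \<in> topspace (total P). proj P e \<in> U \<longrightarrow> crd e \<in> G \<and> sec (crd e) (proj P e) = e)"

lemma continuous_map_locally:
  assumes "\<And>x. x \<in> topspace X \<Longrightarrow> \<exists>V. openin X V \<and> x \<in> V \<and> continuous_map (subtopology X V) Y f"
  shows "continuous_map X Y f"
proof -
  from assms obtain V where V: "\<And>x. x \<in> topspace X \<Longrightarrow>
      openin X (V x) \<and> x \<in> V x \<and> continuous_map (subtopology X (V x)) Y f"
    by metis
  show ?thesis
    by (rule pasting_lemma[where I = "topspace X" and T = V and f = "\<lambda>_. f"]) (use V in auto)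
qed

text \<open>The structure group is a parameter because the same lifting theory serves the bundles
  whose group is all nonzero rationals and the orientation double cover, whose group is {1,
  -1}.\<close>

locale rat_bundle =
  fixes G :: "rat set" and X :: "'x topology" and P :: "('e, 'x) Q_bundle"
  assumes one_G: "1 \<in> G"
    and zero_notin_G: "0 \<notin> G"
    and mult_G: "a \<in> G \<Longrightarrow> b \<in> G \<Longrightarrow> a * b \<in> G"
    and inverse_G: "a \<in> G \<Longrightarrow> inverse a \<in> G"
    and proj_continuous: "continuous_map (total P) X (proj P)"
    and trivializations: "x \<in> topspace X \<Longrightarrow>
      \<exists>U sec crd. x \<in> U \<and> local_trivialization G X P U sec crd"
begin

section \<open>The action on the fibers\<close>

lemma proj_in: "e \<in> topspace (total P) \<Longrightarrow> proj P e \<in> topspace X"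
  using proj_continuous by (auto simp: continuous_map_def)

lemma trivialization_at:
  assumes "x \<in> topspace X"
  obtains U sec crd where "x \<in> U" "openin X U" "U \<subseteq> topspace X"
    "\<And>g. g \<in> G \<Longrightarrow> continuous_map (subtopology X U) (total P) (sec g)"
    "\<And>g. g \<in> G \<Longrightarrow> openin (total P) {e \<in> topspace (total P). proj P e \<in> U \<and> crd e = g}"
    "\<And>u g. u \<in> U \<Longrightarrow> g \<in> G \<Longrightarrow> proj P (sec g u) = u"
    "\<And>u g. u \<in> U \<Longrightarrow> g \<in> G \<Longrightarrow> crd (sec g u) = g"
    "\<And>u g. u \<in> U \<Longrightarrow> g \<in> G \<Longrightarrow> sec g u \<in> topspace (total P)"
    "\<And>u g c. u \<in> U \<Longrightarrow> g \<in> G \<Longrightarrow> c \<in> G \<Longrightarrow> act P c (sec g u) = sec (c * g) u"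
    "\<And>e. e \<in> topspace (total P) \<Longrightarrow> proj P e \<in> U \<Longrightarrow> crd e \<in> G"
    "\<And>e. e \<in> topspace (total P) \<Longrightarrow> proj P e \<in> U \<Longrightarrow> sec (crd e) (proj P e) = e"
proof -
  obtain U sec crd where U: "x \<in> U" "local_trivialization G X P U sec crd"
    using trivializations assms by blast
  then have UX: "U \<subseteq> topspace X"
    by (meson local_trivialization_def openin_subset)
  moreover have "\<And>u g. u \<in> U \<Longrightarrow> g \<in> G \<Longrightarrow> sec g u \<in> topspace (total P)"
    using U(2) UX unfolding local_trivialization_def continuous_map_def Pi_def by auto
  ultimately show ?thesis
    using U that[of U sec crd] unfolding local_trivialization_def by blast
qed

lemma act_total:
  assumes "e \<in> topspace (total P)" "c \<in> G"
  shows "act P c e \<in> topspace (total P)" and "proj P (act P c e) = proj P e"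
proof -
  obtain U sec crd where U: "proj P e \<in> U"
    "\<And>u g. u \<in> U \<Longrightarrow> g \<in> G \<Longrightarrow> proj P (sec g u) = u"
    "\<And>u g. u \<in> U \<Longrightarrow> g \<in> G \<Longrightarrow> sec g u \<in> topspace (total P)"
    "\<And>u g c. u \<in> U \<Longrightarrow> g \<in> G \<Longrightarrow> c \<in> G \<Longrightarrow> act P c (sec g u) = sec (c * g) u"
    "\<And>e. e \<in> topspace (total P) \<Longrightarrow> proj P e \<in> U \<Longrightarrow> crd e \<in> G"
    "\<And>e. e \<in> topspace (total P) \<Longrightarrow> proj P e \<in> U \<Longrightarrow> sec (crd e) (proj P e) = e"
    by (rule trivialization_at[OF proj_in[OF assms(1)]]) blast
  have "act P c e = sec (c * crd e) (proj P e)"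
    using U assms by metis
  then show "act P c e \<in> topspace (total P)" and "proj P (act P c e) = proj P e"
    using U assms mult_G by auto
qed

lemma act_one [simp]:
  assumes "e \<in> topspace (total P)"
  shows "act P 1 e = e"
proof -
  obtain U sec crd where U: "proj P e \<in> U"
    "\<And>u g c. u \<in> U \<Longrightarrow> g \<in> G \<Longrightarrow> c \<in> G \<Longrightarrow> act P c (sec g u) = sec (c * g) u"
    "\<And>e. e \<in> topspace (total P) \<Longrightarrow> proj P e \<in> U \<Longrightarrow> crd e \<in> G"
    "\<And>e. e \<in> topspace (total P) \<Longrightarrow> proj P e \<in> U \<Longrightarrow> sec (crd e) (proj P e) = e"
    by (rule trivialization_at[OF proj_in[OF assms]]) blast
  then show ?thesis
    by (metis assms mult_1 one_G)
qed

lemma act_act: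
  assumes "e \<in> topspace (total P)" "c \<in> G" "d \<in> G"
  shows "act P c (act P d e) = act P (c * d) e"
proof -
  obtain U sec crd where U: "proj P e \<in> U"
    "\<And>u g c. u \<in> U \<Longrightarrow> g \<in> G \<Longrightarrow> c \<in> G \<Longrightarrow> act P c (sec g u) = sec (c * g) u"
    "\<And>e. e \<in> topspace (total P) \<Longrightarrow> proj P e \<in> U \<Longrightarrow> crd e \<in> G"
    "\<And>e. e \<in> topspace (total P) \<Longrightarrow> proj P e \<in> U \<Longrightarrow> sec (crd e) (proj P e) = e"
    by (rule trivialization_at[OF proj_in[OF assms(1)]]) blast
  have g: "crd e \<in> G" and e: "e = sec (crd e) (proj P e)"
    using U assms by auto
  have "act P c (act P d (sec (crd e) (proj P e))) = act P (c * d) (sec (crd e) (proj P e))"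
    using U(1) g assms mult_G by (simp add: U(2) mult.assoc)
  then show ?thesis
    using e by simp
qed

lemma act_cancel:
  assumes "e \<in> topspace (total P)" "c \<in> G" "d \<in> G" "act P c e = act P d e"
  shows "c = d"
proof -
  obtain U sec crd where U: "proj P e \<in> U"
    "\<And>u g. u \<in> U \<Longrightarrow> g \<in> G \<Longrightarrow> crd (sec g u) = g"
    "\<And>u g c. u \<in> U \<Longrightarrow> g \<in> G \<Longrightarrow> c \<in> G \<Longrightarrow> act P c (sec g u) = sec (c * g) u"
    "\<And>e. e \<in> topspace (total P) \<Longrightarrow> proj P e \<in> U \<Longrightarrow> crd e \<in> G"
    "\<And>e. e \<in> topspace (total P) \<Longrightarrow> proj P e \<in> U \<Longrightarrow> sec (crd e) (proj P e) = e"
    by (rule trivialization_at[OF proj_in[OF assms(1)]]) blast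
  have g: "crd e \<in> G" and e: "e = sec (crd e) (proj P e)"
    using U assms by auto
  have "sec (c * crd e) (proj P e) = sec (d * crd e) (proj P e)"
    using assms U(1) g e U(3) by metis
  then have "c * crd e = d * crd e"
    using U(1) g assms U(2) mult_G by metis
  then show ?thesis
    using g zero_notin_G by auto
qed

lemma fibre_transitive:
  assumes "e \<in> topspace (total P)" "e' \<in> topspace (total P)" "proj P e = proj P e'"
  obtains c where "c \<in> G" "e' = act P c e"
proof -
  obtain U sec crd where U: "proj P e \<in> U"
    "\<And>u g c. u \<in> U \<Longrightarrow> g \<in> G \<Longrightarrow> c \<in> G \<Longrightarrow> act P c (sec g u) = sec (c * g) u"
    "\<And>e. e \<in> topspace (total P) \<Longrightarrow> proj P e \<in> U \<Longrightarrow> crd e \<in> G"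
    "\<And>e. e \<in> topspace (total P) \<Longrightarrow> proj P e \<in> U \<Longrightarrow> sec (crd e) (proj P e) = e"
    by (rule trivialization_at[OF proj_in[OF assms(1)]]) blast
  have g: "crd e \<in> G" "crd e' \<in> G" and e: "e = sec (crd e) (proj P e)" "e' = sec (crd e') (proj P e)"
    using U(1,3,4) assms by metis+
  define c where "c = crd e' * inverse (crd e)"
  have "c * crd e = crd e'"
    using g zero_notin_G by (auto simp: c_def field_simps)
  moreover have c: "c \<in> G"
    unfolding c_def using g by (intro mult_G inverse_G)
  ultimately have "e' = act P c e"
    using g e U(1,2) by metis
  then show ?thesis
    using that c by blast
qed

lemma fibre_nonempty:
  assumes "x \<in> topspace X"
  obtains e where "e \<in> topspace (total P)" "proj P e = x"
  by (rule trivialization_at[OF assms]) (use one_G that in blast)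

text \<open>Continuity is local on the total space. On the open sheet where the fiber coordinate
  equals g, acting by c is projecting to the base and applying the section of coordinate c *
  g.\<close>

lemma act_continuous:
  assumes c: "c \<in> G"
  shows "continuous_map (total P) (total P) (act P c)"
proof (rule continuous_map_locally)
  fix e assume e: "e \<in> topspace (total P)"
  obtain U sec crd where U: "proj P e \<in> U" "openin X U"
    "\<And>g. g \<in> G \<Longrightarrow> continuous_map (subtopology X U) (total P) (sec g)"
    "\<And>g. g \<in> G \<Longrightarrow> openin (total P) {e \<in> topspace (total P). proj P e \<in> U \<and> crd e = g}"
    "\<And>u g c. u \<in> U \<Longrightarrow> g \<in> G \<Longrightarrow> c \<in> G \<Longrightarrow> act P c (sec g u) = sec (c * g) u"
    "\<And>e. e \<in> topspace (total P) \<Longrightarrow> proj P e \<in> U \<Longrightarrow> crd e \<in> G"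
    "\<And>e. e \<in> topspace (total P) \<Longrightarrow> proj P e \<in> U \<Longrightarrow> sec (crd e) (proj P e) = e"
    by (rule trivialization_at[OF proj_in[OF e]]) blast
  define g where "g = crd e"
  define V where "V = {e \<in> topspace (total P). proj P e \<in> U \<and> crd e = g}"
  have g: "g \<in> G"
    using U e by (simp add: g_def)
  have "continuous_map (subtopology (total P) V) (subtopology X U) (proj P)"
    using proj_continuous by (auto simp: continuous_map_in_subtopology V_def continuous_map_from_subtopology)
  then have "continuous_map (subtopology (total P) V) (total P) (sec (c * g) \<circ> proj P)"
    using U(3)[OF mult_G[OF c g]] by (rule continuous_map_compose)
  moreover have "(sec (c * g) \<circ> proj P) e = act P c e" if "e \<in> topspace (subtopology (total P) V)" for e
    using that U(5,7) c g unfolding V_def by (auto; metis)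
  ultimately have "continuous_map (subtopology (total P) V) (total P) (act P c)"
    by (rule continuous_map_eq)
  moreover have "openin (total P) V" "e \<in> V"
    using U e g by (auto simp: V_def g_def)
  ultimately show "\<exists>V. openin (total P) V \<and> e \<in> V \<and>
      continuous_map (subtopology (total P) V) (total P) (act P c)"
    by blast
qed

text \<open>Near a given point both lifts stay in sheets of constant fiber coordinate over one
  trivializing set. Points over the same base point are equal exactly when their coordinates are, so
  equality and inequality both persist nearby.\<close>

lemma openin_lifts_eq:
  assumes F: "continuous_map Z (total P) F" and F': "continuous_map Z (total P) F'"
    and eq: "\<And>z. z \<in> topspace Z \<Longrightarrow> proj P (F z) = proj P (F' z)"
  shows "openin Z {z \<in> topspace Z. F z = F' z}" and "openin Z {z \<in> topspace Z. F z \<noteq> F' z}"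
proof -
  have *: "\<exists>N. openin Z N \<and> z \<in> N \<and> (\<forall>y \<in> N. F y = F' y \<longleftrightarrow> F z = F' z)"
    if z: "z \<in> topspace Z" for z
  proof -
    have e: "F z \<in> topspace (total P)" "F' z \<in> topspace (total P)"
      using F F' z by (auto simp: continuous_map_def)
    obtain U sec crd where U: "proj P (F z) \<in> U" "openin X U"
      "\<And>g. g \<in> G \<Longrightarrow> openin (total P) {e \<in> topspace (total P). proj P e \<in> U \<and> crd e = g}"
      "\<And>e. e \<in> topspace (total P) \<Longrightarrow> proj P e \<in> U \<Longrightarrow> crd e \<in> G"
      "\<And>e. e \<in> topspace (total P) \<Longrightarrow> proj P e \<in> U \<Longrightarrow> sec (crd e) (proj P e) = e"
      by (rule trivialization_at[OF proj_in[OF e(1)]]) blast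
    define V where "V H = {y \<in> topspace Z. H y \<in> {e \<in> topspace (total P). proj P e \<in> U \<and> crd e = crd (H z)}}"
      for H :: "_ \<Rightarrow> 'e"
    have op: "openin Z (V F)" "openin Z (V F')"
      unfolding V_def
      using openin_continuous_map_preimage[OF F U(3)] openin_continuous_map_preimage[OF F' U(3)]
        U(1,4) e eq z by simp_all
    have zV: "z \<in> V F \<inter> V F'"
      using z e U(1) eq by (auto simp: V_def)
    have "F y = F' y \<longleftrightarrow> F z = F' z" if "y \<in> V F \<inter> V F'" for y
      using that U(5) eq z e U(1) unfolding V_def by (auto; metis)
    then show ?thesis
      using op zV by (metis openin_Int)
  qed
  have sub: "\<And>N. openin Z N \<Longrightarrow> N \<subseteq> topspace Z"
    by (rule openin_subset)
  show "openin Z {z \<in> topspace Z. F z = F' z}"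
  proof (subst openin_subopen, clarify)
    fix z assume "z \<in> topspace Z" "F z = F' z"
    then obtain N where "openin Z N" "z \<in> N" "\<forall>y \<in> N. F y = F' y"
      using *[of z] by auto
    then show "\<exists>T. openin Z T \<and> z \<in> T \<and> T \<subseteq> {z \<in> topspace Z. F z = F' z}"
      using sub[of N] by (intro exI[of _ N]) auto
  qed
  show "openin Z {z \<in> topspace Z. F z \<noteq> F' z}"
  proof (subst openin_subopen, clarify)
    fix z assume "z \<in> topspace Z" "F z \<noteq> F' z"
    then obtain N where "openin Z N" "z \<in> N" "\<forall>y \<in> N. F y \<noteq> F' y"
      using *[of z] by auto
    then show "\<exists>T. openin Z T \<and> z \<in> T \<and> T \<subseteq> {z \<in> topspace Z. F z \<noteq> F' z}"
      using sub[of N] by (intro exI[of _ N]) auto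
  qed
qed

lemma lifts_eq_on_connected:
  assumes "continuous_map Z (total P) F" "continuous_map Z (total P) F'"
    and "\<And>z. z \<in> topspace Z \<Longrightarrow> proj P (F z) = proj P (F' z)"
    and "connected_space Z" "z0 \<in> topspace Z" "F z0 = F' z0" "z \<in> topspace Z"
  shows "F z = F' z"
proof (rule ccontr)
  assume "F z \<noteq> F' z"
  then have "{z \<in> topspace Z. F z \<noteq> F' z} \<noteq> {}" "{z \<in> topspace Z. F z = F' z} \<noteq> {}"
    using assms by auto
  then show False
    using openin_lifts_eq[OF assms(1-3)] \<open>connected_space Z\<close>
    unfolding connected_space_def by blast
qed

lemma lift_in_trivialization:
  assumes f: "continuous_map Z X f"
    and U: "local_trivialization G X P U sec crd" "f \<in> topspace Z \<rightarrow> U"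
  shows "\<exists>F. continuous_map Z (total P) F \<and> (\<forall>z \<in> topspace Z. proj P (F z) = f z)"
proof (intro exI conjI)
  have "continuous_map Z (subtopology X U) f"
    using f U by (auto simp: continuous_map_in_subtopology)
  then show "continuous_map Z (total P) (sec 1 \<circ> f)"
    using U one_G unfolding local_trivialization_def by (auto intro: continuous_map_compose)
  show "\<forall>z \<in> topspace Z. proj P ((sec 1 \<circ> f) z) = f z"
    using U one_G unfolding local_trivialization_def by auto
qed

section \<open>Merging partial lifts\<close>

definition liftable_on :: "('z::topological_space \<Rightarrow> 'x) \<Rightarrow> 'z set \<Rightarrow> bool" where
  "liftable_on f A \<longleftrightarrow> (\<exists>F. continuous_map (top_of_set A) (total P) F \<and> (\<forall>z \<in> A. proj P (F z) = f z))"

text \<open>A group element matches the second lift to the first at one common point; uniqueness on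
  the connected set \<open>A \<inter> B\<close> extends the match to the whole overlap, and
  closedness of both sets permits pasting.\<close>

lemma liftable_on_Un:
  assumes A: "closed A" "liftable_on f A" and B: "closed B" "liftable_on f B"
    and AB: "connected (A \<inter> B)" "A \<inter> B \<noteq> {}"
  shows "liftable_on f (A \<union> B)"
proof -
  obtain F1 where F1: "continuous_map (top_of_set A) (total P) F1" "\<And>z. z \<in> A \<Longrightarrow> proj P (F1 z) = f z"
    using A by (auto simp: liftable_on_def)
  obtain F2 where F2: "continuous_map (top_of_set B) (total P) F2" "\<And>z. z \<in> B \<Longrightarrow> proj P (F2 z) = f z"
    using B by (auto simp: liftable_on_def)
  obtain z0 where z0: "z0 \<in> A" "z0 \<in> B"
    using AB by blast
  have t1: "F1 z \<in> topspace (total P)" if "z \<in> A" for z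
    using F1 that by (auto simp: continuous_map_def)
  have t2: "F2 z \<in> topspace (total P)" if "z \<in> B" for z
    using F2 that by (auto simp: continuous_map_def)
  obtain c where c: "c \<in> G" "F1 z0 = act P c (F2 z0)"
    using fibre_transitive[of "F2 z0" "F1 z0"] z0 t1 t2 F1 F2 by metis
  define F3 where "F3 = act P c \<circ> F2"
  have F3: "continuous_map (top_of_set B) (total P) F3" "\<And>z. z \<in> B \<Longrightarrow> proj P (F3 z) = f z"
    using F2 act_continuous[OF c(1)] act_total(2)[OF t2 c(1)]
    unfolding F3_def by (auto intro: continuous_map_compose)
  have eq: "F1 z = F3 z" if "z \<in> A" "z \<in> B" for z
  proof (rule lifts_eq_on_connected[where Z = "top_of_set (A \<inter> B)" and F = F1 and F' = F3 and ?z0.0 = z0])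
    show "continuous_map (top_of_set (A \<inter> B)) (total P) F1"
      using continuous_map_from_subtopology_mono[OF F1(1)] by blast
    show "continuous_map (top_of_set (A \<inter> B)) (total P) F3"
      using continuous_map_from_subtopology_mono[OF F3(1)] by blast
    show "connected_space (top_of_set (A \<inter> B))"
      using AB by (simp add: connectedin_def flip: connectedin_iff_connected)
    show "F1 z0 = F3 z0"
      by (simp add: F3_def c)
  qed (use z0 that F1 F3 in auto)
  define F where "F z = (if z \<in> A then F1 z else F3 z)" for z
  have "continuous_map (top_of_set (A \<union> B)) (total P) F"
  proof (rule pasting_lemma_closed[where I = "{True, False}" and T = "\<lambda>b. if b then A else B"
        and f = "\<lambda>b. if b then F1 else F3"])
    show "closedin (top_of_set (A \<union> B)) (if b then A else B)" for b
      using A B by (auto intro: closed_subset)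
    show "continuous_map (subtopology (top_of_set (A \<union> B)) (if b then A else B)) (total P)
        (if b then F1 else F3)" for b
      using F1(1) F3(1) by (auto simp: subtopology_subtopology Int_absorb1)
    show "\<And>z. z \<in> topspace (top_of_set (A \<union> B)) \<Longrightarrow>
        \<exists>j. j \<in> {True, False} \<and> z \<in> (if j then A else B) \<and> F z = (if j then F1 else F3) z"
      by (auto simp: F_def)
  qed (auto simp: eq split: if_splits)
  moreover have "\<forall>z \<in> A \<union> B. proj P (F z) = f z"
    using F1(2) F3(2) by (auto simp: F_def)
  ultimately show ?thesis
    unfolding liftable_on_def by (intro exI[of _ F] conjI)
qed

end

section \<open>Path lifting and holonomy\<close>

context rat_bundle begin

text \<open>A Lebesgue number makes every small rectangle liftable. Merging goes by Bolzano's
  interval induction, once along a strip of small height and once across the strips; neighboring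
  rectangles meet in a segment, so their overlap is connected.\<close>

theorem liftable_on_square:
  fixes f :: "real \<times> real \<Rightarrow> 'x"
  assumes f: "continuous_map (top_of_set ({0..1} \<times> {0..1})) X f"
  shows "liftable_on f ({0..1} \<times> {0..1})"
proof -
  let ?Q = "{0..1::real} \<times> {0..1::real}"
  define \<C> where "\<C> = {B. open B \<and> (\<exists>U sec crd. local_trivialization G X P U sec crd \<and> f ` (?Q \<inter> B) \<subseteq> U)}"
  have cov: "?Q \<subseteq> \<Union>\<C>"
  proof
    fix z assume z: "z \<in> ?Q"
    then have "f z \<in> topspace X"
      using continuous_map_funspace[OF f] by auto
    then obtain U sec crd where U: "f z \<in> U" "local_trivialization G X P U sec crd"
      using trivializations by blast
    then have "openin (top_of_set ?Q) {x \<in> topspace (top_of_set ?Q). f x \<in> U}"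
      by (intro openin_continuous_map_preimage[OF f]) (simp add: local_trivialization_def)
    then obtain B where B: "open B" "{x \<in> topspace (top_of_set ?Q). f x \<in> U} = ?Q \<inter> B"
      unfolding openin_open by (elim exE conjE)
    have "f ` (?Q \<inter> B) \<subseteq> U" "z \<in> B"
      using B(2) z U(1) by auto
    then have "B \<in> \<C>"
      using B(1) U(2) unfolding \<C>_def mem_Collect_eq by (intro conjI exI)
    then show "z \<in> \<Union>\<C>"
      using \<open>z \<in> B\<close> by (rule UnionI)
  qed
  have ne: "\<C> \<noteq> {}"
    using cov by auto
  have cmp: "compact ?Q" and op: "\<And>B. B \<in> \<C> \<Longrightarrow> open B"
    by (simp_all add: compact_Times \<C>_def)
  obtain \<epsilon> where eps: "0 < \<epsilon>" "\<And>T. T \<subseteq> ?Q \<Longrightarrow> diameter T < \<epsilon> \<Longrightarrow> \<exists>B \<in> \<C>. T \<subseteq> B"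
    by (rule Lebesgue_number_lemma[OF cmp ne cov op]) (assumption, rule that)
  \<comment> \<open>Sides below \<epsilon> / 3 bound the diameter by 2 \<epsilon> / 3, strictly less
    than the Lebesgue number.\<close>
  have small: "liftable_on f ({a..b} \<times> {c..d})"
    if "{a..b} \<times> {c..d} \<subseteq> ?Q" "a \<le> b" "c \<le> d" "b - a < \<epsilon> / 3" "d - c < \<epsilon> / 3" for a b c d
  proof -
    have "diameter ({a..b} \<times> {c..d}) \<le> \<epsilon> / 3 + \<epsilon> / 3"
    proof (rule diameter_le)
      fix x y assume "x \<in> {a..b} \<times> {c..d}" "y \<in> {a..b} \<times> {c..d}"
      then have "a \<le> fst x" "fst x \<le> b" "a \<le> fst y" "fst y \<le> b"
        "c \<le> snd x" "snd x \<le> d" "c \<le> snd y" "snd y \<le> d"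
        by auto
      then have "\<bar>fst x - fst y\<bar> \<le> \<epsilon> / 3" "\<bar>snd x - snd y\<bar> \<le> \<epsilon> / 3"
        using that by linarith+
      moreover have "norm (x - y) \<le> norm (fst (x - y)) + norm (snd (x - y))"
        by (metis norm_Pair_le prod.collapse)
      ultimately show "norm (x - y) \<le> \<epsilon> / 3 + \<epsilon> / 3"
        by (auto simp: dist_norm fst_diff snd_diff)
    qed (use eps in auto)
    then have "diameter ({a..b} \<times> {c..d}) < \<epsilon>"
      using eps(1) by linarith
    from eps(2)[OF that(1) this] obtain B where B: "B \<in> \<C>" "{a..b} \<times> {c..d} \<subseteq> B"
      by blast
    then obtain U sec crd where U: "local_trivialization G X P U sec crd" "f ` (?Q \<inter> B) \<subseteq> U"
      by (auto simp: \<C>_def)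
    have "continuous_map (top_of_set ({a..b} \<times> {c..d})) X f"
      using continuous_map_from_subtopology_mono[OF f that(1)] .
    then show ?thesis
      using lift_in_trivialization[OF _ U(1), of "top_of_set ({a..b} \<times> {c..d})" f] U(2) B(2) that(1)
      by (simp add: liftable_on_def image_subset_iff Pi_iff subset_iff)
  qed
  have strip: "liftable_on f ({0..1} \<times> {c..d})"
    if "{c..d} \<subseteq> {0..1}" "c \<le> d" "d - c < \<epsilon> / 3" for c d
  proof -
    \<comment> \<open>The guard makes \<open>L\<close> hold vacuously for intervals that leave
      [0, 1], since \<open>Bolzano\<close> asks about all small real intervals around a
      point.\<close>
    define L where "L a b \<longleftrightarrow> (0 \<le> a \<and> b \<le> 1 \<and> a \<le> b \<longrightarrow> liftable_on f ({a..b} \<times> {c..d}))" for a b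
    have "L 0 1"
    proof (rule Bolzano)
      fix x y z assume L: "L x y" "L y z" "x \<le> y" "y \<le> z"
      have eq: "{x..y} \<times> {c..d} \<inter> {y..z} \<times> {c..d} = {y} \<times> {c..d}"
        "{x..y} \<times> {c..d} \<union> {y..z} \<times> {c..d} = {x..z} \<times> {c..d}"
        using L(3,4) by auto
      show "L x z"
        unfolding L_def
      proof
        assume "0 \<le> x \<and> z \<le> 1 \<and> x \<le> z"
        then have "liftable_on f ({x..y} \<times> {c..d})" "liftable_on f ({y..z} \<times> {c..d})"
          using L by (auto simp: L_def)
        then show "liftable_on f ({x..z} \<times> {c..d})"
          using liftable_on_Un[of "{x..y} \<times> {c..d}" f "{y..z} \<times> {c..d}"] that(2)
          unfolding eq by (auto simp: closed_Times connected_Times)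
      qed
    next
      fix x :: real
      show "\<exists>dd>0. \<forall>a b. a \<le> x \<and> x \<le> b \<and> b - a < dd \<longrightarrow> L a b"
      proof (intro exI conjI allI impI)
      fix a b assume ab: "a \<le> x \<and> x \<le> b \<and> b - a < \<epsilon> / 3"
      show "L a b"
        unfolding L_def
      proof
        assume "0 \<le> a \<and> b \<le> 1 \<and> a \<le> b"
        then have "{a..b} \<times> {c..d} \<subseteq> ?Q"
          using that(1) by (intro Sigma_mono) auto
        then show "liftable_on f ({a..b} \<times> {c..d})"
          using small ab that(2,3) by simp
      qed
    qed (use eps in simp)
    qed simp
    then show ?thesis
      by (simp add: L_def)
  qed
  define L where "L c d \<longleftrightarrow> (0 \<le> c \<and> d \<le> 1 \<and> c \<le> d \<longrightarrow> liftable_on f ({0..1} \<times> {c..d}))" for c d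
  have "L 0 1"
  proof (rule Bolzano)
    fix x y z assume L: "L x y" "L y z" "x \<le> y" "y \<le> z"
    have eq: "{0..1} \<times> {x..y} \<inter> {0..1} \<times> {y..z} = {0..1::real} \<times> {y}"
      "{0..1} \<times> {x..y} \<union> {0..1} \<times> {y..z} = {0..1::real} \<times> {x..z}"
      using L(3,4) by auto
    show "L x z"
      unfolding L_def
    proof
      assume "0 \<le> x \<and> z \<le> 1 \<and> x \<le> z"
      then have "liftable_on f ({0..1} \<times> {x..y})" "liftable_on f ({0..1} \<times> {y..z})"
        using L by (auto simp: L_def)
      then show "liftable_on f ({0..1} \<times> {x..z})"
        using liftable_on_Un[of "{0..1} \<times> {x..y}" f "{0..1} \<times> {y..z}"]
        unfolding eq by (auto simp: closed_Times connected_Times)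
    qed
  next
    fix x :: real
    show "\<exists>dd>0. \<forall>a b. a \<le> x \<and> x \<le> b \<and> b - a < dd \<longrightarrow> L a b"
    proof (intro exI conjI allI impI)
      fix a b assume ab: "a \<le> x \<and> x \<le> b \<and> b - a < \<epsilon> / 3"
      show "L a b"
        unfolding L_def
      proof
        assume "0 \<le> a \<and> b \<le> 1 \<and> a \<le> b"
        then have "{a..b} \<subseteq> {0..1}"
          by auto
        then show "liftable_on f ({0..1} \<times> {a..b})"
          using strip ab by simp
      qed
    qed (use eps in simp)
  qed simp
  then show ?thesis
    by (simp add: L_def)
qed

text \<open>The square also settles paths: \<open>\<alpha> \<circ> fst\<close> is a map of the
  square, its lift restricted to the bottom side lifts \<alpha>, and a translation moves the initial
  point to e.\<close>

lemma path_lift: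
  assumes \<alpha>: "pathin X \<alpha>" and e: "e \<in> topspace (total P)" "proj P e = \<alpha> 0"
  obtains \<beta> where "is_lift P \<alpha> \<beta>" "\<beta> 0 = e"
proof -
  have "continuous_map (top_of_set ({0..1::real} \<times> {0..1::real})) (top_of_set {0..1}) fst"
    by (auto simp: continuous_on_fst)
  then have "continuous_map (top_of_set ({0..1::real} \<times> {0..1::real})) X (\<alpha> \<circ> fst)"
    using \<alpha> unfolding pathin_def by (rule continuous_map_compose)
  then obtain F where F: "continuous_map (top_of_set ({0..1::real} \<times> {0..1::real})) (total P) F"
    "\<And>z. z \<in> {0..1} \<times> {0..1} \<Longrightarrow> proj P (F z) = \<alpha> (fst z)"
    using liftable_on_square unfolding liftable_on_def by (metis comp_apply)
  have F00: "F (0, 0) \<in> topspace (total P)"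
    using continuous_map_funspace[OF F(1)] by auto
  obtain c where c: "c \<in> G" "e = act P c (F (0, 0))"
    using fibre_transitive[OF F00 e(1)] F(2)[of "(0, 0)"] e(2) by auto
  have "continuous_map (top_of_set {0..1}) (top_of_set ({0..1} \<times> {0..1})) (\<lambda>t::real. (t, 0::real))"
    by (auto intro: continuous_intros)
  from continuous_map_compose[OF continuous_map_compose[OF this F(1)] act_continuous[OF c(1)]]
  have "continuous_map (top_of_set {0..1}) (total P) (\<lambda>t. act P c (F (t, 0)))"
    by (simp add: o_def)
  moreover have "proj P (act P c (F (t, 0))) = \<alpha> t" if "t \<in> {0..1}" for t
    using act_total(2)[OF _ c(1), of "F (t, 0)"] continuous_map_funspace[OF F(1)] F(2)[of "(t, 0)"] that
    by (simp add: Pi_iff)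
  ultimately have "is_lift P \<alpha> (\<lambda>t. act P c (F (t, 0)))"
    by (simp add: is_lift_def pathin_def)
  then show ?thesis
    by (rule that) (simp add: c(2))
qed

section \<open>Lifts of paths and their holonomy\<close>

lemma is_lift_total: "is_lift P \<alpha> \<beta> \<Longrightarrow> t \<in> {0..1} \<Longrightarrow> \<beta> t \<in> topspace (total P)"
  unfolding is_lift_def pathin_def using continuous_map_funspace by fastforce

lemma is_lift_proj: "is_lift P \<alpha> \<beta> \<Longrightarrow> t \<in> {0..1} \<Longrightarrow> proj P (\<beta> t) = \<alpha> t"
  by (simp add: is_lift_def)

lemma is_lift_act:
  assumes "is_lift P \<alpha> \<beta>" "c \<in> G"
  shows "is_lift P \<alpha> (\<lambda>t. act P c (\<beta> t))"
  using assms act_total(2)[OF is_lift_total[OF assms(1)] assms(2)] act_continuous[OF assms(2)]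
    continuous_map_compose[of _ _ \<beta> _ "act P c"]
  by (auto simp: is_lift_def pathin_def o_def)

lemma is_lift_unique:
  assumes "is_lift P \<alpha> \<beta>" "is_lift P \<alpha> \<beta>'" "\<beta> 0 = \<beta>' 0" "t \<in> {0..1}"
  shows "\<beta> t = \<beta>' t"
proof (rule lifts_eq_on_connected[where Z = "top_of_set {0..1}" and F = \<beta> and F' = \<beta>' and ?z0.0 = 0])
  show "connected_space (top_of_set {0..1::real})"
    by (simp add: connected_space_subtopology)
qed (use assms in \<open>auto simp: is_lift_def pathin_def\<close>)

text \<open>An arbitrary choice of a point in every fiber, without any continuity. It is the
  reference against which a path that is not closed gets a number as holonomy; along a cycle the
  choices cancel.\<close>

definition base_lift :: "'x \<Rightarrow> 'e" where
  "base_lift x = (SOME e. e \<in> topspace (total P) \<and> proj P e = x)"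

lemma base_lift:
  assumes "x \<in> topspace X"
  shows "base_lift x \<in> topspace (total P)" "proj P (base_lift x) = x"
proof -
  have "\<exists>e. e \<in> topspace (total P) \<and> proj P e = x"
    using fibre_nonempty[OF assms] by blast
  from someI_ex[OF this] show "base_lift x \<in> topspace (total P)" "proj P (base_lift x) = x"
    by (simp_all add: base_lift_def)
qed

definition holonomy :: "(real \<Rightarrow> 'x) \<Rightarrow> rat" where
  "holonomy \<alpha> = (SOME c. c \<in> G \<and> (\<exists>\<beta>. is_lift P \<alpha> \<beta> \<and>
     \<beta> 0 = base_lift (\<alpha> 0) \<and> \<beta> 1 = act P c (base_lift (\<alpha> 1))))"

text \<open>Translating \<beta> by the inverse of u yields the lift that starts at the base lift. It
  ends at the translate of the base lift by w / u, and uniqueness of lifts leaves no other value for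
  the choice in \<open>holonomy\<close>.\<close>

lemma holonomy_eq:
  assumes \<beta>: "is_lift P \<alpha> \<beta>" and u: "u \<in> G" "\<beta> 0 = act P u (base_lift (\<alpha> 0))"
    and w: "w \<in> G" "\<beta> 1 = act P w (base_lift (\<alpha> 1))"
  shows "holonomy \<alpha> = w / u"
proof -
  have \<alpha>: "\<alpha> 0 \<in> topspace X" "\<alpha> 1 \<in> topspace X"
    using is_lift_total[OF \<beta>] is_lift_proj[OF \<beta>] proj_in by (metis atLeastAtMost_iff order_refl zero_le_one)+
  note b = base_lift(1)[OF \<alpha>(1)] base_lift(1)[OF \<alpha>(2)]
  have u0: "u \<noteq> 0"
    using u zero_notin_G by auto
  define \<gamma> where "\<gamma> = (\<lambda>t. act P (inverse u) (\<beta> t))"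
  have \<gamma>: "is_lift P \<alpha> \<gamma>" "\<gamma> 0 = base_lift (\<alpha> 0)" "\<gamma> 1 = act P (w / u) (base_lift (\<alpha> 1))"
    using is_lift_act[OF \<beta>] u w b u0 inverse_G
    by (auto simp: \<gamma>_def act_act divide_inverse mult.commute)
  have wu: "w / u \<in> G"
    using u w mult_G inverse_G by (simp add: divide_inverse)
  show ?thesis
    unfolding holonomy_def
  proof (rule some_equality)
    fix c
    assume "c \<in> G \<and> (\<exists>\<beta>. is_lift P \<alpha> \<beta> \<and> \<beta> 0 = base_lift (\<alpha> 0) \<and> \<beta> 1 = act P c (base_lift (\<alpha> 1)))"
    then obtain \<delta> where \<delta>: "c \<in> G" "is_lift P \<alpha> \<delta>" "\<delta> 0 = base_lift (\<alpha> 0)"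
      "\<delta> 1 = act P c (base_lift (\<alpha> 1))"
      by blast
    have "\<delta> 1 = \<gamma> 1"
      using is_lift_unique[OF \<delta>(2) \<gamma>(1), of 1] \<delta>(3) \<gamma>(2) by simp
    then show "c = w / u"
      using act_cancel[OF b(2) \<delta>(1) wu] \<delta>(4) \<gamma>(3) by simp
  qed (use \<gamma> wu in blast)
qed

text \<open>Both ends of a loop are compared with the same base lift, so the coordinate u of the
  initial point cancels.\<close>

lemma holonomy_loop:
  assumes "is_lift P \<alpha> \<beta>" "\<alpha> 0 = \<alpha> 1" "c \<in> G" "\<beta> 1 = act P c (\<beta> 0)"
  shows "holonomy \<alpha> = c"
proof -
  have \<alpha>: "\<alpha> 0 \<in> topspace X" and \<beta>0: "\<beta> 0 \<in> topspace (total P)" "proj P (\<beta> 0) = \<alpha> 0"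
    using is_lift_total[OF assms(1), of 0] is_lift_proj[OF assms(1), of 0] proj_in[of "\<beta> 0"] by auto
  obtain u where u: "u \<in> G" "\<beta> 0 = act P u (base_lift (\<alpha> 0))"
    using fibre_transitive[OF base_lift(1)[OF \<alpha>] \<beta>0(1)] \<beta>0(2) base_lift(2)[OF \<alpha>] by auto
  have "holonomy \<alpha> = (c * u) / u"
    using assms u base_lift(1)[OF \<alpha>] mult_G
    by (intro holonomy_eq[OF assms(1)]) (auto simp: act_act)
  then show ?thesis
    using u zero_notin_G by auto
qed

text \<open>The parametrization by barycentric coordinates (1 - t, t), so that the simplex in
  \<open>loop_class\<close> gives back the loop.\<close>

definition edge_path :: "((nat \<Rightarrow> real) \<Rightarrow> 'x) \<Rightarrow> real \<Rightarrow> 'x" where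
  "edge_path \<tau> t = \<tau> (\<lambda>i. if i = 0 then 1 - t else if i = 1 then t else 0)"

text \<open>The square is mapped onto the 2-simplex by collapsing one side to the zeroth vertex; the other
  three sides are mapped to the faces.\<close>

lemma holonomy_triangle:
  assumes f: "singular_simplex 2 X f"
  defines "h k \<equiv> holonomy (edge_path (singular_face 2 k f))"
  shows "h 0 * h 2 = h 1" and "h 0 \<in> G" "h 1 \<in> G" "h 2 \<in> G"
proof -
  \<comment> \<open>The side s = 1 becomes the face opposite to vertex 0, the side t = 1 the face
    opposite to vertex 1, and the side t = 0 the face opposite to vertex 2.\<close>
  define r :: "real \<times> real \<Rightarrow> nat \<Rightarrow> real" where
    "r = (\<lambda>(s, t) i. if i = 0 then 1 - s else if i = 1 then s * (1 - t) else if i = 2 then s * t else 0)"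
  let ?Q = "{0..1::real} \<times> {0..1::real}"
  have r_in: "r z \<in> standard_simplex 2" if "z \<in> ?Q" for z
  proof -
    obtain s t where z: "z = (s, t)" "0 \<le> s" "s \<le> 1" "0 \<le> t" "t \<le> 1"
      using \<open>z \<in> ?Q\<close> by auto
    then have st: "0 \<le> s * t" "s * t \<le> s"
      by (simp_all add: mult_left_le)
    then have "s \<le> 1 + s * t" "s * t \<le> 1"
      using z by linarith+
    with st show ?thesis
      using z by (simp add: r_def standard_simplex_def numeral_2_eq_2 algebra_simps)
  qed
  have "continuous_on ?Q (\<lambda>z. r z k)" for k
    by (cases "k = 0"; cases "k = 1"; cases "k = 2")
      (auto simp: r_def case_prod_unfold intro!: continuous_intros)
  then have "continuous_map (top_of_set ?Q) (powertop_real UNIV) r"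
    by (simp add: continuous_map_componentwise_UNIV)
  then have "continuous_map (top_of_set ?Q) (subtopology (powertop_real UNIV) (standard_simplex 2)) r"
    using r_in by (auto simp: continuous_map_in_subtopology)
  moreover have "continuous_map (subtopology (powertop_real UNIV) (standard_simplex 2)) X f"
    using f by (simp add: singular_simplex_def)
  ultimately have "continuous_map (top_of_set ?Q) X (f \<circ> r)"
    by (rule continuous_map_compose)
  then obtain F where F: "continuous_map (top_of_set ?Q) (total P) F"
    and Fr: "\<And>z. z \<in> ?Q \<Longrightarrow> proj P (F z) = f (r z)"
    using liftable_on_square unfolding liftable_on_def by (metis comp_apply)
  have Ft: "F z \<in> topspace (total P)" if "z \<in> ?Q" for z
    using continuous_map_funspace[OF F] that by auto
  have r0: "r (0, t) = r (0, 0)" for t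
    by (simp add: r_def fun_eq_iff)
  \<comment> \<open>On the collapsed side the map is constant, so its lift agrees with a constant
    one. Hence the lifts of the faces 1 and 2 start at the same point.\<close>
  have "F (0, 0) = F (0, 1)"
  proof (rule lifts_eq_on_connected[where Z = "top_of_set {0..1}" and F = "\<lambda>t. F (0, 0)"
        and F' = "\<lambda>t. F (0, t)" and ?z0.0 = 0])
    have "continuous_map (top_of_set {0..1}) (top_of_set ?Q) (\<lambda>t::real. (0::real, t))"
      by (auto intro: continuous_intros)
    from continuous_map_compose[OF this F]
    show "continuous_map (top_of_set {0..1}) (total P) (\<lambda>t. F (0, t))"
      by (simp add: o_def)
    show "proj P (F (0, 0)) = proj P (F (0, t))" if "t \<in> topspace (top_of_set {0..1})" for t
      using that Fr[of "(0, 0)"] Fr[of "(0, t)"] by (simp add: r0[of t])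
  qed (auto simp: connected_space_subtopology Ft)
  have side: "is_lift P (edge_path (singular_face 2 k f)) (\<lambda>t. F (q t))"
    if "continuous_on {0..1} q" "\<And>t. t \<in> {0..1} \<Longrightarrow> q t \<in> ?Q"
      and q: "\<And>t. t \<in> {0..1} \<Longrightarrow> r (q t) = simplical_face k (\<lambda>i. if i = 0 then 1 - t else if i = 1 then t else 0)"
    for q k
  proof -
    have "continuous_map (top_of_set {0..1}) (top_of_set ?Q) q"
      using that(1,2) by (simp add: Pi_iff)
    from continuous_map_compose[OF this F]
    have "continuous_map (top_of_set {0..1}) (total P) (\<lambda>t. F (q t))"
      by (simp add: o_def)
    moreover have "edge_path (singular_face 2 k f) t = f (r (q t))" if "t \<in> {0..1}" for t
    proof -
      have "(\<lambda>i. if i = 0 then 1 - t else if i = 1 then t else 0) \<in> standard_simplex (2 - Suc 0)"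
        using that by (auto simp: standard_simplex_def)
      then show ?thesis
        using q[OF that] by (simp add: edge_path_def singular_face_def)
    qed
    ultimately show ?thesis
      using that(2) Fr by (simp add: is_lift_def pathin_def)
  qed
  have lifts: "is_lift P (edge_path (singular_face 2 0 f)) (\<lambda>t. F (1, t))"
    "is_lift P (edge_path (singular_face 2 1 f)) (\<lambda>t. F (t, 1))"
    "is_lift P (edge_path (singular_face 2 2 f)) (\<lambda>t. F (t, 0))"
    by (rule side; force simp: r_def simplical_face_def fun_eq_iff intro!: continuous_intros)+
  define x where "x z = f (r z)" for z
  have xX: "x z \<in> topspace X" if "z \<in> ?Q" for z
    using that Fr Ft proj_in by (metis x_def)
  have "\<exists>u. u \<in> G \<and> F z = act P u (base_lift (x z))" if "z \<in> ?Q" for z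
    using fibre_transitive[OF base_lift(1)[OF xX[OF that]] Ft[OF that]] Fr[OF that] base_lift(2)[OF xX[OF that]]
    by (metis x_def)
  then obtain u where u: "\<And>z. z \<in> ?Q \<Longrightarrow> u z \<in> G \<and> F z = act P (u z) (base_lift (x z))"
    by metis
  have ends: "edge_path (singular_face 2 0 f) 0 = x (1, 0)" "edge_path (singular_face 2 0 f) 1 = x (1, 1)"
    "edge_path (singular_face 2 1 f) 0 = x (0, 1)" "edge_path (singular_face 2 1 f) 1 = x (1, 1)"
    "edge_path (singular_face 2 2 f) 0 = x (0, 0)" "edge_path (singular_face 2 2 f) 1 = x (1, 0)"
    by (simp_all add: x_def Fr is_lift_proj[OF lifts(1), symmetric] is_lift_proj[OF lifts(2), symmetric]
        is_lift_proj[OF lifts(3), symmetric] del: One_nat_def)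
  have "x (0, 1) = x (0, 0)"
    by (simp add: x_def r0[of 1])
  then have u01: "u (0, 1) = u (0, 0)"
    using u[of "(0, 1)"] u[of "(0, 0)"] \<open>F (0, 0) = F (0, 1)\<close> act_cancel[OF base_lift(1)[OF xX[of "(0, 0)"]]]
    by auto
  \<comment> \<open>Each face contributes the quotient of u at its two corners, so the product along
    the edges from 0 to 1 and from 1 to 2 telescopes to the quotient for the edge from 0 to
    2.\<close>
  have h0: "h 0 = u (1, 1) / u (1, 0)"
    unfolding h_def by (rule holonomy_eq[OF lifts(1)]) (simp_all add: ends u del: One_nat_def)
  have h1: "h 1 = u (1, 1) / u (0, 1)"
    unfolding h_def by (rule holonomy_eq[OF lifts(2)]) (simp_all add: ends u del: One_nat_def)
  have h2: "h 2 = u (1, 0) / u (0, 0)"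
    unfolding h_def by (rule holonomy_eq[OF lifts(3)]) (simp_all add: ends u del: One_nat_def)
  note h = h0 h1 h2
  show "h 0 * h 2 = h 1"
    using u[of "(1, 0)"] zero_notin_G by (auto simp: h u01 simp del: One_nat_def)
  show "h 0 \<in> G" "h 1 \<in> G" "h 2 \<in> G"
    unfolding h divide_inverse using u by (auto intro!: mult_G inverse_G)
qed

end

section \<open>From holonomy to a character of the first homology group\<close>

lemma comm_group_Qx: "comm_group Qx"
proof (rule comm_groupI)
  show "\<exists>y \<in> carrier Qx. y \<otimes>\<^bsub>Qx\<^esub> x = \<one>\<^bsub>Qx\<^esub>" if "x \<in> carrier Qx" for x
    using that by (intro bexI[of _ "inverse x"]) (auto simp: Qx_def)
qed (auto simp: Qx_def)

context rat_bundle begin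

text \<open>\<open>Qx\<close> is commutative, so the holonomies of 1-simplices extend to the free
  abelian group of chains. The boundary of a 2-simplex goes to the product of the holonomies of the
  faces 0 and 2 divided by that of the face 1, which is 1 by the triangle relation.\<close>

lemma holonomy_hom_on_chains:
  obtains h where "\<And>c d. singular_chain 1 X c \<Longrightarrow> singular_chain 1 X d \<Longrightarrow> h (c + d) = h c * h d"
    and "\<And>c. singular_chain 1 X c \<Longrightarrow> h c \<noteq> 0"
    and "\<And>\<tau>. singular_simplex 1 X \<tau> \<Longrightarrow> holonomy (edge_path \<tau>) \<noteq> 0 \<Longrightarrow> h (frag_of \<tau>) = holonomy (edge_path \<tau>)"
    and "\<And>d. singular_chain 2 X d \<Longrightarrow> h (chain_boundary 2 d) = 1"
proof -
  \<comment> \<open>The default 1 makes k nonzero on every simplex at once. The faces of 2-simplices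
    and the simplices of liftable loops have nonzero holonomy, so on them k is the holonomy.\<close>
  define k where "k \<tau> = (if holonomy (edge_path \<tau>) = 0 then 1 else holonomy (edge_path \<tau>))" for \<tau>
  have "k ` singular_simplex_set 1 X \<subseteq> carrier Qx"
    by (auto simp: k_def Qx_def)
  then obtain h where h: "h \<in> hom (free_Abelian_group (singular_simplex_set 1 X)) Qx"
    and hk: "\<And>\<tau>. \<tau> \<in> singular_simplex_set 1 X \<Longrightarrow> h (frag_of \<tau>) = k \<tau>"
    by (rule comm_group.free_Abelian_group_universal[OF comm_group_Qx]) blast
  have add: "h (c + d) = h c * h d" if "singular_chain 1 X c" "singular_chain 1 X d" for c d
    using h that by (simp add: hom_def singular_chain_def Qx_def)
  have nz: "h c \<noteq> 0" if "singular_chain 1 X c" for c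
    using h that by (auto simp: hom_def singular_chain_def Qx_def)
  have h0: "h 0 = 1"
    using add[of 0 0] nz[of 0] by auto
  have diff: "h (c - d) = h c / h d" if "singular_chain 1 X c" "singular_chain 1 X d" for c d
    using add[of "c - d" d] nz[of d] that by (simp add: singular_chain_diff eq_divide_eq)
  have bd: "h (chain_boundary 2 d) = 1" if "singular_chain 2 X d" for d
  proof -
    have "Poly_Mapping.keys d \<subseteq> singular_simplex_set 2 X"
      using that by (simp add: singular_chain_def)
    then show ?thesis
    proof (rule free_Abelian_group_induct[where P = "\<lambda>d. h (chain_boundary 2 d) = 1"])
      show "h (chain_boundary 2 0) = 1"
        by (simp add: h0)
    next
      fix x y :: "'x chain"
      assume xy: "Poly_Mapping.keys x \<subseteq> singular_simplex_set 2 X" "Poly_Mapping.keys y \<subseteq> singular_simplex_set 2 X"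
        "h (chain_boundary 2 x) = 1" "h (chain_boundary 2 y) = 1"
      then have "singular_chain 1 X (chain_boundary 2 x)" "singular_chain 1 X (chain_boundary 2 y)"
        using singular_chain_boundary[of 2 X] by (auto simp: singular_chain_def[of 2])
      then show "h (chain_boundary 2 (x - y)) = 1"
        using xy by (simp add: chain_boundary_diff diff)
    next
      fix f assume "f \<in> singular_simplex_set 2 X"
      then have f: "singular_simplex 2 X f"
        by simp
      define s where "s j = singular_face 2 j f" for j
      have s: "singular_simplex 1 X (s j)" if "j \<le> 2" for j
        using singular_simplex_singular_face[OF f, of j] that by (simp add: s_def)
      then have sc: "singular_chain 1 X (frag_of (s j))" if "j \<le> 2" for j
        using that by (simp add: singular_chain_of)
      note tri = holonomy_triangle[OF f, folded s_def]
      have hs: "h (frag_of (s j)) = holonomy (edge_path (s j))" if "j \<in> {0, 1, 2}" for j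
        using hk[of "s j"] s[of j] tri that zero_notin_G by (auto simp: k_def)
      have "chain_boundary 2 (frag_of f) = frag_of (s 0) - frag_of (s 1) + frag_of (s 2)"
        by (simp add: chain_boundary_of s_def numeral_2_eq_2)
      then have "h (chain_boundary 2 (frag_of f)) = h (frag_of (s 0)) / h (frag_of (s 1)) * h (frag_of (s 2))"
        using sc by (simp add: add diff singular_chain_diff)
      also have "\<dots> = 1"
        using hs tri zero_notin_G by (auto simp: divide_simps)
      finally show "h (chain_boundary 2 (frag_of f)) = 1" .
    qed
  qed
  show ?thesis
    by (rule that[of h]) (use add nz hk bd in \<open>auto simp: k_def\<close>)
qed

text \<open>The class of a loop is represented by a 1-cycle, because the two faces of the simplex are equal.\<close>

lemma loop_simplex:
  assumes "loop_in X \<alpha>"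
  defines "\<tau> \<equiv> restrict (\<lambda>y. \<alpha> (y 1)) (standard_simplex 1)"
  shows "singular_simplex 1 X \<tau>" and "singular_relcycle 1 X {} (frag_of \<tau>)"
    and "t \<in> {0..1} \<Longrightarrow> edge_path \<tau> t = \<alpha> t"
proof -
  have "continuous_map (subtopology (powertop_real UNIV) (standard_simplex 1)) (top_of_set {0..1}) (\<lambda>y. y 1)"
    by (auto simp: continuous_map_in_subtopology standard_simplex_def
        intro!: continuous_map_from_subtopology continuous_map_product_projection)
  then have "continuous_map (subtopology (powertop_real UNIV) (standard_simplex 1)) X (\<alpha> \<circ> (\<lambda>y. y 1))"
    using assms(1) continuous_map_compose unfolding loop_in_def pathin_def by blast
  then have "continuous_map (subtopology (powertop_real UNIV) (standard_simplex 1)) X \<tau>"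
    by (rule continuous_map_eq) (simp add: \<tau>_def)
  then show s: "singular_simplex 1 X \<tau>"
    by (simp add: singular_simplex_def \<tau>_def)
  have "singular_face 1 0 \<tau> = singular_face 1 1 \<tau>"
    using assms(1) simplical_face_in_standard_simplex[of 1 0] simplical_face_in_standard_simplex[of 1 1]
    by (auto simp: singular_face_def \<tau>_def standard_simplex_0 simplical_face_def loop_in_def fun_eq_iff restrict_def)
  then have "chain_boundary 1 (frag_of \<tau>) = 0"
    by (simp add: chain_boundary_of)
  then show "singular_relcycle 1 X {} (frag_of \<tau>)"
    using s by (simp add: singular_cycle singular_chain_of)
  show "edge_path \<tau> t = \<alpha> t" if "t \<in> {0..1}"
  proof -
    have "(\<lambda>i. if i = 0 then 1 - t else if i = 1 then t else 0) \<in> standard_simplex 1"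
      using that by (auto simp: standard_simplex_def)
    then show ?thesis
      by (simp add: edge_path_def \<tau>_def)
  qed
qed

text \<open>Homologous chains differ by a boundary, on which h is 1, so h may be evaluated on any
  representative of a class; the choice operator picks one.\<close>

lemma homology_character:
  obtains \<sigma> where "\<sigma> \<in> hom (homology_group 1 X) Qx"
    and "\<And>\<alpha> \<beta> c. loop_in X \<alpha> \<Longrightarrow> is_lift P \<alpha> \<beta> \<Longrightarrow> c \<in> G \<Longrightarrow> \<beta> 1 = act P c (\<beta> 0) \<Longrightarrow>
      \<sigma> (loop_class X \<alpha>) = c"
proof -
  obtain h where add: "\<And>c d. singular_chain 1 X c \<Longrightarrow> singular_chain 1 X d \<Longrightarrow> h (c + d) = h c * h d"
    and nz: "\<And>c. singular_chain 1 X c \<Longrightarrow> h c \<noteq> 0"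
    and hol: "\<And>\<tau>. singular_simplex 1 X \<tau> \<Longrightarrow> holonomy (edge_path \<tau>) \<noteq> 0 \<Longrightarrow>
      h (frag_of \<tau>) = holonomy (edge_path \<tau>)"
    and bd: "\<And>d. singular_chain 2 X d \<Longrightarrow> h (chain_boundary 2 d) = 1"
    using holonomy_hom_on_chains by blast
  have inv: "h c' = h c" if "singular_chain 1 X c" "homologous_rel 1 X {} c c'" for c c'
  proof -
    have c': "singular_chain 1 X c'"
      using homologous_rel_singular_chain that by blast
    from that(2) obtain d where d: "singular_chain 2 X d" "chain_boundary 2 d = c - c'"
      by (auto simp: homologous_rel_def singular_boundary numeral_2_eq_2)
    have "h c = h (c' + chain_boundary 2 d)"
      by (simp add: d)
    also have "\<dots> = h c' * h (chain_boundary 2 d)"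
      using add[OF c', of "chain_boundary 2 d"] singular_chain_boundary[OF d(1)] by simp
    finally show ?thesis
      using bd[OF d(1)] by simp
  qed
  define \<sigma> where "\<sigma> A = h (SOME c. c \<in> A)" for A
  have \<sigma>: "\<sigma> (homologous_rel_set 1 X {} c) = h c" if "singular_chain 1 X c" for c
    unfolding \<sigma>_def
  proof (rule someI2[where a = c])
    show "h c' = h c" if "c' \<in> homologous_rel_set 1 X {} c" for c'
      using inv[OF \<open>singular_chain 1 X c\<close>, of c'] that by simp
  qed simp
  show ?thesis
  proof (rule that[of \<sigma>])
    have car: "carrier (homology_group 1 X) = homologous_rel_set 1 X {} ` singular_relcycle_set 1 X {}"
      using carrier_relative_homology_group[of 1 X "{}"] by simp
    \<comment> \<open>The product of two classes is again a class because the carrier is closed; it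
      contains a + b, which identifies it.\<close>
    have mult: "homologous_rel_set 1 X {} a \<otimes>\<^bsub>homology_group 1 X\<^esub> homologous_rel_set 1 X {} b =
        homologous_rel_set 1 X {} (a + b)" if "singular_relcycle 1 X {} a" "singular_relcycle 1 X {} b" for a b
    proof -
      let ?H = "homology_group 1 X"
      have "homologous_rel_set 1 X {} a \<otimes>\<^bsub>?H\<^esub> homologous_rel_set 1 X {} b \<in> carrier ?H"
        using that car group.is_monoid[OF group_relative_homology_group] monoid.m_closed by (metis image_eqI mem_Collect_eq)
      then obtain c where c: "homologous_rel_set 1 X {} a \<otimes>\<^bsub>?H\<^esub> homologous_rel_set 1 X {} b = homologous_rel_set 1 X {} c"
        using car by auto
      have "a + b \<in> homologous_rel_set 1 X {} a \<otimes>\<^bsub>?H\<^esub> homologous_rel_set 1 X {} b"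
        unfolding mult_relative_homology_group[of 1 X "{}", unfolded of_nat_1]
        by (rule UN_I[of a], simp, rule UN_I[of b]) simp_all
      then have "homologous_rel 1 X {} c (a + b)"
        using c by auto
      then show ?thesis
        unfolding c by (simp add: homologous_rel_set_eq)
    qed
    show "\<sigma> \<in> hom (homology_group 1 X) Qx"
    proof (rule homI)
      fix A assume "A \<in> carrier (homology_group 1 X)"
      then show "\<sigma> A \<in> carrier Qx"
        unfolding car using nz \<sigma> by (auto simp: Qx_def singular_cycle)
    next
      fix A B assume "A \<in> carrier (homology_group 1 X)" "B \<in> carrier (homology_group 1 X)"
      then obtain a b where ab: "singular_relcycle 1 X {} a" "singular_relcycle 1 X {} b"
        "A = homologous_rel_set 1 X {} a" "B = homologous_rel_set 1 X {} b"
        unfolding car by auto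
      then have "singular_chain 1 X a" "singular_chain 1 X b"
        by (auto simp: singular_cycle)
      then show "\<sigma> (A \<otimes>\<^bsub>homology_group 1 X\<^esub> B) = \<sigma> A \<otimes>\<^bsub>Qx\<^esub> \<sigma> B"
        unfolding ab(3,4) mult[OF ab(1,2)] by (simp add: \<sigma> singular_chain_add add Qx_def del: One_nat_def)
    qed
    fix \<alpha> \<beta> c
    assume \<alpha>: "loop_in X \<alpha>" and \<beta>: "is_lift P \<alpha> \<beta>" "c \<in> G" "\<beta> 1 = act P c (\<beta> 0)"
    define \<tau> where "\<tau> = restrict (\<lambda>y. \<alpha> (y 1)) (standard_simplex 1)"
    note \<tau> = loop_simplex[OF \<alpha>, folded \<tau>_def]
    have "holonomy (edge_path \<tau>) = c"
      using \<alpha> \<beta> by (intro holonomy_loop[of _ \<beta>]) (auto simp: is_lift_def \<tau>(3) loop_in_def)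
    then have "h (frag_of \<tau>) = c"
      using hol[OF \<tau>(1)] \<beta>(2) zero_notin_G by metis
    then show "\<sigma> (loop_class X \<alpha>) = c"
      using \<sigma>[of "frag_of \<tau>"] \<tau>(1) by (simp add: loop_class_def \<tau>_def singular_chain_of del: One_nat_def)
  qed
qed

end

text \<open>The homomorphism just constructed witnesses the property by which
  \<open>spirality_character\<close> is chosen, so the chosen one has this property as well.\<close>

theorem spirality_character_loop:
  assumes "rat_bundle {q. q \<noteq> 0} X P" "loop_in X \<alpha>" "is_lift P \<alpha> \<beta>" "c \<noteq> 0" "\<beta> 1 = act P c (\<beta> 0)"
  shows "spirality_character X P (loop_class X \<alpha>) = c"
proof -
  interpret rat_bundle "{q. q \<noteq> 0}" X P
    by fact
  obtain \<sigma> where "\<sigma> \<in> hom (homology_group 1 X) Qx"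
    "\<And>\<alpha> \<beta> c. loop_in X \<alpha> \<Longrightarrow> is_lift P \<alpha> \<beta> \<Longrightarrow> c \<in> {q. q \<noteq> 0} \<Longrightarrow> \<beta> 1 = act P c (\<beta> 0) \<Longrightarrow>
      \<sigma> (loop_class X \<alpha>) = c"
    using homology_character by blast
  then have "\<exists>\<sigma>. \<sigma> \<in> hom (homology_group 1 X) Qx \<and>
        (\<forall>\<alpha> \<beta> c. loop_in X \<alpha> \<and> is_lift P \<alpha> \<beta> \<and> c \<noteq> 0 \<and> \<beta> 1 = act P c (\<beta> 0) \<longrightarrow>
           \<sigma> (loop_class X \<alpha>) = c)"
    by (intro exI[of _ \<sigma>] conjI allI impI) blast+
  from someI_ex[OF this] show ?thesis
    using assms(2-) unfolding spirality_character_def by blast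
qed

section \<open>Bundles obtained by gluing and twisting\<close>

text \<open>A trivializing homeomorphism \<theta> gives the sections, by fixing the second argument,
  and through its inverse the coordinate, whose level sets are open because G is discrete.\<close>

lemma rat_bundle_principal_bundle:
  assumes P: "principal_bundle G X P"
    and G: "1 \<in> G" "0 \<notin> G" "\<And>a b. a \<in> G \<Longrightarrow> b \<in> G \<Longrightarrow> a * b \<in> G" "\<And>a. a \<in> G \<Longrightarrow> inverse a \<in> G"
  shows "rat_bundle G X P"
proof
  show con: "continuous_map (total P) X (proj P)"
    using P by (simp add: principal_bundle_def)
  fix x assume "x \<in> topspace X"
  then obtain U \<theta> where U: "openin X U" "x \<in> U"
    and \<theta>: "homeomorphic_map (prod_topology (subtopology X U) (discrete_topology G))
        (subtopology (total P) {e \<in> topspace (total P). proj P e \<in> U}) \<theta>"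
    and act': "\<forall>u \<in> U. \<forall>a \<in> G. proj P (\<theta> (u, a)) = u \<and>
          (\<forall>c \<in> G. act P c (\<theta> (u, a)) = \<theta> (u, c * a))"
    using P unfolding principal_bundle_def by blast
  then have act: "\<And>u a. u \<in> U \<Longrightarrow> a \<in> G \<Longrightarrow> proj P (\<theta> (u, a)) = u"
      "\<And>u a c. u \<in> U \<Longrightarrow> a \<in> G \<Longrightarrow> c \<in> G \<Longrightarrow> act P c (\<theta> (u, a)) = \<theta> (u, c * a)"
    by simp_all
  let ?E = "subtopology (total P) {e \<in> topspace (total P). proj P e \<in> U}"
  have UX: "U \<subseteq> topspace X"
    using U(1) by (rule openin_subset)
  obtain \<theta>' where \<theta>': "homeomorphic_maps (prod_topology (subtopology X U) (discrete_topology G)) ?E \<theta> \<theta>'"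
    using \<theta> homeomorphic_map_maps by blast
  then have \<theta>'_con: "continuous_map ?E (prod_topology (subtopology X U) (discrete_topology G)) \<theta>'"
    by (simp add: homeomorphic_maps_def)
  have \<theta>'_in: "snd (\<theta>' e) \<in> G" "\<theta> (\<theta>' e) = e" "fst (\<theta>' e) \<in> U"
    if "e \<in> topspace (total P)" "proj P e \<in> U" for e
  proof -
    have "\<theta>' \<in> topspace ?E \<rightarrow> U \<times> G"
      using UX continuous_map_funspace[OF \<theta>'_con] by (simp add: Int_absorb1)
    then show "snd (\<theta>' e) \<in> G" "fst (\<theta>' e) \<in> U"
      using that by (auto simp: Pi_iff mem_Times_iff)
    show "\<theta> (\<theta>' e) = e"
      using \<theta>' that by (simp add: homeomorphic_maps_def)
  qed
  have \<theta>'_\<theta>: "\<theta>' (\<theta> (u, a)) = (u, a)" if "u \<in> U" "a \<in> G" for u a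
    using \<theta>' that UX by (auto simp: homeomorphic_maps_def)
  have fst_\<theta>': "fst (\<theta>' e) = proj P e" if "e \<in> topspace (total P)" "proj P e \<in> U" for e
    using act(1)[of "fst (\<theta>' e)" "snd (\<theta>' e)"] \<theta>'_in[OF that] by simp
  have opE: "openin (total P) {e \<in> topspace (total P). proj P e \<in> U}"
    using con U(1) by (rule openin_continuous_map_preimage)
  have "local_trivialization G X P U (\<lambda>g u. \<theta> (u, g)) (\<lambda>e. snd (\<theta>' e))"
    unfolding local_trivialization_def
  proof (intro conjI ballI impI)
    show "openin X U" by fact
    show "continuous_map (subtopology X U) (total P) (\<lambda>u. \<theta> (u, g))" if "g \<in> G" for g
    proof -
      have "continuous_map (subtopology X U) (prod_topology (subtopology X U) (discrete_topology G)) (\<lambda>u. (u, g))"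
        using that by (simp add: continuous_map_pairwise o_def)
      moreover have "continuous_map (prod_topology (subtopology X U) (discrete_topology G)) (total P) \<theta>"
        using \<theta>' by (simp add: homeomorphic_maps_def continuous_map_in_subtopology)
      ultimately have "continuous_map (subtopology X U) (total P) (\<theta> \<circ> (\<lambda>u. (u, g)))"
        by (rule continuous_map_compose)
      then show ?thesis
        by (simp add: o_def)
    qed
    show "openin (total P) {e \<in> topspace (total P). proj P e \<in> U \<and> snd (\<theta>' e) = g}" if "g \<in> G" for g
    proof -
      have c': "continuous_map ?E (discrete_topology G) (snd \<circ> \<theta>')"
        by (rule continuous_map_compose[OF \<theta>'_con continuous_map_snd])
      have "openin ?E {e \<in> topspace ?E. (snd \<circ> \<theta>') e \<in> {g}}"
        using that by (intro openin_continuous_map_preimage[OF c']) simp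
      moreover have "{e \<in> topspace ?E. (snd \<circ> \<theta>') e \<in> {g}} =
          {e \<in> topspace (total P). proj P e \<in> U \<and> snd (\<theta>' e) = g}"
        by auto
      ultimately have "openin ?E {e \<in> topspace (total P). proj P e \<in> U \<and> snd (\<theta>' e) = g}"
        by simp
      then show ?thesis
        using opE by (rule openin_trans_full)
    qed
    fix u g assume "u \<in> U" "g \<in> G"
    then show "proj P (\<theta> (u, g)) = u" "snd (\<theta>' (\<theta> (u, g))) = g"
      by (simp_all add: act(1) \<theta>'_\<theta>)
    show "act P c (\<theta> (u, g)) = \<theta> (u, c * g)" if "c \<in> G" for c
      using act(2) \<open>u \<in> U\<close> \<open>g \<in> G\<close> that by simp
  next
    fix e assume e: "e \<in> topspace (total P)" "proj P e \<in> U"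
    then show "snd (\<theta>' e) \<in> G"
      by (rule \<theta>'_in)
    show "\<theta> (proj P e, snd (\<theta>' e)) = e"
      using \<theta>'_in(2)[OF e] by (simp flip: fst_\<theta>'[OF e])
  qed
  then show "\<exists>U sec crd. x \<in> U \<and> local_trivialization G X P U sec crd"
    using U(2) by blast
qed (use G in auto)

section \<open>Quotient spaces and maps into discrete spaces\<close>

lemma quotient_map_quotient_topology:
  "quotient_map X (quotient_topology X r) (\<lambda>x. r `` {x})"
  and topspace_quotient_topology: "topspace (quotient_topology X r) = (\<lambda>x. r `` {x}) ` topspace X"
proof -
  have img: "(\<lambda>x. r `` {x}) ` topspace X = topspace X // r"
    by (auto simp: quotient_def)
  have "{x \<in> topspace X. r `` {x} \<in> topspace X // r} = topspace X"
    by (auto simp: quotient_def)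
  then have "openin (quotient_topology X r) (topspace X // r)"
    by (simp add: openin_quotient_topology)
  then have top: "topspace (quotient_topology X r) = topspace X // r"
    by (meson openin_quotient_topology openin_subset openin_topspace subset_antisym)
  then show "topspace (quotient_topology X r) = (\<lambda>x. r `` {x}) ` topspace X"
    by (simp add: img)
  show "quotient_map X (quotient_topology X r) (\<lambda>x. r `` {x})"
    unfolding quotient_map_def top by (simp add: img openin_quotient_topology)
qed

lemma openin_quotient_mapD:
  assumes "quotient_map X Y f" "V \<subseteq> topspace Y" "openin X {x \<in> topspace X. f x \<in> V}"
  shows "openin Y V"
  using assms by (simp add: quotient_map_def)

lemma openin_topspace_subtopology_Int:
  assumes "openin X U"
  shows "openin (subtopology X S) (topspace (subtopology X S) \<inter> U)"
proof -
  have "topspace (subtopology X S) \<inter> U = U \<inter> S"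
    using openin_subset[OF assms] by auto
  then show ?thesis
    using openin_subtopology_Int[OF assms] by simp
qed

lemma continuous_map_into_discrete:
  assumes "\<And>x. x \<in> topspace X \<Longrightarrow> f x \<in> A" "\<And>a. a \<in> A \<Longrightarrow> openin X {x \<in> topspace X. f x = a}"
  shows "continuous_map X (discrete_topology A) f"
proof -
  have "openin X {x \<in> topspace X. f x \<in> U}" if "U \<subseteq> A" for U
  proof -
    have "{x \<in> topspace X. f x \<in> U} = (\<Union>a \<in> U. {x \<in> topspace X. f x = a})"
      by auto
    moreover have "openin X \<dots>"
      using assms(2) that by (intro openin_Union) auto
    ultimately show ?thesis
      by simp
  qed
  then show ?thesis
    using assms(1) by (auto simp: continuous_map_def)
qed

text \<open>The weights \<open>w\<close> straighten the gluing over \<open>W\<close>: in the coordinate \<open>w x * a\<close> the points over \<open>W\<close>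
  are identified without scaling.\<close>

definition gluing_weights ::
    "'c topology \<Rightarrow> 'x topology \<Rightarrow> ('c \<Rightarrow> 'x) \<Rightarrow> (('c \<times> rat) \<times> ('c \<times> rat)) set \<Rightarrow> 'x set \<Rightarrow> ('c \<Rightarrow> rat) \<Rightarrow> bool"
where
  "gluing_weights C X \<kappa> r W w \<longleftrightarrow>
     openin X W \<and> (\<forall>g. openin C {x \<in> topspace C. \<kappa> x \<in> W \<and> w x = g}) \<and>
     (\<forall>x \<in> topspace C. \<kappa> x \<in> W \<longrightarrow> w x \<noteq> 0) \<and>
     (\<forall>x \<in> topspace C. \<forall>y \<in> topspace C. \<forall>a b. \<kappa> x \<in> W \<longrightarrow> \<kappa> x = \<kappa> y \<longrightarrow>
         (((x, a), (y, b)) \<in> r \<longleftrightarrow> w x * a = w y * b))"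

text \<open>By the weight condition \<open>w x * a\<close> takes one value on the points of a class
  that lie over \<open>topspace C\<close>, so it is a fiber coordinate on the quotient; the section
  of coordinate g sends \<open>\<kappa> x\<close> to the class of \<open>(x, g / w x)\<close>.
  Continuity and openness pass down because \<kappa> and the projection to classes are quotient
  maps.\<close>

lemma rat_bundle_gluing:
  fixes r :: "(('c \<times> rat) \<times> ('c \<times> rat)) set"
  assumes quo: "quotient_map C X \<kappa>"
    and r: "equiv UNIV r"
    and r_\<kappa>: "\<And>x a y b. ((x, a), (y, b)) \<in> r \<Longrightarrow> \<kappa> x = \<kappa> y"
    and r_scale: "\<And>x a y b c. ((x, a), (y, b)) \<in> r \<Longrightarrow> ((x, c * a), (y, c * b)) \<in> r"
    and weights: "\<And>p. p \<in> topspace X \<Longrightarrow> \<exists>W w. p \<in> W \<and> gluing_weights C X \<kappa> r W w"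
  defines "P \<equiv> \<lparr>total = quotient_topology (prod_topology C (discrete_topology {q. q \<noteq> 0})) r,
      proj = (\<lambda>e. \<kappa> (fst (SOME z. z \<in> e))), act = (\<lambda>c e. (\<lambda>(x, a). (x, c * a)) ` e)\<rparr>"
  shows "rat_bundle {q. q \<noteq> 0} X P"
    and "continuous_map (prod_topology C (discrete_topology {q. q \<noteq> 0})) (total P) (\<lambda>z. r `` {z})"
    and "proj P (r `` {(x, a)}) = \<kappa> x"
    and "c \<noteq> 0 \<Longrightarrow> act P c (r `` {(x, a)}) = r `` {(x, c * a)}"
proof -
  let ?E = "prod_topology C (discrete_topology {q::rat. q \<noteq> 0})"
  have quE: "quotient_map ?E (total P) (\<lambda>z. r `` {z})"
    by (simp add: P_def quotient_map_quotient_topology)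
  then show conE: "continuous_map ?E (total P) (\<lambda>z. r `` {z})"
    by (rule quotient_imp_continuous_map)
  have topP: "topspace (total P) = (\<lambda>z. r `` {z}) ` (topspace C \<times> {q. q \<noteq> 0})"
    by (simp add: P_def topspace_quotient_topology)
  have eq: "r `` {z} = r `` {z'} \<longleftrightarrow> (z, z') \<in> r" for z z'
    using r by (simp add: eq_equiv_class_iff)
  have self: "z \<in> r `` {z}" for z
    using equiv_class_self[OF r] by simp
  show projP: "proj P (r `` {(x, a)}) = \<kappa> x" for x a
  proof -
    have "(SOME z. z \<in> r `` {(x, a)}) \<in> r `` {(x, a)}"
      using self by (rule someI)
    then show ?thesis
      unfolding P_def using r_\<kappa>[of x a] by (metis Image_singleton_iff prod.collapse select_convs(2))
  qed
  \<comment> \<open>\<open>act\<close> scales all members of a class. That the result is a whole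
    class uses the invariance of the relation under scaling by c and by its inverse.\<close>
  show actP: "act P c (r `` {(x, a)}) = r `` {(x, c * a)}" if c: "c \<noteq> 0" for x a c
  proof -
    have "((x, a), (y, b / c)) \<in> r" if "((x, c * a), (y, b)) \<in> r" for y b
      using r_scale[OF that, of "inverse c"] c by (simp add: field_simps)
    note unscale = this
    show ?thesis
    proof (intro equalityI subsetI)
      fix z assume "z \<in> act P c (r `` {(x, a)})"
      then obtain y b where "((x, a), (y, b)) \<in> r" "z = (y, c * b)"
        by (auto simp: P_def)
      then show "z \<in> r `` {(x, c * a)}"
        using r_scale by simp
    next
      fix z assume z: "z \<in> r `` {(x, c * a)}"
      obtain y b where yb: "z = (y, b)"
        by (cases z)
      then have "(y, b / c) \<in> r `` {(x, a)}"
        using unscale z by simp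
      then have "(\<lambda>(x, a). (x, c * a)) (y, b / c) \<in> (\<lambda>(x, a). (x, c * a)) ` (r `` {(x, a)})"
        by (rule imageI)
      then show "z \<in> act P c (r `` {(x, a)})"
        using c by (simp add: yb P_def)
    qed
  qed
  have \<kappa>_top: "\<kappa> ` topspace C = topspace X" and \<kappa>_con: "continuous_map C X \<kappa>"
    using quo by (auto simp: quotient_imp_surjective_map quotient_imp_continuous_map)
  show "rat_bundle {q. q \<noteq> 0} X P"
  proof
    have "continuous_map ?E X (proj P \<circ> (\<lambda>z. r `` {z}))"
    proof (rule continuous_map_eq)
      show "continuous_map ?E X (\<kappa> \<circ> fst)"
        by (rule continuous_map_compose[OF continuous_map_fst \<kappa>_con])
    qed (use projP in auto)
    then show "continuous_map (total P) X (proj P)"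
      using continuous_compose_quotient_map[OF quE] by blast
  next
    fix p assume "p \<in> topspace X"
    then obtain W w where pW: "p \<in> W" and Ww: "gluing_weights C X \<kappa> r W w"
      using weights by blast
    have W: "p \<in> W" "openin X W"
      and w_open: "openin C {x \<in> topspace C. \<kappa> x \<in> W \<and> w x = g}" for g
      using pW Ww by (simp_all add: gluing_weights_def)
    have w0: "w x \<noteq> 0" if "x \<in> topspace C" "\<kappa> x \<in> W" for x
      using Ww that by (simp add: gluing_weights_def)
    have wr: "((x, a), (y, b)) \<in> r \<longleftrightarrow> w x * a = w y * b"
      if "x \<in> topspace C" "y \<in> topspace C" "\<kappa> x \<in> W" "\<kappa> x = \<kappa> y" for x y a b
      using Ww that unfolding gluing_weights_def by metis
    \<comment> \<open>A class may have members outside \<open>topspace C\<close>, where nothing is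
      known about the weights, so the representative is chosen over
      \<open>topspace C\<close>.\<close>
    define crd where "crd e = (let (x, a) = (SOME z. z \<in> e \<and> fst z \<in> topspace C) in w x * a)" for e
    have crd: "crd (r `` {(x, a)}) = w x * a" if "x \<in> topspace C" "\<kappa> x \<in> W" for x a
    proof -
      let ?z = "SOME z. z \<in> r `` {(x, a)} \<and> fst z \<in> topspace C"
      have "?z \<in> r `` {(x, a)} \<and> fst ?z \<in> topspace C"
        by (rule someI[of _ "(x, a)"]) (use self that in auto)
      then have z: "((x, a), (fst ?z, snd ?z)) \<in> r" "fst ?z \<in> topspace C"
        by auto
      have "w x * a = w (fst ?z) * snd ?z"
        using wr[OF that(1) z(2) that(2) r_\<kappa>[OF z(1)]] z(1) by blast
      then show ?thesis
        by (simp add: crd_def case_prod_unfold Let_def)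
    qed
    define pre where "pre u = (SOME x. x \<in> topspace C \<and> \<kappa> x = u)" for u
    have pre: "pre u \<in> topspace C" "\<kappa> (pre u) = u" if "u \<in> W" for u
    proof -
      have "\<exists>x. x \<in> topspace C \<and> \<kappa> x = u"
        using that \<kappa>_top openin_subset[OF W(2)] by (metis imageE subsetD)
      from someI_ex[OF this] show "pre u \<in> topspace C" "\<kappa> (pre u) = u"
        by (simp_all add: pre_def)
    qed
    define sec where "sec g u = r `` {(pre u, g / w (pre u))}" for g u
    have sec: "sec g (\<kappa> x) = r `` {(x, g / w x)}" if "x \<in> topspace C" "\<kappa> x \<in> W" for g x
      unfolding sec_def eq using pre[OF that(2)] that w0 by (subst wr) auto
    have "local_trivialization {q. q \<noteq> 0} X P W sec crd"
      unfolding local_trivialization_def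
    proof (intro conjI ballI impI)
      show "openin X W" by fact
      show "continuous_map (subtopology X W) (total P) (sec g)" if g: "g \<in> {q. q \<noteq> 0}" for g
      proof -
        let ?C = "subtopology C {x \<in> topspace C. \<kappa> x \<in> W}"
        have q: "quotient_map ?C (subtopology X W) \<kappa>"
          by (rule quotient_map_restriction[OF quo refl]) (use W in auto)
        have "continuous_map ?C (discrete_topology {q. q \<noteq> 0}) (\<lambda>x. g / w x)"
        proof (rule continuous_map_into_discrete)
          fix a :: rat assume a: "a \<in> {q. q \<noteq> 0}"
          have "{x \<in> topspace ?C. g / w x = a} =
              {x \<in> topspace C. \<kappa> x \<in> W \<and> w x = g / a} \<inter> {x \<in> topspace C. \<kappa> x \<in> W}"
            using a g w0 by (auto simp: field_simps)
          then show "openin ?C {x \<in> topspace ?C. g / w x = a}"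
            using openin_subtopology_Int[OF w_open] by simp
        qed (use g w0 in auto)
        then have "continuous_map ?C ?E (\<lambda>x. (x, g / w x))"
          by (simp add: continuous_map_pairwise o_def continuous_map_from_subtopology)
        from continuous_map_compose[OF this conE]
        have "continuous_map ?C (total P) (\<lambda>x. r `` {(x, g / w x)})"
          by (simp add: o_def)
        then have "continuous_map ?C (total P) (sec g \<circ> \<kappa>)"
          by (rule continuous_map_eq) (simp add: sec)
        then show ?thesis
          using continuous_compose_quotient_map[OF q] by blast
      qed
      show "openin (total P) {e \<in> topspace (total P). proj P e \<in> W \<and> crd e = g}"
        if g: "g \<in> {q. q \<noteq> 0}" for g
      proof -
        let ?V = "{e \<in> topspace (total P). proj P e \<in> W \<and> crd e = g}"
        have "{z \<in> topspace ?E. r `` {z} \<in> ?V} =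
            (\<Union>a \<in> {q. q \<noteq> 0}. {x \<in> topspace C. \<kappa> x \<in> W \<and> w x = g / a} \<times> {a})"
          by (auto simp: topP projP crd field_simps)
        moreover have "openin ?E \<dots>"
          using w_open by (intro openin_Union) (auto simp: openin_prod_Times_iff)
        ultimately have "openin ?E {z \<in> topspace ?E. r `` {z} \<in> ?V}"
          by simp
        then show ?thesis
          by (rule openin_quotient_mapD[OF quE, rotated]) auto
      qed
      fix u g assume ug: "u \<in> W" "g \<in> {q::rat. q \<noteq> 0}"
      note p = pre[OF ug(1)]
      show "proj P (sec g u) = u"
        by (simp add: sec_def projP p)
      show "crd (sec g u) = g"
        using p ug w0[of "pre u"] by (simp add: sec_def crd)
      show "act P c (sec g u) = sec (c * g) u" if "c \<in> {q. q \<noteq> 0}" for c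
        using that by (simp add: sec_def actP)
    next
      fix e assume e: "e \<in> topspace (total P)" "proj P e \<in> W"
      then obtain x a where xa: "e = r `` {(x, a)}" "x \<in> topspace C" "a \<noteq> 0"
        by (auto simp: topP)
      then have "\<kappa> x \<in> W"
        using e(2) by (simp add: projP)
      with xa show "crd e \<in> {q. q \<noteq> 0}" "sec (crd e) (proj P e) = e"
        using w0 by (simp_all add: projP crd sec)
    qed
    then show "\<exists>U sec crd. p \<in> U \<and> local_trivialization {q. q \<noteq> 0} X P U sec crd"
      using W(1) by blast
  qed auto
qed

text \<open>The product of the two fiber coordinates is unchanged when both change sign, so it
  descends to the quotient as a coordinate; the sections pair a section of P with the section of Q
  of coordinate 1. Q lives over all of S and is restricted to A by the fiber product itself. The
  last claim lets a sign pass from one factor to the other.\<close>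

lemma rat_bundle_twisted_product:
  assumes P: "rat_bundle {q. q \<noteq> 0} (subtopology S A) P" and Q: "rat_bundle {1, - 1} S Q"
  defines "R \<equiv> twisted_product P Q"
    and "cls \<equiv> (\<lambda>z. {((a, b), (act P \<epsilon> a, act Q \<epsilon> b)) | a b \<epsilon>. \<epsilon> \<in> {1, - 1}} `` {z})"
  shows "rat_bundle {q. q \<noteq> 0} (subtopology S A) R"
    and "continuous_map (subtopology (prod_topology (total P) (total Q)) {(a, b). proj P a = proj Q b})
      (total R) cls"
    and "a \<in> topspace (total P) \<Longrightarrow> b \<in> topspace (total Q) \<Longrightarrow> proj R (cls (a, b)) = proj P a"
    and "a \<in> topspace (total P) \<Longrightarrow> b \<in> topspace (total Q) \<Longrightarrow> c \<noteq> 0 \<Longrightarrow>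
      act R c (cls (a, b)) = cls (act P c a, b)"
    and "a \<in> topspace (total P) \<Longrightarrow> b \<in> topspace (total Q) \<Longrightarrow> \<epsilon> \<in> {1, - 1} \<Longrightarrow>
      cls (act P \<epsilon> a, act Q \<epsilon> b) = cls (a, b)"
proof -
  interpret P: rat_bundle "{q. q \<noteq> 0}" "subtopology S A" P by fact
  interpret Q: rat_bundle "{1, - 1}" S Q by fact
  let ?E = "subtopology (prod_topology (total P) (total Q)) {(a, b). proj P a = proj Q b}"
  define r where "r = {((a, b), (act P \<epsilon> a, act Q \<epsilon> b)) | a b \<epsilon>. \<epsilon> \<in> {1, - 1}}"
  have cls_r: "cls z = r `` {z}" for z
    by (simp add: cls_def r_def)
  have tot: "total R = quotient_topology ?E r"
    by (simp add: R_def twisted_product_def r_def)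
  have cls_r': "cls = (\<lambda>z. r `` {z})"
    by (simp add: cls_r fun_eq_iff)
  have quE: "quotient_map ?E (total R) cls"
    unfolding cls_r' tot by (rule quotient_map_quotient_topology)
  then show conE: "continuous_map ?E (total R) cls"
    by (rule quotient_imp_continuous_map)
  have topE: "topspace ?E = {(a, b). a \<in> topspace (total P) \<and> b \<in> topspace (total Q) \<and> proj P a = proj Q b}"
    by auto
  have topR: "topspace (total R) = cls ` topspace ?E"
    unfolding cls_r' tot by (rule topspace_quotient_topology)
  have cls: "cls (a, b) = {(a, b), (act P (- 1) a, act Q (- 1) b)}"
    if "a \<in> topspace (total P)" "b \<in> topspace (total Q)" for a b
    using that unfolding cls_def by (auto simp: P.act_one Q.act_one; force simp: P.act_one Q.act_one)
  show cls_act: "cls (act P \<epsilon> a, act Q \<epsilon> b) = cls (a, b)"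
    if "a \<in> topspace (total P)" "b \<in> topspace (total Q)" "\<epsilon> \<in> {1, - 1}" for a b \<epsilon>
  proof -
    have "act P \<epsilon> a \<in> topspace (total P)" "act Q \<epsilon> b \<in> topspace (total Q)"
      using P.act_total(1)[OF that(1), of \<epsilon>] Q.act_total(1)[OF that(2,3)] that(3) by auto
    then show ?thesis
      using that by (auto simp: cls P.act_act Q.act_act)
  qed
  show projR: "proj R (cls (a, b)) = proj P a"
    if "a \<in> topspace (total P)" "b \<in> topspace (total Q)" for a b
  proof -
    have "(SOME z. z \<in> cls (a, b)) \<in> cls (a, b)"
      by (rule someI[of _ "(a, b)"]) (simp add: cls that)
    then have "(SOME z. z \<in> cls (a, b)) = (a, b) \<or> (SOME z. z \<in> cls (a, b)) = (act P (- 1) a, act Q (- 1) b)"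
      by (simp only: cls[OF that] insert_iff empty_iff simp_thms)
    moreover have "proj R (cls (a, b)) = proj P (fst (SOME z. z \<in> cls (a, b)))"
      by (simp add: R_def twisted_product_def)
    moreover have "proj P (act P (- 1) a) = proj P a"
      using P.act_total(2)[OF that(1), of "- 1"] by simp
    ultimately show ?thesis
      by auto
  qed
  show actR: "act R c (cls (a, b)) = cls (act P c a, b)"
    if "a \<in> topspace (total P)" "b \<in> topspace (total Q)" "c \<noteq> 0" for a b c
  proof -
    have "act P c a \<in> topspace (total P)"
      using P.act_total(1)[OF that(1), of c] that(3) by simp
    then show ?thesis
      using that by (simp add: cls R_def twisted_product_def P.act_act)
  qed
  show "rat_bundle {q. q \<noteq> 0} (subtopology S A) R"
  proof
    have "continuous_map ?E (subtopology S A) (proj R \<circ> cls)"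
    proof (rule continuous_map_eq)
      show "continuous_map ?E (subtopology S A) (proj P \<circ> fst)"
        by (rule continuous_map_compose[OF continuous_map_from_subtopology[OF continuous_map_fst] P.proj_continuous])
      show "(proj P \<circ> fst) z = (proj R \<circ> cls) z" if "z \<in> topspace ?E" for z
        using that by (cases z) (simp add: projR)
    qed
    then show "continuous_map (total R) (subtopology S A) (proj R)"
      using continuous_compose_quotient_map[OF quE] by blast
  next
    fix p assume p: "p \<in> topspace (subtopology S A)"
    obtain U secP crdP where U: "p \<in> U" "openin (subtopology S A) U"
      "\<And>g. g \<in> {q. q \<noteq> 0} \<Longrightarrow> continuous_map (subtopology (subtopology S A) U) (total P) (secP g)"
      "\<And>g. g \<in> {q. q \<noteq> 0} \<Longrightarrow> openin (total P) {e \<in> topspace (total P). proj P e \<in> U \<and> crdP e = g}"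
      "\<And>u g. u \<in> U \<Longrightarrow> g \<in> {q. q \<noteq> 0} \<Longrightarrow> proj P (secP g u) = u"
      "\<And>u g. u \<in> U \<Longrightarrow> g \<in> {q. q \<noteq> 0} \<Longrightarrow> crdP (secP g u) = g"
      "\<And>u g. u \<in> U \<Longrightarrow> g \<in> {q. q \<noteq> 0} \<Longrightarrow> secP g u \<in> topspace (total P)"
      "\<And>u g c. u \<in> U \<Longrightarrow> g \<in> {q. q \<noteq> 0} \<Longrightarrow> c \<in> {q. q \<noteq> 0} \<Longrightarrow> act P c (secP g u) = secP (c * g) u"
      "\<And>e. e \<in> topspace (total P) \<Longrightarrow> proj P e \<in> U \<Longrightarrow> crdP e \<in> {q. q \<noteq> 0}"
      "\<And>e. e \<in> topspace (total P) \<Longrightarrow> proj P e \<in> U \<Longrightarrow> secP (crdP e) (proj P e) = e"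
      by (rule P.trivialization_at[OF p]) blast
    have pS: "p \<in> topspace S"
      using p by simp
    obtain V secQ crdQ where V: "p \<in> V" "openin S V"
      "\<And>g. g \<in> {1, - 1} \<Longrightarrow> continuous_map (subtopology S V) (total Q) (secQ g)"
      "\<And>g. g \<in> {1, - 1} \<Longrightarrow> openin (total Q) {e \<in> topspace (total Q). proj Q e \<in> V \<and> crdQ e = g}"
      "\<And>u g. u \<in> V \<Longrightarrow> g \<in> {1, - 1} \<Longrightarrow> proj Q (secQ g u) = u"
      "\<And>u g. u \<in> V \<Longrightarrow> g \<in> {1, - 1} \<Longrightarrow> crdQ (secQ g u) = g"
      "\<And>u g. u \<in> V \<Longrightarrow> g \<in> {1, - 1} \<Longrightarrow> secQ g u \<in> topspace (total Q)"
      "\<And>u g c. u \<in> V \<Longrightarrow> g \<in> {1, - 1} \<Longrightarrow> c \<in> {1, - 1} \<Longrightarrow> act Q c (secQ g u) = secQ (c * g) u"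
      "\<And>e. e \<in> topspace (total Q) \<Longrightarrow> proj Q e \<in> V \<Longrightarrow> crdQ e \<in> {1, - 1}"
      "\<And>e. e \<in> topspace (total Q) \<Longrightarrow> proj Q e \<in> V \<Longrightarrow> secQ (crdQ e) (proj Q e) = e"
      by (rule Q.trivialization_at[OF pS]) blast
    have one: "1 \<in> {1, - 1 :: rat}"
      by simp
    have UA: "U \<subseteq> topspace S" "U \<subseteq> A"
      using openin_subset[OF U(2)] by auto
    define crd where "crd e = (let (a, b) = (SOME z. z \<in> e) in crdP a * crdQ b)" for e
    have crd: "crd (cls (a, b)) = crdP a * crdQ b"
      if ab: "a \<in> topspace (total P)" "b \<in> topspace (total Q)" "proj P a \<in> U" "proj Q b \<in> V" for a b
    proof -
      have "(SOME z. z \<in> cls (a, b)) \<in> cls (a, b)"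
        by (rule someI[of _ "(a, b)"]) (simp add: cls that)
      then have *: "(SOME z. z \<in> cls (a, b)) = (a, b) \<or> (SOME z. z \<in> cls (a, b)) = (act P (- 1) a, act Q (- 1) b)"
        by (simp only: cls[OF ab(1,2)] insert_iff empty_iff simp_thms)
      have "crdP (act P (- 1) a) = - crdP a"
        using U(6)[OF ab(3), of "- crdP a"] U(8)[OF ab(3), of "crdP a" "- 1"] U(9,10)[OF ab(1,3)] by auto
      moreover have "crdQ (act Q (- 1) b) = - crdQ b"
        using V(6)[OF ab(4), of "- crdQ b"] V(8)[OF ab(4), of "crdQ b" "- 1"] V(9,10)[OF ab(2,4)] by auto
      ultimately show ?thesis
        using * by (auto simp: crd_def)
    qed
    define sec where "sec g u = cls (secP g u, secQ 1 u)" for g u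
    have "local_trivialization {q. q \<noteq> 0} (subtopology S A) R (U \<inter> V) sec crd"
      unfolding local_trivialization_def
    proof (intro conjI ballI impI)
      have "openin (subtopology S A) (V \<inter> A)"
        using V(2) by (rule openin_subtopology_Int)
      then have "openin (subtopology S A) (U \<inter> (V \<inter> A))"
        using U(2) by (rule openin_Int[rotated])
      moreover have "U \<inter> (V \<inter> A) = U \<inter> V"
        using UA by auto
      ultimately show "openin (subtopology S A) (U \<inter> V)"
        by simp
      show "continuous_map (subtopology (subtopology S A) (U \<inter> V)) (total R) (sec g)"
        if g: "g \<in> {q. q \<noteq> 0}" for g
      proof -
        let ?X = "subtopology (subtopology S A) (U \<inter> V)"
        have "continuous_map ?X (total P) (secP g)"
          using continuous_map_from_subtopology_mono[OF U(3)[OF g]] by blast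
        moreover have "continuous_map ?X (total Q) (secQ 1)"
          using continuous_map_from_subtopology_mono[OF V(3)[OF one], of "A \<inter> (U \<inter> V)"]
          by (auto simp: subtopology_subtopology)
        moreover have "secP g u \<in> topspace (total P) \<and> proj P (secP g u) = proj Q (secQ 1 u)"
          if "u \<in> topspace ?X" for u
          using that g U(5,7) V(5)[OF _ one] by simp
        ultimately have "continuous_map ?X ?E (\<lambda>u. (secP g u, secQ 1 u))"
          by (simp add: continuous_map_in_subtopology continuous_map_pairwise o_def Pi_iff)
        from continuous_map_compose[OF this conE] show ?thesis
          by (simp add: o_def sec_def[abs_def])
      qed
      show "openin (total R) {e \<in> topspace (total R). proj R e \<in> U \<inter> V \<and> crd e = g}"
        if g: "g \<in> {q. q \<noteq> 0}" for g
      proof -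
        let ?V = "{e \<in> topspace (total R). proj R e \<in> U \<inter> V \<and> crd e = g}"
        let ?N = "\<lambda>\<epsilon>. {e \<in> topspace (total P). proj P e \<in> U \<and> crdP e = g * \<epsilon>} \<times>
              {e \<in> topspace (total Q). proj Q e \<in> V \<and> crdQ e = \<epsilon>}"
        have "z \<in> ?N 1 \<union> ?N (- 1)" if z: "z \<in> topspace ?E" "cls z \<in> ?V" for z
        proof -
          obtain a b where ab: "z = (a, b)" "a \<in> topspace (total P)" "b \<in> topspace (total Q)" "proj P a = proj Q b"
            using z(1) by auto
          then have "proj P a \<in> U" "proj Q b \<in> V"
            using z(2) projR by auto
          then show ?thesis
            using z(2) ab crd V(9)[of b] by auto
        qed
        moreover have "cls z \<in> ?V" if z: "z \<in> topspace ?E" "z \<in> ?N 1 \<union> ?N (- 1)" for z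
        proof -
          obtain a b where ab: "z = (a, b)" "a \<in> topspace (total P)" "b \<in> topspace (total Q)" "proj P a = proj Q b"
            using z(1) by auto
          then show ?thesis
            using z crd[of a b] projR[of a b] by (auto simp: topR simp del: topspace_subtopology)
        qed
        ultimately have VN: "{z \<in> topspace ?E. cls z \<in> ?V} = topspace ?E \<inter> (?N 1 \<union> ?N (- 1))"
          by blast
        have "openin (prod_topology (total P) (total Q)) (?N 1 \<union> ?N (- 1))"
          using U(4) V(4) g by (intro openin_Un) (simp_all add: openin_prod_Times_iff)
        then have "openin ?E (topspace ?E \<inter> (?N 1 \<union> ?N (- 1)))"
          by (rule openin_topspace_subtopology_Int)
        then show ?thesis
          by (intro openin_quotient_mapD[OF quE]) (auto simp only: VN)
      qed
      fix u g assume ug: "u \<in> U \<inter> V" "g \<in> {q::rat. q \<noteq> 0}"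
      have s: "secP g u \<in> topspace (total P)" "secQ 1 u \<in> topspace (total Q)"
        "proj P (secP g u) = u" "proj Q (secQ 1 u) = u" "crdP (secP g u) = g" "crdQ (secQ 1 u) = 1"
        using ug U V one by auto
      show "proj R (sec g u) = u"
        by (simp add: sec_def projR s)
      show "crd (sec g u) = g"
        using ug by (simp add: sec_def crd s)
      show "act R c (sec g u) = sec (c * g) u" if "c \<in> {q. q \<noteq> 0}" for c
        using that ug U(8)[of u g c] by (simp add: sec_def actR s)
    next
      fix e assume e: "e \<in> topspace (total R)" "proj R e \<in> U \<inter> V"
      then obtain a b where ab: "e = cls (a, b)" "a \<in> topspace (total P)" "b \<in> topspace (total Q)" "proj P a = proj Q b"
        unfolding topR topE by auto
      then have UV: "proj P a \<in> U" "proj Q b \<in> V"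
        using e(2) projR by auto
      show "crd e \<in> {q. q \<noteq> 0}"
        using U(9)[OF ab(2) UV(1)] V(9)[OF ab(3) UV(2)] ab UV by (auto simp: crd)
      have \<epsilon>: "crdQ b \<in> {1, - 1}" "crdQ b * crdQ b = 1" and g: "crdP a \<noteq> 0"
        using U(9)[OF ab(2) UV(1)] V(9)[OF ab(3) UV(2)] by auto
      \<comment> \<open>Acting by the sign \<open>crdQ b\<close> on both components keeps the class
        and moves b to the section of coordinate 1.\<close>
      have "act P (crdQ b) a = secP (crdP a * crdQ b) (proj P a)"
        using U(8)[OF UV(1), of "crdP a" "crdQ b"] U(10)[OF ab(2) UV(1)] g \<epsilon> by (auto simp: mult.commute)
      moreover have "act Q (crdQ b) b = secQ 1 (proj Q b)"
        using V(8)[OF UV(2) \<epsilon>(1) \<epsilon>(1)] V(10)[OF ab(3) UV(2)] \<epsilon> by simp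
      ultimately show "sec (crd e) (proj R e) = e"
        using cls_act[OF ab(2,3) \<epsilon>(1)] ab UV by (simp add: sec_def crd projR)
    qed
    then show "\<exists>U sec crd. p \<in> U \<and> local_trivialization {q. q \<noteq> 0} (subtopology S A) R U sec crd"
      using U(1) V(1) by blast
  qed auto
qed

section \<open>Topological manifolds with boundary\<close>

lemma locally_Euclidean_at_open:
  assumes "openin X U" "x \<in> U"
  shows "locally_Euclidean_at n (subtopology X U) x \<longleftrightarrow> locally_Euclidean_at n X x"
proof
  assume "locally_Euclidean_at n (subtopology X U) x"
  then obtain V W where V: "openin (subtopology X U) V" "x \<in> V" "openin (Euclidean_space n) W"
    "subtopology (subtopology X U) V homeomorphic_space subtopology (Euclidean_space n) W"
    unfolding locally_Euclidean_at_def by blast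
  moreover have "openin X V" "U \<inter> V = V"
    using V(1) assms(1) openin_trans_full openin_subset[OF V(1)] by auto
  ultimately show "locally_Euclidean_at n X x"
    unfolding locally_Euclidean_at_def by (auto simp: subtopology_subtopology)
next
  assume "locally_Euclidean_at n X x"
  then obtain V W h where V: "openin X V" "x \<in> V" "openin (Euclidean_space n) W"
    and h: "homeomorphic_map (subtopology X V) (subtopology (Euclidean_space n) W) h"
    unfolding locally_Euclidean_at_def homeomorphic_space by blast
  let ?W = "h ` (U \<inter> V)"
  have tV: "topspace (subtopology X V) = V" and tW: "topspace (subtopology (Euclidean_space n) W) = W"
    using openin_subset[OF V(1)] openin_subset[OF V(3)] by auto
  have "openin (subtopology X V) (U \<inter> V)"
    using assms(1) by (rule openin_subtopology_Int)
  then have oW: "openin (subtopology (Euclidean_space n) W) ?W"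
    using homeomorphic_imp_open_map[OF h] by (simp add: open_map_def)
  then have W: "openin (Euclidean_space n) ?W" "W \<inter> ?W = ?W"
    using V(3) openin_trans_full openin_subset[OF oW] tW by auto
  have hs: "h ` (topspace (subtopology X V) \<inter> (U \<inter> V)) = topspace (subtopology (Euclidean_space n) W) \<inter> ?W"
    using openin_subset[OF oW] unfolding tV tW by auto
  have eqU: "subtopology (subtopology X V) (U \<inter> V) = subtopology (subtopology X U) (U \<inter> V)"
    by (simp add: subtopology_subtopology Int_ac)
  have eqW: "subtopology (subtopology (Euclidean_space n) W) ?W = subtopology (Euclidean_space n) ?W"
    by (simp add: subtopology_subtopology W(2))
  have "homeomorphic_map (subtopology (subtopology X U) (U \<inter> V)) (subtopology (Euclidean_space n) ?W) h"
    using homeomorphic_map_subtopologies[OF h hs] unfolding eqU eqW .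
  moreover have "openin (subtopology X U) (U \<inter> V)"
    using V(1) openin_subtopology_Int[of X V U] by (simp add: Int_commute)
  ultimately show "locally_Euclidean_at n (subtopology X U) x"
    unfolding locally_Euclidean_at_def
    using W(1) V(2) assms(2) homeomorphic_map_imp_homeomorphic_space by blast
qed

lemma locally_Euclidean_at_homeomorphic:
  assumes f: "homeomorphic_map X Y f" and "locally_Euclidean_at n X x"
  shows "locally_Euclidean_at n Y (f x)"
proof -
  obtain V W where V: "openin X V" "x \<in> V" "openin (Euclidean_space n) W"
    "subtopology X V homeomorphic_space subtopology (Euclidean_space n) W"
    using assms(2) unfolding locally_Euclidean_at_def by blast
  have "openin Y (f ` V)"
    using homeomorphic_imp_open_map[OF f] V(1) by (simp add: open_map_def)
  moreover have "subtopology X V homeomorphic_space subtopology Y (f ` V)"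
  proof -
    have "f ` (topspace X \<inter> V) = topspace Y \<inter> f ` V"
      using openin_subset[OF V(1)] openin_subset[OF \<open>openin Y (f ` V)\<close>] by (simp add: Int_absorb1)
    then show ?thesis
      by (rule homeomorphic_map_imp_homeomorphic_space[OF homeomorphic_map_subtopologies[OF f]])
  qed
  then have "subtopology Y (f ` V) homeomorphic_space subtopology (Euclidean_space n) W"
    using V(4) homeomorphic_space_trans homeomorphic_space_sym by blast
  ultimately show ?thesis
    using V(2,3) unfolding locally_Euclidean_at_def by blast
qed

lemma openin_manifold_interior: "openin X (manifold_interior n X)"
proof (subst openin_subopen, clarify)
  fix x assume "x \<in> manifold_interior n X"
  then obtain U W where U: "openin X U" "x \<in> U" "openin (Euclidean_space n) W"
        "subtopology X U homeomorphic_space subtopology (Euclidean_space n) W"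
    unfolding manifold_interior_def locally_Euclidean_at_def by blast
  then have "U \<subseteq> manifold_interior n X"
    using openin_subset[OF U(1)] unfolding manifold_interior_def locally_Euclidean_at_def by blast
  then show "\<exists>T. openin X T \<and> x \<in> T \<and> T \<subseteq> manifold_interior n X"
    using U by blast
qed

lemma manifold_interior_open_subset:
  assumes "openin X U"
  shows "manifold_interior n (subtopology X U) = U \<inter> manifold_interior n X"
  using openin_subset[OF assms] locally_Euclidean_at_open[OF assms]
  by (auto simp: manifold_interior_def)

lemma closedin_manifold_boundary: "closedin X (manifold_boundary n X)"
  by (simp add: manifold_boundary_def closedin_diff openin_manifold_interior)

text \<open>A covering is a local homeomorphism. The contrapositive is what is used: points above a
  boundary point are boundary points.\<close>

lemma finite_covering_interior:
  assumes p: "finite_covering X Y p" and x: "x \<in> manifold_interior n X"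
  shows "p x \<in> manifold_interior n Y"
proof -
  have xX: "x \<in> topspace X"
    using x by (simp add: manifold_interior_def)
  have pY: "p x \<in> topspace Y"
    using p xX continuous_map_funspace[of X Y p] by (auto simp: finite_covering_def)
  obtain U \<V> where U: "openin Y U" "p x \<in> U" "\<Union>\<V> = {x \<in> topspace X. p x \<in> U}"
        "\<forall>V \<in> \<V>. openin X V \<and> homeomorphic_map (subtopology X V) (subtopology Y U) p"
    using p pY unfolding finite_covering_def by blast
  then obtain V where V: "V \<in> \<V>" "x \<in> V"
    using xX by blast
  then have "locally_Euclidean_at n (subtopology X V) x"
    using U(4) x by (simp add: locally_Euclidean_at_open manifold_interior_def)
  moreover have "homeomorphic_map (subtopology X V) (subtopology Y U) p"
    using U(4) V(1) by blast
  ultimately have "locally_Euclidean_at n (subtopology Y U) (p x)"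
    by (rule locally_Euclidean_at_homeomorphic[rotated])
  then show ?thesis
    using U(1,2) pY by (simp add: locally_Euclidean_at_open manifold_interior_def)
qed

section \<open>Finiteness of fibers and covering degrees\<close>

lemma finite_covering_fibre:
  assumes "finite_covering X Y p" "y \<in> topspace Y"
  shows "finite {x \<in> topspace X. p x = y}"
proof -
  obtain U \<V> where U: "y \<in> U" "finite \<V>" "\<Union>\<V> = {x \<in> topspace X. p x \<in> U}"
        "\<forall>V \<in> \<V>. openin X V \<and> homeomorphic_map (subtopology X V) (subtopology Y U) p"
    using assms unfolding finite_covering_def by blast
  have "finite {x \<in> V. p x = y}" if V: "V \<in> \<V>" for V
  proof -
    have "inj_on p V"
      using U(4) V homeomorphic_imp_injective_map[of "subtopology X V" "subtopology Y U" p]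
        openin_subset[of X V] by (simp add: Int_absorb1)
    then have "\<exists>z. {x \<in> V. p x = y} \<subseteq> {z}"
      by (auto simp: inj_on_def)
    then show ?thesis
      using finite_subset by blast
  qed
  moreover have "{x \<in> topspace X. p x = y} = (\<Union>V \<in> \<V>. {x \<in> V. p x = y})"
    using U(1,3) by blast
  ultimately show ?thesis
    using U(2) by simp
qed

text \<open>\<open>card\<close> is 0 on infinite sets, so positivity takes the finiteness of the
  fiber besides a point of A in it.\<close>

lemma covering_degree_pos:
  assumes "finite_covering X Y p" "A \<subseteq> topspace X" "A \<noteq> {}"
  shows "covering_degree A p > 0"
proof -
  define a where "a = (SOME a. a \<in> A)"
  have a: "a \<in> A"
    unfolding a_def using assms(3) by (simp add: some_in_eq)
  have "p a \<in> topspace Y"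
    using assms(1,2) a continuous_map_funspace[of X Y p] by (auto simp: finite_covering_def)
  note fin = finite_covering_fibre[OF assms(1) this]
  have "finite {x \<in> A. p x = p a}"
    by (rule finite_subset[OF _ fin]) (use assms(2) in auto)
  moreover have "a \<in> {x \<in> A. p x = p a}"
    using a by simp
  ultimately show ?thesis
    unfolding covering_degree_def a_def[symmetric] using card_gt_0_iff by blast
qed

text \<open>A box around z, cut by the half-space, has as its part off the wall a product of
  intervals, which is connected. Closures of products are products of closures, so every point of
  the cut box is a limit of that part.\<close>

lemma half_space_small_neighbourhood:
  assumes n: "n > 0" and N: "openin (half_space n) N" "z \<in> N"
  obtains V where "openin (half_space n) V" "z \<in> V" "V \<subseteq> N"
    "connectedin (half_space n) {y \<in> V. y 0 > 0}" "V \<subseteq> half_space n closure_of {y \<in> V. y 0 > 0}"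
    "{y \<in> V. y 0 > 0} \<noteq> {}"
proof -
  let ?Q = "powertop_real UNIV"
  let ?H = "{y. (\<forall>i\<ge>n. y i = 0) \<and> y 0 \<ge> 0} :: (nat \<Rightarrow> real) set"
  have hs: "half_space n = subtopology ?Q ?H"
    unfolding half_space_def Euclidean_space_def subtopology_subtopology
    by (rule arg_cong2[where f = subtopology]) auto
  obtain O' where O': "openin ?Q O'" "N = O' \<inter> ?H"
    using N(1) unfolding hs openin_subtopology by blast
  then obtain U where U: "finite {i. U i \<noteq> UNIV}" "\<And>i. open (U i)" "z \<in> Pi\<^sub>E UNIV U" "Pi\<^sub>E UNIV U \<subseteq> O'"
    using N(2) unfolding openin_product_topology_alt by (auto; metis)
  have zH: "z \<in> ?H"
    using N(2) O'(2) by blast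
  have "\<exists>e>0. ball (z i) e \<subseteq> U i" for i
    using U(2)[of i] U(3) by (auto simp: open_contains_ball)
  then obtain e where e: "\<And>i. e i > 0" "\<And>i. ball (z i) (e i) \<subseteq> U i"
    by metis
  \<comment> \<open>R is the box, unrestricted from index n on so that only finitely many factors
    are proper. J is its part with positive coordinate 0; there the coordinates from n on are pinned
    to 0, as in \<open>Euclidean_space n\<close>.\<close>
  define R where "R i = (if i < n then {z i - e i <..< z i + e i} else UNIV)" for i
  define J where "J i = (if i = 0 then {max 0 (z 0 - e 0) <..< z 0 + e 0} else if i < n then {z i - e i <..< z i + e i} else {0})" for i
  define V where "V = ?H \<inter> Pi\<^sub>E UNIV R"
  have "openin ?Q (Pi\<^sub>E UNIV R)"
    by (rule product_topology_basis) (auto simp: R_def intro: finite_subset[of _ "{..<n}"])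
  then have V_open: "openin (half_space n) V"
    unfolding hs V_def openin_subtopology by blast
  have zV: "z \<in> V"
    using zH e(1) by (auto simp: V_def R_def)
  have VN: "V \<subseteq> N"
  proof
    fix y assume y: "y \<in> V"
    have "y i \<in> U i" for i
    proof (cases "i < n")
      case True
      then have "y i \<in> ball (z i) (e i)"
        using y by (auto simp: V_def R_def dist_real_def PiE_iff abs_less_iff split: if_splits)
      then show ?thesis
        using e(2) by blast
    next
      case False
      then have "y i = z i"
        using y zH by (auto simp: V_def)
      then show ?thesis
        using U(3) by auto
    qed
    then show "y \<in> N"
      using U(4) O'(2) y by (auto simp: V_def)
  qed
  have A: "{y \<in> V. y 0 > 0} = Pi\<^sub>E UNIV J"
  proof (intro equalityI subsetI)
    fix y assume y: "y \<in> {y \<in> V. y 0 > 0}"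
    then have "y i \<in> R i" for i
      by (auto simp: V_def)
    then show "y \<in> Pi\<^sub>E UNIV J"
      using y n by (force simp: V_def R_def J_def PiE_iff split: if_splits)
  next
    fix y assume "y \<in> Pi\<^sub>E UNIV J"
    then have y: "y i \<in> J i" for i
      by auto
    show "y \<in> {y \<in> V. y 0 > 0}"
    proof -
      have "y 0 > 0" "y 0 \<in> R 0"
        using y[of 0] n by (auto simp: J_def R_def)
      moreover have "y i \<in> R i" if "i \<noteq> 0" for i
        using y[of i] that by (auto simp: J_def R_def split: if_splits)
      moreover have "y i = 0" if "i \<ge> n" for i
        using y[of i] that n by (auto simp: J_def split: if_splits)
      ultimately have "y \<in> Pi\<^sub>E UNIV R" "y \<in> ?H" "y 0 > 0"
        by (auto simp: PiE_iff; metis)+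
      then show ?thesis
        by (simp add: V_def)
    qed
  qed
  have Jcon: "connected (J i)" for i
    by (auto simp: J_def)
  have "connectedin ?Q (Pi\<^sub>E UNIV J)"
    unfolding connectedin_PiE using Jcon by simp
  moreover have "Pi\<^sub>E UNIV J \<subseteq> ?H"
    using A by (auto simp: V_def)
  ultimately have con: "connectedin (half_space n) {y \<in> V. y 0 > 0}"
    unfolding A hs by (simp add: connectedin_subtopology)
  have clo: "y \<in> half_space n closure_of {y \<in> V. y 0 > 0}" if y: "y \<in> V" for y
  proof -
    have "y i \<in> closure (J i)" for i
    proof -
      consider "i = 0" | "i \<noteq> 0" "i < n" | "i \<noteq> 0" "i \<ge> n"
        by linarith
      then show ?thesis
      proof cases
        case 1
        have "z 0 \<ge> 0" "y 0 \<ge> 0" "y 0 \<in> R 0"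
          using zH y by (auto simp: V_def)
        moreover have "max 0 (z 0 - e 0) < z 0 + e 0"
          using \<open>z 0 \<ge> 0\<close> e(1)[of 0] by auto
        ultimately show ?thesis
          using 1 n by (auto simp: J_def R_def)
      next
        case 2
        then have "y i \<in> J i"
          using y by (auto simp: V_def R_def J_def PiE_iff split: if_splits)
        then show ?thesis
          using closure_subset by blast
      next
        case 3
        then show ?thesis
          using y by (auto simp: V_def J_def)
      qed
    qed
    then have "y \<in> ?Q closure_of (Pi\<^sub>E UNIV J)"
      by (simp add: closure_of_product_topology PiE_iff)
    then show ?thesis
      using y \<open>Pi\<^sub>E UNIV J \<subseteq> ?H\<close> unfolding A hs closure_of_subtopology
      by (simp add: V_def Int_absorb1)
  qed
  have "Pi\<^sub>E UNIV J \<noteq> {}"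
  proof -
    have "J i \<noteq> {}" for i
      using e(1)[of i] zH by (auto simp: J_def)
    then show ?thesis
      by (simp add: PiE_eq_empty_iff)
  qed
  then show ?thesis
    using that[OF V_open zV VN con] clo unfolding A[symmetric] by blast
qed

text \<open>In a half-space chart the points with positive coordinate 0 are interior. Whether points
  of the wall are interior is left open: in the chart, the interior part of B lies between a
  connected set and its closure, and every such set is connected.\<close>

lemma manifold_small_neighbourhood:
  assumes X: "manifold_with_boundary n X" and n: "n > 0" and N: "openin X N" "x \<in> N"
  obtains B where "openin X B" "x \<in> B" "B \<subseteq> N" "connectedin X B"
    "connectedin X (B \<inter> manifold_interior n X)" "B \<inter> manifold_interior n X \<noteq> {}"
proof -
  have xX: "x \<in> topspace X"
    using N openin_subset by blast
  consider "locally_Euclidean_at n X x" | U \<phi> where "openin X U" "x \<in> U"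
    "homeomorphic_map (subtopology X U) (half_space n) \<phi>"
    using X xX unfolding manifold_with_boundary_def by blast
  then show ?thesis
  proof cases
    case 1
    then obtain U W h where U: "openin X U" "x \<in> U" "openin (Euclidean_space n) W"
      and h: "homeomorphic_map (subtopology X U) (subtopology (Euclidean_space n) W) h"
      unfolding locally_Euclidean_at_def homeomorphic_space by blast
    have "locally_connected_space (subtopology (Euclidean_space n) W)"
      using U(3) by (rule locally_connected_space_open_subset[OF locally_connected_Euclidean_space])
    then have "locally_connected_space (subtopology X U)"
      using homeomorphic_map_imp_homeomorphic_space[OF h] homeomorphic_locally_connected_space by blast
    moreover have "openin (subtopology X U) (N \<inter> U)" "x \<in> N \<inter> U"
      using N U by (auto intro: openin_subtopology_Int)
    ultimately obtain B where B: "openin (subtopology X U) B" "connectedin (subtopology X U) B"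
      "x \<in> B" "B \<subseteq> N \<inter> U"
      unfolding locally_connected_space by meson
    have BX: "openin X B" "connectedin X B"
      using B U(1) openin_trans_full by (auto simp: connectedin_subtopology)
    have "U \<subseteq> manifold_interior n X"
      using U h openin_subset[OF U(1)] homeomorphic_map_imp_homeomorphic_space[OF h]
      unfolding manifold_interior_def locally_Euclidean_at_def by blast
    then have "B \<inter> manifold_interior n X = B"
      using B(4) by blast
    then show ?thesis
      using that[OF BX(1) B(3)] B(3,4) BX(2) by auto
  next
    case 2
    have U: "U \<subseteq> topspace X"
      using 2(1) by (rule openin_subset)
    obtain \<psi> where \<psi>: "homeomorphic_maps (subtopology X U) (half_space n) \<phi> \<psi>"
      using 2(3) homeomorphic_map_maps by blast
    have \<psi>m: "homeomorphic_map (half_space n) (subtopology X U) \<psi>"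
      using \<psi> homeomorphic_maps_map homeomorphic_maps_sym by blast
    have inv: "\<psi> (\<phi> y) = y" if "y \<in> U" for y
      using \<psi> that U by (auto simp: homeomorphic_maps_def)
    have inv': "\<phi> (\<psi> y) = y" if "y \<in> topspace (half_space n)" for y
      using \<psi> that by (auto simp: homeomorphic_maps_def)
    have "openin (subtopology X U) (N \<inter> U)"
      using N(1) by (rule openin_subtopology_Int)
    then have "openin (half_space n) (\<phi> ` (N \<inter> U))"
      using homeomorphic_imp_open_map[OF 2(3)] by (simp add: open_map_def)
    then obtain V where V: "openin (half_space n) V" "\<phi> x \<in> V" "V \<subseteq> \<phi> ` (N \<inter> U)"
      "connectedin (half_space n) {y \<in> V. y 0 > 0}" "V \<subseteq> half_space n closure_of {y \<in> V. y 0 > 0}"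
      "{y \<in> V. y 0 > 0} \<noteq> {}"
      using half_space_small_neighbourhood[OF n, of "\<phi> ` (N \<inter> U)" "\<phi> x"] N(2) 2(2) by blast
    define B where "B = \<psi> ` V"
    have Vh: "V \<subseteq> topspace (half_space n)"
      using V(1) by (rule openin_subset)
    have BU: "openin (subtopology X U) B"
      using homeomorphic_imp_open_map[OF \<psi>m] V(1) by (simp add: open_map_def B_def)
    then have BX: "openin X B"
      using 2(1) openin_trans_full by blast
    have xB: "x \<in> B"
      using V(2) inv[OF 2(2)] unfolding B_def by (metis imageI)
    have BN: "B \<subseteq> N"
      using V(3) inv by (auto simp: B_def)
    define A where "A = {y \<in> V. y 0 > 0}"
    have A_int: "\<psi> y \<in> manifold_interior n X" if y: "y \<in> A" for y
    proof -
      let ?P = "{y \<in> topspace (Euclidean_space n). y 0 > 0}"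
      have "openin (Euclidean_space n) {y \<in> topspace (Euclidean_space n). y 0 \<in> {0<..}}"
      proof (rule openin_continuous_map_preimage)
        show "continuous_map (Euclidean_space n) euclideanreal (\<lambda>y. y 0)"
          unfolding Euclidean_space_def
          by (intro continuous_map_from_subtopology continuous_map_product_projection) simp
      qed simp
      then have P: "openin (Euclidean_space n) ?P"
        by (simp add: greaterThan_def)
      have yP: "y \<in> ?P" "y \<in> topspace (half_space n)"
        using y Vh by (auto simp: A_def half_space_def)
      have "locally_Euclidean_at n (Euclidean_space n) y"
        unfolding locally_Euclidean_at_def using P yP(1) homeomorphic_space_refl by blast
      then have "locally_Euclidean_at n (subtopology (Euclidean_space n) ?P) y"
        using locally_Euclidean_at_open[OF P yP(1)] by blast
      moreover have "subtopology (half_space n) ?P = subtopology (Euclidean_space n) ?P"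
        unfolding half_space_def subtopology_subtopology
        by (rule arg_cong2[where f = subtopology]) auto
      moreover have "openin (half_space n) ?P"
        using openin_subtopology_Int[OF P, of "{y. y 0 \<ge> 0}"] unfolding half_space_def
        by (metis (no_types, lifting) Int_absorb2 less_imp_le mem_Collect_eq subsetI)
      ultimately have "locally_Euclidean_at n (half_space n) y"
        using locally_Euclidean_at_open[of "half_space n" ?P y] yP(1) by simp
      then have "locally_Euclidean_at n (subtopology X U) (\<psi> y)"
        by (rule locally_Euclidean_at_homeomorphic[OF \<psi>m])
      moreover have "\<psi> y \<in> U"
        using homeomorphic_imp_surjective_map[OF \<psi>m] yP(2) U by auto
      ultimately show ?thesis
        using locally_Euclidean_at_open[OF 2(1)] U by (auto simp: manifold_interior_def)
    qed
    have conn: "connectedin X (\<psi> ` D)" if "A \<subseteq> D" "D \<subseteq> V" for D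
    proof -
      have "connectedin (half_space n) D"
        using connectedin_intermediate_closure_of[OF V(4)] that V(5) unfolding A_def by blast
      then have "connectedin (subtopology X U) (\<psi> ` D)"
        by (rule connectedin_continuous_map_image[OF homeomorphic_imp_continuous_map[OF \<psi>m]])
      then show ?thesis
        by (simp add: connectedin_subtopology)
    qed
    have "B \<inter> manifold_interior n X = \<psi> ` {y \<in> V. \<psi> y \<in> manifold_interior n X}"
      by (auto simp: B_def)
    moreover have "connectedin X (\<psi> ` {y \<in> V. \<psi> y \<in> manifold_interior n X})"
      using A_int by (intro conn) (auto simp: A_def)
    moreover have "connectedin X B"
      unfolding B_def by (rule conn) (auto simp: A_def)
    moreover have "\<psi> ` {y \<in> V. \<psi> y \<in> manifold_interior n X} \<noteq> {}"
      using A_int V(6) by (auto simp: A_def)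
    ultimately show ?thesis
      using that[OF BX xB BN] by simp
  qed
qed

lemma locally_connected_space_manifold:
  assumes "manifold_with_boundary n X" "n > 0"
  shows "locally_connected_space X"
  unfolding locally_connected_space
  using manifold_small_neighbourhood[OF assms] by metis

section \<open>Surfaces cut along curves\<close>

locale cut_surface =
  fixes X :: "'x topology" and T :: "'x set" and C :: "'c topology" and \<kappa> :: "'c \<Rightarrow> 'x"
  assumes cut: "cut_along 2 X T C \<kappa>"
    and Hausdorff_X: "Hausdorff_space X"
    and Euclidean_X: "x \<in> topspace X \<Longrightarrow> locally_Euclidean_at 2 X x"
    and T_subset: "T \<subseteq> topspace X"
    and finite_curves: "finite (connected_components_of (subtopology X T))"
begin

abbreviation interiorC where "interiorC \<equiv> manifold_interior 2 C"
abbreviation opp_end where "opp_end \<equiv> opp C \<kappa>"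

lemma compact_C: "compact_space C" and manifold_C: "manifold_with_boundary 2 C"
  and \<kappa>_continuous: "continuous_map C X \<kappa>" and \<kappa>_surj: "\<kappa> ` topspace C = topspace X"
  and boundary_C: "manifold_boundary 2 C = {x \<in> topspace C. \<kappa> x \<in> T}"
  and \<kappa>_homeo: "homeomorphic_map (subtopology C interiorC) (subtopology X (topspace X - T)) \<kappa>"
  using cut unfolding cut_along_def by simp_all

lemma Hausdorff_C: "Hausdorff_space C"
  using manifold_C by (simp add: manifold_with_boundary_def)

text \<open>A continuous map from a compact to a Hausdorff space is closed. Open sets of the surface
  are obtained below as complements of images of closed sets.\<close>

lemma \<kappa>_closed: "closed_map C X \<kappa>"
  by (rule continuous_imp_closed_map[OF \<kappa>_continuous compact_C Hausdorff_X])

lemma \<kappa>_in: "x \<in> topspace C \<Longrightarrow> \<kappa> x \<in> topspace X"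
  using \<kappa>_surj by blast

lemma interior_iff: "x \<in> topspace C \<Longrightarrow> x \<in> interiorC \<longleftrightarrow> \<kappa> x \<notin> T"
  using boundary_C unfolding manifold_boundary_def by blast

lemma interiorC_subset: "interiorC \<subseteq> topspace C"
  by (auto simp: manifold_interior_def)

lemma interior_inj:
  assumes "x \<in> interiorC" "y \<in> topspace C" "\<kappa> x = \<kappa> y"
  shows "x = y"
proof -
  have "y \<in> interiorC"
    using assms interior_iff interiorC_subset by (metis subsetD)
  moreover have "inj_on \<kappa> interiorC"
    using homeomorphic_imp_injective_map[OF \<kappa>_homeo] interiorC_subset by (simp add: Int_absorb1)
  ultimately show ?thesis
    using assms by (auto dest: inj_onD)
qed

section \<open>The two ends over each curve\<close>

lemma ends_subset: "\<delta> \<in> ends C \<Longrightarrow> \<delta> \<subseteq> manifold_boundary 2 C"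
  unfolding ends_def boundary_components_def using connected_components_of_subset by fastforce

lemma ends_topspace: "\<delta> \<in> ends C \<Longrightarrow> \<delta> \<subseteq> topspace C"
  using ends_subset unfolding boundary_C by blast

lemma ends_nonempty: "\<delta> \<in> ends C \<Longrightarrow> \<delta> \<noteq> {}"
  unfolding ends_def boundary_components_def using nonempty_connected_components_of by blast

lemma ends_disjoint: "\<delta> \<in> ends C \<Longrightarrow> \<epsilon> \<in> ends C \<Longrightarrow> x \<in> \<delta> \<Longrightarrow> x \<in> \<epsilon> \<Longrightarrow> \<delta> = \<epsilon>"
  unfolding ends_def boundary_components_def using connected_components_of_overlap by blast

lemma ends_connected: "\<delta> \<in> ends C \<Longrightarrow> connectedin C \<delta>"
  unfolding ends_def boundary_components_def
  using connectedin_connected_components_of by (fastforce simp: connectedin_subtopology)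

lemma ends_closed: "\<delta> \<in> ends C \<Longrightarrow> closedin C \<delta>"
  unfolding ends_def boundary_components_def
  using closedin_connected_components_of closedin_manifold_boundary closedin_trans_full by blast

lemma boundary_in_end:
  assumes "x \<in> topspace C" "\<kappa> x \<in> T"
  obtains \<delta> where "\<delta> \<in> ends C" "x \<in> \<delta>"
proof -
  have "x \<in> topspace (subtopology C (manifold_boundary 2 C))"
    using assms by (simp add: boundary_C)
  then show ?thesis
    using that unfolding ends_def boundary_components_def by (metis UnionE Union_connected_components_of)
qed

lemma end_curve:
  assumes "\<delta> \<in> ends C"
  obtains K where "K \<in> connected_components_of (subtopology X T)" "\<kappa> ` \<delta> \<subseteq> K"
proof -
  have "connectedin (subtopology X T) (\<kappa> ` \<delta>)"
    using connectedin_continuous_map_image[OF \<kappa>_continuous ends_connected[OF assms]] ends_subset[OF assms]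
    by (auto simp: connectedin_subtopology boundary_C)
  moreover have "subtopology X T \<noteq> trivial_topology"
    using ends_nonempty[OF assms] ends_subset[OF assms] T_subset
    by (auto simp: boundary_C simp flip: null_topspace_iff_trivial)
  ultimately show ?thesis
    using exists_connected_component_of_superset that by blast
qed

lemma curve_ends:
  assumes "K \<in> connected_components_of (subtopology X T)"
  obtains A B where "A \<noteq> B" "{\<delta> \<in> ends C. \<kappa> ` \<delta> \<subseteq> K} = {A, B}"
    "\<kappa> ` A = K" "\<kappa> ` B = K" "inj_on \<kappa> A" "inj_on \<kappa> B"
proof -
  have K: "K \<subseteq> topspace X"
    using connected_components_of_subset[OF assms] by auto
  obtain A B where AB: "A \<noteq> B" "{\<delta> \<in> boundary_components 2 C. \<kappa> ` \<delta> \<subseteq> K} = {A, B}"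
    "homeomorphic_map (subtopology C A) (subtopology X K) \<kappa>"
    "homeomorphic_map (subtopology C B) (subtopology X K) \<kappa>"
    using cut assms unfolding cut_along_def by meson
  have "A \<in> ends C" "B \<in> ends C"
    using AB(2) unfolding ends_def by blast+
  then have "topspace (subtopology C A) = A" "topspace (subtopology C B) = B" "topspace (subtopology X K) = K"
    using ends_topspace K by auto
  then show ?thesis
    using that[OF AB(1) AB(2)[folded ends_def]]
      homeomorphic_imp_surjective_map[OF AB(3)] homeomorphic_imp_surjective_map[OF AB(4)]
      homeomorphic_imp_injective_map[OF AB(3)] homeomorphic_imp_injective_map[OF AB(4)] by simp
qed

lemma finite_ends: "finite (ends C)"
proof -
  have "finite {\<delta> \<in> ends C. \<kappa> ` \<delta> \<subseteq> K}" if "K \<in> connected_components_of (subtopology X T)" for K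
    by (rule curve_ends[OF that]) simp
  then have "finite (\<Union>K \<in> connected_components_of (subtopology X T). {\<delta> \<in> ends C. \<kappa> ` \<delta> \<subseteq> K})"
    using finite_curves by blast
  moreover have "ends C \<subseteq> (\<Union>K \<in> connected_components_of (subtopology X T). {\<delta> \<in> ends C. \<kappa> ` \<delta> \<subseteq> K})"
  proof
    fix \<delta> assume "\<delta> \<in> ends C"
    moreover from this obtain K where "K \<in> connected_components_of (subtopology X T)" "\<kappa> ` \<delta> \<subseteq> K"
      by (rule end_curve)
    ultimately show "\<delta> \<in> (\<Union>K \<in> connected_components_of (subtopology X T). {\<delta> \<in> ends C. \<kappa> ` \<delta> \<subseteq> K})"
      by blast
  qed
  ultimately show ?thesis
    by (rule rev_finite_subset)
qed

text \<open>The images of two ends lie in components of T. If the images meet, the components are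
  equal, and \<open>cut_along\<close> provides exactly two ends over one component.\<close>

lemma end_pair:
  assumes "\<delta> \<in> ends C"
  obtains \<delta>' where "\<delta>' \<in> ends C" "\<delta>' \<noteq> \<delta>" "\<kappa> ` \<delta>' = \<kappa> ` \<delta>" "inj_on \<kappa> \<delta>"
    "\<And>\<epsilon>. \<epsilon> \<in> ends C \<Longrightarrow> \<kappa> ` \<epsilon> \<inter> \<kappa> ` \<delta> \<noteq> {} \<Longrightarrow> \<epsilon> = \<delta> \<or> \<epsilon> = \<delta>'"
proof -
  obtain K where K: "K \<in> connected_components_of (subtopology X T)" "\<kappa> ` \<delta> \<subseteq> K"
    using end_curve[OF assms] .
  obtain A B where AB: "A \<noteq> B" "{\<delta> \<in> ends C. \<kappa> ` \<delta> \<subseteq> K} = {A, B}"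
    "\<kappa> ` A = K" "\<kappa> ` B = K" "inj_on \<kappa> A" "inj_on \<kappa> B"
    using curve_ends[OF K(1)] .
  have all: "\<epsilon> = A \<or> \<epsilon> = B" if \<epsilon>: "\<epsilon> \<in> ends C" "\<kappa> ` \<epsilon> \<inter> K \<noteq> {}" for \<epsilon>
  proof -
    obtain L where L: "L \<in> connected_components_of (subtopology X T)" "\<kappa> ` \<epsilon> \<subseteq> L"
      using end_curve[OF \<epsilon>(1)] .
    then have "L = K"
      using connected_components_of_overlap[OF L(1) K(1)] \<epsilon>(2) by blast
    then show ?thesis
      using L(2) \<epsilon>(1) AB(2) by blast
  qed
  have AB_in: "A \<in> ends C" "B \<in> ends C"
    using AB(2) by blast+
  have "\<delta> = A \<or> \<delta> = B"
    using AB(2) assms K(2) by blast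
  then show ?thesis
  proof
    assume \<delta>: "\<delta> = A"
    show ?thesis
    proof (rule that[OF AB_in(2)])
      show "\<epsilon> = \<delta> \<or> \<epsilon> = B" if "\<epsilon> \<in> ends C" "\<kappa> ` \<epsilon> \<inter> \<kappa> ` \<delta> \<noteq> {}" for \<epsilon>
        using all[OF that(1)] that(2) AB(3) unfolding \<delta> by simp
    qed (use AB \<delta> in simp_all)
  next
    assume \<delta>: "\<delta> = B"
    show ?thesis
    proof (rule that[OF AB_in(1)])
      show "\<epsilon> = \<delta> \<or> \<epsilon> = A" if "\<epsilon> \<in> ends C" "\<kappa> ` \<epsilon> \<inter> \<kappa> ` \<delta> \<noteq> {}" for \<epsilon>
        using all[OF that(1)] that(2) AB(4) unfolding \<delta> by auto
    qed (use AB \<delta> in simp_all)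
  qed
qed

lemma opp_end:
  assumes "\<delta> \<in> ends C"
  shows "opp_end \<delta> \<in> ends C" "opp_end \<delta> \<noteq> \<delta>" "\<kappa> ` opp_end \<delta> = \<kappa> ` \<delta>" "inj_on \<kappa> \<delta>"
    and "\<And>\<epsilon>. \<epsilon> \<in> ends C \<Longrightarrow> \<kappa> ` \<epsilon> \<inter> \<kappa> ` \<delta> \<noteq> {} \<Longrightarrow> \<epsilon> = \<delta> \<or> \<epsilon> = opp_end \<delta>"
proof -
  obtain \<delta>' where \<delta>': "\<delta>' \<in> ends C" "\<delta>' \<noteq> \<delta>" "\<kappa> ` \<delta>' = \<kappa> ` \<delta>" "inj_on \<kappa> \<delta>"
    and all: "\<And>\<epsilon>. \<epsilon> \<in> ends C \<Longrightarrow> \<kappa> ` \<epsilon> \<inter> \<kappa> ` \<delta> \<noteq> {} \<Longrightarrow> \<epsilon> = \<delta> \<or> \<epsilon> = \<delta>'"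
    using end_pair[OF assms] by blast
  have "opp_end \<delta> = \<delta>'"
    unfolding opp_def
  proof (rule the_equality)
    fix \<epsilon> assume "\<epsilon> \<in> ends C \<and> \<epsilon> \<noteq> \<delta> \<and> \<kappa> ` \<epsilon> = \<kappa> ` \<delta>"
    then show "\<epsilon> = \<delta>'"
      using all[of \<epsilon>] ends_nonempty[OF assms] by auto
  qed (use \<delta>' in simp)
  then show "opp_end \<delta> \<in> ends C" "opp_end \<delta> \<noteq> \<delta>" "\<kappa> ` opp_end \<delta> = \<kappa> ` \<delta>" "inj_on \<kappa> \<delta>"
    "\<And>\<epsilon>. \<epsilon> \<in> ends C \<Longrightarrow> \<kappa> ` \<epsilon> \<inter> \<kappa> ` \<delta> \<noteq> {} \<Longrightarrow> \<epsilon> = \<delta> \<or> \<epsilon> = opp_end \<delta>"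
    using \<delta>' all by blast+
qed

lemma opp_opp_end:
  assumes "\<delta> \<in> ends C"
  shows "opp_end (opp_end \<delta>) = \<delta>"
proof -
  have "\<kappa> ` \<delta> \<inter> \<kappa> ` opp_end \<delta> \<noteq> {}"
    using opp_end(3)[OF assms] ends_nonempty[OF assms] by auto
  then show ?thesis
    using opp_end(2)[OF assms] opp_end(5)[OF opp_end(1)[OF assms] assms] by metis
qed

text \<open>Over a curve there are only \<delta> and its opposite, and \<kappa> is injective on
  \<delta>, so a further point with the same image has to lie on the opposite end.\<close>

lemma same_image_end:
  assumes "\<delta> \<in> ends C" "x \<in> \<delta>" "y \<in> topspace C" "\<kappa> x = \<kappa> y"
  shows "y = x \<or> y \<in> opp_end \<delta>"
proof -
  have "\<kappa> y \<in> T"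
    using ends_subset[OF assms(1)] assms(2,4) by (auto simp: boundary_C)
  then obtain \<epsilon> where \<epsilon>: "\<epsilon> \<in> ends C" "y \<in> \<epsilon>"
    using boundary_in_end assms(3) by blast
  then have "\<epsilon> = \<delta> \<or> \<epsilon> = opp_end \<delta>"
    using opp_end(5)[OF assms(1) \<epsilon>(1)] assms(2,4) by force
  then show ?thesis
    using opp_end(4)[OF assms(1)] \<epsilon>(2) assms(2,4) by (metis inj_onD)
qed

lemma same_image_cases:
  assumes "x \<in> topspace C" "y \<in> topspace C" "\<kappa> x = \<kappa> y" "x \<noteq> y"
  obtains \<delta> where "\<delta> \<in> ends C" "x \<in> \<delta>" "y \<in> opp_end \<delta>"
proof -
  have "\<kappa> x \<in> T"
    using assms interior_iff interior_inj by blast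
  then obtain \<delta> where "\<delta> \<in> ends C" "x \<in> \<delta>"
    using boundary_in_end assms(1) by blast
  then show ?thesis
    using that same_image_end assms by metis
qed

lemma end_vertex:
  assumes "\<delta> \<in> ends C"
  shows "vertex_of C \<delta> \<in> connected_components_of C" "\<delta> \<subseteq> vertex_of C \<delta>"
proof -
  have "C \<noteq> trivial_topology"
    using ends_nonempty[OF assms] ends_topspace[OF assms] by auto
  then obtain v where v: "v \<in> connected_components_of C" "\<delta> \<subseteq> v"
    using exists_connected_component_of_superset[OF ends_connected[OF assms]] by blast
  have "vertex_of C \<delta> = v"
    unfolding vertex_of_def
  proof (rule the_equality)
    fix w assume "w \<in> connected_components_of C \<and> \<delta> \<subseteq> w"
    then show "w = v"
      using connected_components_of_overlap[OF _ v(1)] v(2) ends_nonempty[OF assms] by blast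
  qed (use v in simp)
  then show "vertex_of C \<delta> \<in> connected_components_of C" "\<delta> \<subseteq> vertex_of C \<delta>"
    using v by simp_all
qed

lemma component_open: "v \<in> connected_components_of C \<Longrightarrow> openin C v"
  using locally_connected_space_manifold[OF manifold_C]
  by (simp add: openin_connected_components_of_locally_connected_space)

end

section \<open>The subsurface carried by a set of components\<close>

locale cut_subsurface = cut_surface X T C \<kappa>
  for X :: "'x topology" and T and C :: "'c topology" and \<kappa> +
  fixes \<Phi> :: "'c set set"
  assumes \<Phi>: "\<Phi> \<subseteq> connected_components_of C"
begin

abbreviation part where "part \<equiv> \<Union>\<Phi>"
abbreviation Y where "Y \<equiv> almost_fiber_part X \<kappa> \<Phi>"

lemma part_subset: "part \<subseteq> topspace C"
  using \<Phi> connected_components_of_subset by blast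

lemma part_open: "openin C part"
  using \<Phi> component_open by blast

lemma part_closed: "closedin C part"
proof -
  have "topspace C - part = \<Union>(connected_components_of C - \<Phi>)"
  proof (intro equalityI subsetI)
    fix x assume "x \<in> topspace C - part"
    then show "x \<in> \<Union>(connected_components_of C - \<Phi>)"
      using Union_connected_components_of[of C] by blast
  next
    fix x assume "x \<in> \<Union>(connected_components_of C - \<Phi>)"
    then show "x \<in> topspace C - part"
      using \<Phi> connected_components_of_overlap[of _ C] connected_components_of_subset[of _ C] by blast
  qed
  moreover have "openin C (\<Union>(connected_components_of C - \<Phi>))"
    using component_open by blast
  ultimately show ?thesis
    using part_subset by (simp add: closedin_def)
qed

lemma Y_eq: "Y = subtopology X (\<kappa> ` part)"
  by (simp add: almost_fiber_part_def)

lemma topspace_Y: "topspace Y = \<kappa> ` part"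
  using part_subset \<kappa>_in by (auto simp: Y_eq)

lemma closedin_part_image: "closedin X (\<kappa> ` (part \<inter> Z))" if "closedin C Z" for Z
  using \<kappa>_closed part_closed that by (simp add: closed_map_def closedin_Int)

lemma openin_Y_complement: "openin Y (topspace Y - \<kappa> ` (part \<inter> Z))" if "closedin C Z" for Z
proof -
  have "closedin Y (\<kappa> ` (part \<inter> Z))"
    unfolding Y_eq using closedin_part_image[OF that] by (auto intro: closedin_subset_topspace)
  then show ?thesis
    by (simp add: openin_diff)
qed

text \<open>Y has the subspace topology of X, while the bundle over it is glued from pieces. The two
  views agree because \<kappa> maps a compact space onto a Hausdorff one.\<close>

lemma quotient_map_part: "quotient_map (subtopology C part) Y \<kappa>"
proof (rule continuous_imp_quotient_map)
  show "continuous_map (subtopology C part) Y \<kappa>"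
    unfolding Y_eq using \<kappa>_continuous
    by (auto simp: continuous_map_in_subtopology continuous_map_from_subtopology)
  show "compact_space (subtopology C part)"
    using part_closed compact_C closedin_compact_space compact_space_subtopology by blast
  show "Hausdorff_space Y"
    unfolding Y_eq using Hausdorff_X by (rule Hausdorff_space_subtopology)
  show "\<kappa> ` topspace (subtopology C part) = topspace Y"
    using part_subset topspace_Y by (simp add: Int_absorb1)
qed

lemma end_part_cases:
  assumes "\<delta> \<in> ends C"
  shows "vertex_of C \<delta> \<in> \<Phi> \<longleftrightarrow> \<delta> \<inter> part \<noteq> {}" and "vertex_of C \<delta> \<in> \<Phi> \<longleftrightarrow> \<delta> \<subseteq> part"
proof -
  have 1: "\<delta> \<subseteq> part" if "vertex_of C \<delta> \<in> \<Phi>"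
    using end_vertex(2)[OF assms] that by blast
  have 2: "vertex_of C \<delta> \<in> \<Phi>" if "\<delta> \<inter> part \<noteq> {}"
  proof -
    obtain v where v: "v \<in> \<Phi>" "\<delta> \<inter> v \<noteq> {}"
      using \<open>\<delta> \<inter> part \<noteq> {}\<close> by blast
    then have "v = vertex_of C \<delta>"
      using connected_components_of_overlap[OF _ end_vertex(1)[OF assms], of v] \<Phi> end_vertex(2)[OF assms] by blast
    then show ?thesis
      using v(1) by simp
  qed
  show "vertex_of C \<delta> \<in> \<Phi> \<longleftrightarrow> \<delta> \<inter> part \<noteq> {}" "vertex_of C \<delta> \<in> \<Phi> \<longleftrightarrow> \<delta> \<subseteq> part"
    using 1 2 ends_nonempty[OF assms] by blast+
qed

lemma fiber_ends_iff:
  "\<delta> \<in> fiber_ends C \<kappa> \<Phi> \<longleftrightarrow> \<delta> \<in> ends C \<and> \<delta> \<subseteq> part \<and> opp_end \<delta> \<subseteq> part"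
  using end_part_cases(2) opp_end(1) unfolding fiber_ends_def by blast

lemma fiber_ends_opp: "\<delta> \<in> fiber_ends C \<kappa> \<Phi> \<Longrightarrow> opp_end \<delta> \<in> fiber_ends C \<kappa> \<Phi>"
  using opp_opp_end opp_end(1) by (simp add: fiber_ends_iff)

lemma fiber_end_intro:
  assumes "\<delta> \<in> ends C" "x \<in> \<delta>" "x \<in> part" "y \<in> opp_end \<delta>" "y \<in> part"
  shows "\<delta> \<in> fiber_ends C \<kappa> \<Phi>"
  using assms end_part_cases[OF assms(1)] end_part_cases[OF opp_end(1)[OF assms(1)]]
  unfolding fiber_ends_iff by blast

section \<open>The gluing relation and its local straightening\<close>

context
  fixes D :: "('c, 'd, 'p, 'j) setup_data"
  assumes h_nonzero: "\<forall>\<delta> \<in> fiber_ends C \<kappa> \<Phi>. h_number C D \<delta> \<noteq> 0"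
begin

lemma s_number_nonzero: "\<delta> \<in> fiber_ends C \<kappa> \<Phi> \<Longrightarrow> s_number C \<kappa> D \<delta> \<noteq> 0"
  using h_nonzero fiber_ends_opp by (simp add: s_number_def)

lemma s_number_opp: "\<delta> \<in> fiber_ends C \<kappa> \<Phi> \<Longrightarrow> s_number C \<kappa> D (opp_end \<delta>) * s_number C \<kappa> D \<delta> = 1"
  using bspec[OF h_nonzero, of \<delta>] bspec[OF h_nonzero fiber_ends_opp, of \<delta>] opp_opp_end[of \<delta>]
  by (simp add: s_number_def fiber_ends_iff)

lemma gluing_rel_iff:
  "((x, a), (y, b)) \<in> gluing_rel C \<kappa> \<Phi> D \<longleftrightarrow> x = y \<and> a = b \<or>
     (\<exists>\<delta> \<in> fiber_ends C \<kappa> \<Phi>. x \<in> opp_end \<delta> \<and> y \<in> \<delta> \<and> \<kappa> x = \<kappa> y \<and> b = s_number C \<kappa> D \<delta> * a)"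
  by (auto simp: gluing_rel_def)

text \<open>Classes have at most two members. In a chain of two genuine gluings the middle point
  determines its end, so the second gluing runs back along the same edge; injectivity on ends
  returns the point, and \<open>s_number_opp\<close> returns the coordinate.\<close>

lemma equiv_gluing_rel: "equiv UNIV (gluing_rel C \<kappa> \<Phi> D)"
proof (rule equivI)
  show "gluing_rel C \<kappa> \<Phi> D \<subseteq> UNIV \<times> UNIV"
    by simp
  show "refl (gluing_rel C \<kappa> \<Phi> D)"
    by (auto simp: refl_on_def gluing_rel_iff)
  show "sym (gluing_rel C \<kappa> \<Phi> D)"
  proof (rule symI, clarify)
    fix x a y b assume "((x, a), (y, b)) \<in> gluing_rel C \<kappa> \<Phi> D"
    then consider "x = y" "a = b" | \<delta> where "\<delta> \<in> fiber_ends C \<kappa> \<Phi>" "x \<in> opp_end \<delta>" "y \<in> \<delta>" "\<kappa> x = \<kappa> y"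
        "b = s_number C \<kappa> D \<delta> * a"
      by (auto simp: gluing_rel_iff)
    then show "((y, b), (x, a)) \<in> gluing_rel C \<kappa> \<Phi> D"
    proof cases
      case 2
      have "a = s_number C \<kappa> D (opp_end \<delta>) * b"
        using s_number_opp[OF 2(1)] by (simp add: 2(5) flip: mult.assoc)
      moreover have "y \<in> opp_end (opp_end \<delta>)"
        using 2(1,3) by (simp add: opp_opp_end fiber_ends_iff)
      ultimately show ?thesis
        using fiber_ends_opp[OF 2(1)] 2(2,4) unfolding gluing_rel_iff by force
    qed (simp add: gluing_rel_iff)
  qed
  show "trans (gluing_rel C \<kappa> \<Phi> D)"
  proof (rule transI, clarify)
    fix x a y b z c
    assume xy: "((x, a), (y, b)) \<in> gluing_rel C \<kappa> \<Phi> D" and yz: "((y, b), (z, c)) \<in> gluing_rel C \<kappa> \<Phi> D"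
    show "((x, a), (z, c)) \<in> gluing_rel C \<kappa> \<Phi> D"
    proof (cases "(x = y \<and> a = b) \<or> (y = z \<and> b = c)")
      case False
      then obtain \<delta> \<epsilon> where \<delta>: "\<delta> \<in> fiber_ends C \<kappa> \<Phi>" "x \<in> opp_end \<delta>" "y \<in> \<delta>" "\<kappa> x = \<kappa> y"
          "b = s_number C \<kappa> D \<delta> * a"
        and \<epsilon>: "\<epsilon> \<in> fiber_ends C \<kappa> \<Phi>" "y \<in> opp_end \<epsilon>" "z \<in> \<epsilon>" "\<kappa> y = \<kappa> z" "c = s_number C \<kappa> D \<epsilon> * b"
        using xy yz unfolding gluing_rel_iff by blast
      have ends: "\<delta> \<in> ends C" "\<epsilon> \<in> ends C"
        using \<delta>(1) \<epsilon>(1) by (simp_all add: fiber_ends_iff)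
      have "\<delta> = opp_end \<epsilon>"
        using ends_disjoint[OF ends(1) opp_end(1)[OF ends(2)] \<delta>(3) \<epsilon>(2)] .
      then have \<epsilon>\<delta>: "\<epsilon> = opp_end \<delta>"
        using opp_opp_end ends(2) by simp
      then have "x = z"
        using opp_end(4)[OF ends(2)] \<delta>(2,4) \<epsilon>(3,4) by (auto dest: inj_onD)
      moreover have "c = a"
        using s_number_opp[OF \<delta>(1)] by (simp add: \<epsilon>(5) \<delta>(5) \<epsilon>\<delta> flip: mult.assoc)
      ultimately show ?thesis
        by (simp add: gluing_rel_iff)
    qed (use xy yz in auto)
  qed
qed

text \<open>Two distinct preimages in \<open>part\<close> would lie on opposite ends, both contained
  in \<open>part\<close>, and these form an edge of the full subgraph. So \<kappa> is injective on
  the part lying over W, and trivial weights suffice.\<close>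

lemma gluing_weights_away_from_ends:
  defines "W \<equiv> topspace Y - \<kappa> ` (part \<inter> \<Union>(fiber_ends C \<kappa> \<Phi>))"
  shows "gluing_weights (subtopology C part) Y \<kappa> (gluing_rel C \<kappa> \<Phi> D) W (\<lambda>_. 1)"
proof -
  have fe: "fiber_ends C \<kappa> \<Phi> \<subseteq> ends C"
    by (auto simp: fiber_ends_iff)
  have "closedin C (\<Union>(fiber_ends C \<kappa> \<Phi>))"
    using fe finite_subset[OF fe finite_ends] ends_closed by (intro closedin_Union) auto
  then have W: "openin Y W"
    unfolding W_def by (rule openin_Y_complement)
  have cont: "continuous_map (subtopology C part) Y \<kappa>"
    using quotient_map_part by (rule quotient_imp_continuous_map)
  have op: "openin (subtopology C part) {x \<in> topspace (subtopology C part). \<kappa> x \<in> W \<and> 1 = g}" for g :: rat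
    using openin_continuous_map_preimage[OF cont W] by (cases "g = 1") auto
  have no: "z \<notin> \<delta>" if "\<delta> \<in> fiber_ends C \<kappa> \<Phi>" "z \<in> part" "\<kappa> z \<in> W" for z \<delta>
    using that unfolding W_def by blast
  have rel: "((x, a), (y, b)) \<in> gluing_rel C \<kappa> \<Phi> D \<longleftrightarrow> 1 * a = 1 * b"
    if xy': "x \<in> topspace (subtopology C part)" "y \<in> topspace (subtopology C part)" "\<kappa> x \<in> W" "\<kappa> x = \<kappa> y"
    for x y a b
  proof -
    have xy: "x \<in> part" "y \<in> part" "x \<in> topspace C" "y \<in> topspace C" "\<kappa> y \<in> W"
      using xy' by auto
    have "x = y"
    proof (rule ccontr)
      assume "x \<noteq> y"
      then obtain \<delta> where "\<delta> \<in> ends C" "x \<in> \<delta>" "y \<in> opp_end \<delta>"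
        using same_image_cases[OF xy(3,4) xy'(4)] by blast
      then show False
        using fiber_end_intro no[OF _ xy(1) xy'(3)] xy by blast
    qed
    then show ?thesis
      using no[OF _ xy(2,5)] by (auto simp: gluing_rel_iff)
  qed
  show ?thesis
    unfolding gluing_weights_def
  proof (intro conjI allI ballI impI)
    show "openin Y W" "openin (subtopology C part) {x \<in> topspace (subtopology C part). \<kappa> x \<in> W \<and> 1 = g}" for g :: rat
      by (rule W op)+
  qed (simp, rule rel)
qed

text \<open>The two sides of the curve have disjoint neighborhoods in C. The weight
  \<open>s_number C \<kappa> D \<delta>\<close> on the side of the opposite end and 1 on the side of
  \<delta> turn the gluing factor into an equality of coordinates.\<close>

lemma gluing_weights_at_end:
  assumes \<delta>: "\<delta> \<in> fiber_ends C \<kappa> \<Phi>" and x: "x \<in> \<delta>"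
  shows "\<exists>W w. \<kappa> x \<in> W \<and> gluing_weights (subtopology C part) Y \<kappa> (gluing_rel C \<kappa> \<Phi> D) W w"
proof -
  let ?\<delta>' = "opp_end \<delta>"
  define q where "q = s_number C \<kappa> D \<delta>"
  have q0: "q \<noteq> 0" and q1: "s_number C \<kappa> D ?\<delta>' * q = 1"
    using \<delta> s_number_nonzero s_number_opp by (simp_all add: q_def)
  have e: "\<delta> \<in> ends C" "?\<delta>' \<in> ends C" "\<delta> \<subseteq> part" "?\<delta>' \<subseteq> part" "?\<delta>' \<noteq> \<delta>"
    using \<delta> opp_end by (auto simp: fiber_ends_iff)
  have "disjnt \<delta> ?\<delta>'"
    using ends_disjoint[OF e(1,2)] e(5) by (auto simp: disjnt_iff)
  moreover have "compactin C \<delta>" "compactin C ?\<delta>'"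
    using closedin_compact_space[OF compact_C] ends_closed e(1,2) by blast+
  ultimately obtain N1 N2 where N: "openin C N1" "openin C N2" "\<delta> \<subseteq> N1" "?\<delta>' \<subseteq> N2" "disjnt N1 N2"
    using Hausdorff_space_compact_sets Hausdorff_C by metis
  define F where "F = fiber_ends C \<kappa> \<Phi> - {\<delta>, ?\<delta>'}"
  have F: "F \<subseteq> ends C"
    by (auto simp: F_def fiber_ends_iff)
  have cZ: "closedin C ((topspace C - (N1 \<union> N2)) \<union> \<Union>F)"
    using N(1,2) F finite_subset[OF F finite_ends] ends_closed
    by (intro closedin_Un closedin_Union closedin_diff openin_Un) auto
  \<comment> \<open>Removing the images of everything outside both neighborhoods and of all other
    glued ends leaves an open set over which \<delta> and its opposite are the only glued
    ends.\<close>
  define W where "W = topspace Y - \<kappa> ` (part \<inter> ((topspace C - (N1 \<union> N2)) \<union> \<Union>F))"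
  have W: "openin Y W"
    unfolding W_def using cZ by (rule openin_Y_complement)
  have W_N: "z \<in> N1 \<union> N2" and W_F: "\<And>\<epsilon>. \<epsilon> \<in> F \<Longrightarrow> z \<notin> \<epsilon>" if "z \<in> part" "\<kappa> z \<in> W" for z
    using that part_subset by (auto simp: W_def)
  have xW: "\<kappa> x \<in> W"
  proof -
    have "z \<notin> (topspace C - (N1 \<union> N2)) \<union> \<Union>F" if "z \<in> part" "\<kappa> x = \<kappa> z" for z
    proof -
      have "z = x \<or> z \<in> ?\<delta>'"
        using same_image_end[OF e(1) x] that part_subset by blast
      moreover have "z \<notin> \<Union>F" if z: "z \<in> \<delta> \<union> ?\<delta>'"
      proof
        assume "z \<in> \<Union>F"
        then obtain \<epsilon> where \<epsilon>: "\<epsilon> \<in> F" "z \<in> \<epsilon>"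
          by blast
        then have "\<epsilon> = \<delta> \<or> \<epsilon> = ?\<delta>'"
          using z ends_disjoint[OF e(1), of \<epsilon> z] ends_disjoint[OF e(2), of \<epsilon> z] F by blast
        then show False
          using \<epsilon>(1) by (auto simp: F_def)
      qed
      ultimately show ?thesis
        using x N(3,4) by blast
    qed
    then show ?thesis
      using x e(3) by (auto simp: W_def topspace_Y)
  qed
  define w where "w z = (if z \<in> N2 then q else 1)" for z
  have cont: "continuous_map (subtopology C part) Y \<kappa>"
    using quotient_map_part by (rule quotient_imp_continuous_map)
  have op: "openin (subtopology C part) {z \<in> topspace (subtopology C part). \<kappa> z \<in> W \<and> w z = g}" for g
  proof -
    define N where "N = (if g = q then N2 else {}) \<union> (if g = 1 then N1 else {})"
    have "openin (subtopology C part) (N \<inter> part)"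
      using N_def \<open>openin C N1\<close> \<open>openin C N2\<close> by (intro openin_subtopology_Int) auto
    moreover have "openin (subtopology C part) {z \<in> topspace (subtopology C part). \<kappa> z \<in> W}"
      by (rule openin_continuous_map_preimage[OF cont W])
    moreover have "{z \<in> topspace (subtopology C part). \<kappa> z \<in> W \<and> w z = g} =
        (N \<inter> part) \<inter> {z \<in> topspace (subtopology C part). \<kappa> z \<in> W}"
    proof -
      have "w z = g \<longleftrightarrow> z \<in> N" if "z \<in> part" "\<kappa> z \<in> W" for z
        using W_N[OF that] \<open>disjnt N1 N2\<close> by (auto simp: w_def N_def disjnt_iff)
      then show ?thesis
        by auto
    qed
    ultimately show ?thesis
      by (simp add: openin_Int)
  qed
  have w0: "w z \<noteq> 0" for z
    using q0 by (simp add: w_def)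
  have rel: "((y, a), (z, b)) \<in> gluing_rel C \<kappa> \<Phi> D \<longleftrightarrow> w y * a = w z * b"
    if yz: "y \<in> topspace (subtopology C part)" "z \<in> topspace (subtopology C part)" "\<kappa> y \<in> W" "\<kappa> y = \<kappa> z"
    for y z a b
  proof -
    have p: "y \<in> part" "z \<in> part" "y \<in> topspace C" "z \<in> topspace C" "\<kappa> z \<in> W"
      using yz by auto
    show ?thesis
    proof (cases "y = z")
      case True
      \<comment> \<open>A point on an end and on its opposite could be related to itself with a
        factor; disjointness of the two ends excludes this.\<close>
      have "\<not> (y \<in> opp_end \<epsilon> \<and> y \<in> \<epsilon>)" if "\<epsilon> \<in> fiber_ends C \<kappa> \<Phi>" for \<epsilon>
        using that ends_disjoint opp_end(1,2) unfolding fiber_ends_iff by metis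
      then show ?thesis
        using True q0 by (auto simp: gluing_rel_iff w_def)
    next
      case False
      then obtain \<epsilon> where \<epsilon>: "\<epsilon> \<in> ends C" "y \<in> \<epsilon>" "z \<in> opp_end \<epsilon>"
        using same_image_cases[OF p(3,4) yz(4)] by blast
      then have "\<epsilon> \<in> fiber_ends C \<kappa> \<Phi>"
        using fiber_end_intro p by blast
      then have "\<epsilon> = \<delta> \<or> \<epsilon> = ?\<delta>'"
        using W_F[OF p(1) yz(3)] \<epsilon>(2) unfolding F_def by blast
      then have cases: "y \<in> \<delta> \<and> z \<in> ?\<delta>' \<or> y \<in> ?\<delta>' \<and> z \<in> \<delta>"
        using \<epsilon> opp_opp_end[OF e(1)] by auto
      have rel: "((y, a), (z, b)) \<in> gluing_rel C \<kappa> \<Phi> D \<longleftrightarrow> b = s_number C \<kappa> D \<eta> * a"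
        if "\<eta> \<in> fiber_ends C \<kappa> \<Phi>" "z \<in> \<eta>" "y \<in> opp_end \<eta>" for \<eta>
      proof -
        have "\<eta>' = \<eta>" if "\<eta>' \<in> fiber_ends C \<kappa> \<Phi>" "z \<in> \<eta>'" for \<eta>'
          using ends_disjoint that \<open>\<eta> \<in> fiber_ends C \<kappa> \<Phi>\<close> \<open>z \<in> \<eta>\<close> unfolding fiber_ends_iff by metis
        then show ?thesis
          using False that yz(4) unfolding gluing_rel_iff by blast
      qed
      from cases show ?thesis
      proof
        assume "y \<in> \<delta> \<and> z \<in> ?\<delta>'"
        moreover from this have "w y = 1" "w z = q"
          using N(3-5) by (auto simp: w_def disjnt_iff)
        ultimately show ?thesis
          using rel[OF fiber_ends_opp[OF \<delta>]] opp_opp_end[OF e(1)] q1 q0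
          by (auto simp: field_simps)
      next
        assume "y \<in> ?\<delta>' \<and> z \<in> \<delta>"
        moreover from this have "w y = q" "w z = 1"
          using N(3-5) by (auto simp: w_def disjnt_iff)
        ultimately show ?thesis
          using rel[OF \<delta>] by (auto simp: q_def)
      qed
    qed
  qed
  have "gluing_weights (subtopology C part) Y \<kappa> (gluing_rel C \<kappa> \<Phi> D) W w"
    unfolding gluing_weights_def
  proof (intro conjI allI ballI impI)
    show "openin Y W" "openin (subtopology C part) {z \<in> topspace (subtopology C part). \<kappa> z \<in> W \<and> w z = g}" for g
      by (rule W op)+
  qed (rule w0, rule rel)
  then show ?thesis
    using xW by blast
qed

lemma rat_bundle_H_plus:
  shows "rat_bundle {q. q \<noteq> 0} Y (H_plus C \<kappa> \<Phi> D)"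
    and "continuous_map (prod_topology (subtopology C part) (discrete_topology {q. q \<noteq> 0}))
      (total (H_plus C \<kappa> \<Phi> D)) (\<lambda>z. gluing_rel C \<kappa> \<Phi> D `` {z})"
    and "proj (H_plus C \<kappa> \<Phi> D) (gluing_rel C \<kappa> \<Phi> D `` {(x, a)}) = \<kappa> x"
    and "c \<noteq> 0 \<Longrightarrow> act (H_plus C \<kappa> \<Phi> D) c (gluing_rel C \<kappa> \<Phi> D `` {(x, a)}) =
      gluing_rel C \<kappa> \<Phi> D `` {(x, c * a)}"
proof -
  have w: "\<exists>W w. p \<in> W \<and> gluing_weights (subtopology C part) Y \<kappa> (gluing_rel C \<kappa> \<Phi> D) W w"
    if p: "p \<in> topspace Y" for p
  proof (cases "\<exists>\<delta> \<in> fiber_ends C \<kappa> \<Phi>. \<exists>x \<in> \<delta>. p = \<kappa> x")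
    case True
    then show ?thesis
      using gluing_weights_at_end by blast
  next
    case False
    then have "p \<in> topspace Y - \<kappa> ` (part \<inter> \<Union>(fiber_ends C \<kappa> \<Phi>))"
      using p by blast
    then show ?thesis
      using gluing_weights_away_from_ends
      by (intro exI[of _ "topspace Y - \<kappa> ` (part \<inter> \<Union>(fiber_ends C \<kappa> \<Phi>))"] exI[of _ "\<lambda>_. 1"] conjI)
  qed
  have \<kappa>: "\<kappa> x = \<kappa> y" if "((x, a), (y, b)) \<in> gluing_rel C \<kappa> \<Phi> D" for x a y b
    using that by (auto simp: gluing_rel_iff)
  have scale: "((x, c * a), (y, c * b)) \<in> gluing_rel C \<kappa> \<Phi> D" if "((x, a), (y, b)) \<in> gluing_rel C \<kappa> \<Phi> D" for x a y b c
    using that by (auto simp: gluing_rel_iff)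
  note g = rat_bundle_gluing[OF quotient_map_part equiv_gluing_rel \<kappa> scale w, folded H_plus_def]
  show "rat_bundle {q. q \<noteq> 0} Y (H_plus C \<kappa> \<Phi> D)"
    "continuous_map (prod_topology (subtopology C part) (discrete_topology {q. q \<noteq> 0}))
      (total (H_plus C \<kappa> \<Phi> D)) (\<lambda>z. gluing_rel C \<kappa> \<Phi> D `` {z})"
    "proj (H_plus C \<kappa> \<Phi> D) (gluing_rel C \<kappa> \<Phi> D `` {(x, a)}) = \<kappa> x"
    "c \<noteq> 0 \<Longrightarrow> act (H_plus C \<kappa> \<Phi> D) c (gluing_rel C \<kappa> \<Phi> D `` {(x, a)}) =
      gluing_rel C \<kappa> \<Phi> D `` {(x, c * a)}"
    using g by simp_all
qed

end

end

section \<open>Local homology and local orientations\<close>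

text \<open>The complement of N is excised, with \<open>topspace X - V\<close> as the subspace; the
  hypothesis is the closure condition of the excision axiom.\<close>

lemma excision_complements:
  assumes "N \<subseteq> topspace X" "X closure_of (topspace X - N) \<subseteq> X interior_of (topspace X - V)"
  shows "hom_induced p (subtopology X N) (N - V) X (topspace X - V) id \<in>
    iso (relative_homology_group p (subtopology X N) (N - V)) (relative_homology_group p X (topspace X - V))"
proof -
  have "topspace X - (topspace X - N) = N" "topspace X - V - (topspace X - N) = N - V"
    using assms(1) by blast+
  then show ?thesis
    using homology_excision_axiom[OF assms(2), of "topspace X" p] by simp
qed

lemma excision_open_point:
  assumes X: "Hausdorff_space X" and N: "openin X N" "x \<in> N"
  shows "hom_induced p (subtopology X N) (N - {x}) X (topspace X - {x}) id \<in>
    iso (relative_homology_group p (subtopology X N) (N - {x})) (relative_homology_group p X (topspace X - {x}))"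
proof (rule excision_complements)
  show NX: "N \<subseteq> topspace X"
    using N(1) by (rule openin_subset)
  have "closedin X {x}"
    using X N(2) NX by (simp add: closedin_Hausdorff_sing_eq subset_iff)
  then have "X interior_of (topspace X - {x}) = topspace X - {x}"
    by (simp add: interior_of_openin openin_diff)
  moreover have "closedin X (topspace X - N)"
    using N(1) by (simp add: closedin_diff)
  then have "X closure_of (topspace X - N) = topspace X - N"
    by (simp add: closure_of_closedin)
  ultimately show "X closure_of (topspace X - N) \<subseteq> X interior_of (topspace X - {x})"
    using N(2) by auto
qed

text \<open>The relative groups depend only on the homeomorphism type of the closed set that is
  removed, so w may be moved to the origin. Raising the dimension from 0 to n shifts the degree by
  n, and in dimension 0 the complement of the origin is empty, which leaves the zeroth homology of a
  point.\<close>

lemma local_homology_Euclidean: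
  assumes "w \<in> topspace (Euclidean_space n)"
  shows "relative_homology_group (int n) (Euclidean_space n) (topspace (Euclidean_space n) - {w}) \<cong> integer_group"
proof -
  let ?z = "(\<lambda>_. 0) :: nat \<Rightarrow> real"
  have z: "?z \<in> topspace (Euclidean_space k)" for k
    by (simp add: topspace_Euclidean_space)
  have cl: "closedin (Euclidean_space k) {v}" if "v \<in> topspace (Euclidean_space k)" for k v
    using that Hausdorff_Euclidean_space by (simp add: closedin_Hausdorff_sing_eq)
  have "subtopology (Euclidean_space n) {w} homeomorphic_space subtopology (Euclidean_space n) {?z}"
    unfolding homeomorphic_space_def homeomorphic_maps_def using assms z[of n]
    by (intro exI[of _ "\<lambda>_. ?z"] exI[of _ "\<lambda>_. w"]) (auto simp: continuous_map_in_subtopology)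
  then have 1: "relative_homology_group (int n) (Euclidean_space n) (topspace (Euclidean_space n) - {w}) \<cong>
      relative_homology_group (int n) (Euclidean_space n) (topspace (Euclidean_space n) - {?z})"
    by (rule isomorphic_relative_homology_groups_Euclidean_complements[OF cl[OF assms] cl[OF z]])
  have top0: "topspace (Euclidean_space 0) = {?z}"
    by (auto simp: topspace_Euclidean_space)
  have "relative_homology_group 0 (Euclidean_space 0) (topspace (Euclidean_space 0) - {?z}) \<cong>
      relative_homology_group (0 + int n) (Euclidean_space (0 + n)) (topspace (Euclidean_space (0 + n)) - {?z})"
    by (rule relative_homology_group_Euclidean_complement_step[OF cl[OF z]])
  then have 2: "homology_group 0 (Euclidean_space 0) \<cong>
      relative_homology_group (int n) (Euclidean_space n) (topspace (Euclidean_space n) - {?z})"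
    by (simp add: top0)
  have 3: "homology_group 0 (Euclidean_space 0) \<cong> integer_group"
    by (rule homology_coefficients[OF top0])
  show ?thesis
    using 1 2 3 group.iso_sym[OF group_relative_homology_group 2] iso_trans by metis
qed

text \<open>Excision in X, a chart, and excision in Euclidean space carry the group to the model
  case.\<close>

lemma local_homology_integers:
  assumes X: "Hausdorff_space X" and x: "x \<in> manifold_interior n X"
  shows "local_homology n X {x} \<cong> integer_group"
proof -
  obtain U W h where U: "openin X U" "x \<in> U" "openin (Euclidean_space n) W"
    and h: "homeomorphic_map (subtopology X U) (subtopology (Euclidean_space n) W) h"
    using x unfolding manifold_interior_def locally_Euclidean_at_def homeomorphic_space by blast
  have tU: "topspace (subtopology X U) = U" and tW: "topspace (subtopology (Euclidean_space n) W) = W"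
    using openin_subset[OF U(1)] openin_subset[OF U(3)] by auto
  have hU: "h ` U = W" "inj_on h U"
    using homeomorphic_imp_surjective_map[OF h] homeomorphic_imp_injective_map[OF h] by (simp_all only: tU tW)
  have hx: "h x \<in> W"
    using hU U(2) by blast
  have "h ` (U - {x}) = W - {h x}"
    using hU U(2) by (simp add: inj_on_image_set_diff)
  then have 1: "relative_homology_group (int n) (subtopology X U) (U - {x}) \<cong>
      relative_homology_group (int n) (subtopology (Euclidean_space n) W) (W - {h x})"
    by (intro is_isoI[OF homeomorphic_map_relative_homology_iso[OF h]]) (auto simp only: tU)
  have 2: "relative_homology_group (int n) (subtopology X U) (U - {x}) \<cong> local_homology n X {x}"
    unfolding local_homology_def by (rule is_isoI[OF excision_open_point[OF X U(1,2)]])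
  have 3: "relative_homology_group (int n) (subtopology (Euclidean_space n) W) (W - {h x}) \<cong>
      relative_homology_group (int n) (Euclidean_space n) (topspace (Euclidean_space n) - {h x})"
    by (rule is_isoI[OF excision_open_point[OF Hausdorff_Euclidean_space U(3) hx]])
  have 4: "relative_homology_group (int n) (Euclidean_space n) (topspace (Euclidean_space n) - {h x}) \<cong> integer_group"
    using hx openin_subset[OF U(3)] by (intro local_homology_Euclidean) auto
  have "local_homology n X {x} \<cong> relative_homology_group (int n) (subtopology X U) (U - {x})"
    using 2 group.iso_sym[OF group_relative_homology_group] by blast
  then show ?thesis
    using 1 3 4 iso_trans by metis
qed

text \<open>Under an isomorphism with the integers a generator must divide 1, so it goes to 1 or -1;
  these are distinct and negatives of each other.\<close>

lemma infinite_cyclic_generators: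
  assumes G: "group G" "G \<cong> integer_group"
    and a: "a \<in> carrier G" "generate G {a} = carrier G"
  shows "a \<noteq> inv\<^bsub>G\<^esub> a"
    and "b \<in> carrier G \<Longrightarrow> generate G {b} = carrier G \<Longrightarrow> b = a \<or> b = inv\<^bsub>G\<^esub> a"
proof -
  interpret group G by fact
  obtain f where f: "f \<in> iso G integer_group"
    using G(2) by (auto simp: is_iso_def)
  then interpret f: group_hom G integer_group f
    by (simp add: group_hom_def group_hom_axioms_def iso_def G(1))
  have inj: "inj_on f (carrier G)" and surj: "f ` carrier G = UNIV"
    using f by (auto simp: iso_def bij_betw_def)
  have unit: "f c = 1 \<or> f c = - 1" if c: "c \<in> carrier G" "generate G {c} = carrier G" for c
  proof -
    obtain d where d: "d \<in> carrier G" "f d = 1"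
      using surj by (metis UNIV_I imageE)
    then obtain k :: int where "d = c [^]\<^bsub>G\<^esub> k"
      using generate_pow[OF c(1)] c(2) by auto
    then have "1 = k * f c"
      using d(2) f.hom_int_pow[OF c(1), of k] by simp
    then show ?thesis
      by (metis zmult_eq_1_iff)
  qed
  have inv: "f (inv\<^bsub>G\<^esub> c) = - f c" if "c \<in> carrier G" for c
    using f.hom_inv[OF that] by simp
  show "a \<noteq> inv\<^bsub>G\<^esub> a"
    using unit[OF a] inv[OF a(1)] by auto
  show "b = a \<or> b = inv\<^bsub>G\<^esub> a" if b: "b \<in> carrier G" "generate G {b} = carrier G"
  proof -
    have "f b = f a \<or> f b = f (inv\<^bsub>G\<^esub> a)"
      using unit[OF a] unit[OF b] inv[OF a(1)] by auto
    then show ?thesis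
      using inj a(1) b(1) inv_closed by (metis inj_onD)
  qed
qed

text \<open>The support of a chain is compact, so a chain that bounds relative to the complement of a point
  also bounds relative to the complement of a neighborhood of that point.\<close>

lemma relboundary_near_point:
  assumes X: "Hausdorff_space X" and x: "x \<in> topspace X"
    and z: "singular_relboundary n X (topspace X - {x}) z"
  obtains V where "openin X V" "x \<in> V" "\<And>y. y \<in> V \<Longrightarrow> singular_relboundary n X (topspace X - {y}) z"
proof -
  obtain d e where d: "singular_chain (Suc n) X d" and e: "singular_chain n (subtopology X (topspace X - {x})) e"
    and de: "chain_boundary (Suc n) d + e = z"
    using z unfolding singular_relboundary by blast
  define K where "K = (\<Union>f \<in> Poly_Mapping.keys e. f ` standard_simplex n)"
  have e': "singular_chain n X e" and off: "\<And>f. f \<in> Poly_Mapping.keys e \<Longrightarrow> f ` standard_simplex n \<subseteq> topspace X - {x}"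
    using e by (auto simp: singular_chain_subtopology)
  have "compactin X (f ` standard_simplex n)" if f: "f \<in> Poly_Mapping.keys e" for f
  proof -
    have "continuous_map (subtopology (powertop_real UNIV) (standard_simplex n)) X f"
      using e' f by (auto simp: singular_chain_def singular_simplex_def)
    moreover have "compactin (subtopology (powertop_real UNIV) (standard_simplex n)) (standard_simplex n)"
      using compactin_standard_simplex by (simp add: compactin_subtopology)
    ultimately show ?thesis
      using image_compactin by blast
  qed
  then have "closedin X K"
    unfolding K_def using compactin_imp_closedin[OF X] by (intro closedin_Union) auto
  then have "openin X (topspace X - K)"
    by (simp add: openin_diff)
  moreover have "x \<in> topspace X - K"
    using x off by (auto simp: K_def)
  moreover have "singular_relboundary n X (topspace X - {y}) z" if "y \<in> topspace X - K" for y
  proof -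
    have "singular_chain n (subtopology X (topspace X - {y})) e"
      using e' off that by (fastforce simp: singular_chain_subtopology K_def)
    then show ?thesis
      using d de unfolding singular_relboundary by blast
  qed
  ultimately show ?thesis
    using that by blast
qed

text \<open>Homology classes are sets of chains, so the negative of a class is the set of the
  negatives of its chains.\<close>

abbreviation opposite :: "('a \<Rightarrow> 'a chain set) \<Rightarrow> 'a \<Rightarrow> 'a chain set" where
  "opposite \<omega> \<equiv> \<lambda>y. uminus ` \<omega> y"

lemma uminus_homologous_rel_set:
  "uminus ` homologous_rel_set n X A z = homologous_rel_set n X A (- z)"
proof -
  have *: "homologous_rel n X A (- z) (- c)" if "homologous_rel n X A z c" for z c
    using singular_relboundary_minus[of n X A "z - c"] that by (simp add: homologous_rel_def)
  show ?thesis
  proof (intro equalityI subsetI)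
    fix c assume "c \<in> homologous_rel_set n X A (- z)"
    then have "- c \<in> homologous_rel_set n X A z"
      using *[of "- z" c] by simp
    then have "- (- c) \<in> uminus ` homologous_rel_set n X A z"
      by (rule imageI)
    then show "c \<in> uminus ` homologous_rel_set n X A z"
      by simp
  qed (use * in auto)
qed

lemma orientation_on_generator:
  assumes "orientation_on n X U \<omega>" "x \<in> U" "x \<in> manifold_interior n X"
  shows "\<omega> x \<in> carrier (local_homology n X {x})"
    and "generate (local_homology n X {x}) {\<omega> x} = carrier (local_homology n X {x})"
proof -
  note * = bspec[OF assms(1)[unfolded orientation_on_def] IntI[OF assms(2,3)]]
  show "\<omega> x \<in> carrier (local_homology n X {x})"
    "generate (local_homology n X {x}) {\<omega> x} = carrier (local_homology n X {x})"
    by (rule conjunct1[OF *], rule conjunct1[OF conjunct2[OF *]])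
qed

text \<open>The passage to the chain level: one relative cycle represents the orientation at all
  nearby points, so comparing two orientations becomes a question about a single difference of
  chains.\<close>

lemma orientation_on_chain:
  assumes "orientation_on n X U \<omega>" "x \<in> U" "x \<in> manifold_interior n X"
  obtains V z where "openin X V" "x \<in> V" "V \<subseteq> U \<inter> manifold_interior n X"
    "singular_relcycle n X (topspace X - V) z"
    "\<And>y. y \<in> V \<Longrightarrow> \<omega> y = homologous_rel_set n X (topspace X - {y}) z"
proof -
  obtain V \<mu> where V: "openin X V" "x \<in> V" "V \<subseteq> U \<inter> manifold_interior n X"
    and \<mu>: "\<mu> \<in> carrier (local_homology n X V)"
    and \<omega>: "\<forall>y \<in> V. hom_induced (int n) X (topspace X - V) X (topspace X - {y}) id \<mu> = \<omega> y"
    using conjunct2[OF conjunct2[OF bspec[OF assms(1)[unfolded orientation_on_def] IntI[OF assms(2,3)]]]]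
    by (elim exE conjE) (rule that)
  obtain z where z: "singular_relcycle n X (topspace X - V) z" "\<mu> = homologous_rel_set n X (topspace X - V) z"
    using \<mu> unfolding local_homology_def carrier_relative_homology_group by blast
  have "\<omega> y = homologous_rel_set n X (topspace X - {y}) z" if "y \<in> V" for y
  proof -
    have "hom_induced (int n) X (topspace X - V) X (topspace X - {y}) id \<mu> =
        homologous_rel_set n X (topspace X - {y}) (chain_map n id z)"
      unfolding z(2) using z(1) that by (intro hom_induced_chain_map) auto
    moreover have "chain_map n id z = z"
      using z(1) by (auto intro: chain_map_ident simp: singular_relcycle)
    ultimately show ?thesis
      using \<omega> that by metis
  qed
  then show ?thesis
    using that V z(1) by blast
qed

text \<open>Equality at x says that the difference of two representing cycles bounds relative to the
  complement of x; compactness of supports spreads this to nearby points. In the opposite case the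
  second cycle is negated.\<close>

lemma orientations_agree_near:
  assumes X: "Hausdorff_space X"
    and \<omega>: "orientation_on n X U \<omega>" "x \<in> U" and \<omega>': "orientation_on n X U' \<omega>'" "x \<in> U'"
    and x: "x \<in> manifold_interior n X"
  shows "\<omega> x = \<omega>' x \<Longrightarrow> \<exists>V. openin X V \<and> x \<in> V \<and> (\<forall>y \<in> V. \<omega> y = \<omega>' y)"
    and "\<omega> x = uminus ` \<omega>' x \<Longrightarrow> \<exists>V. openin X V \<and> x \<in> V \<and> (\<forall>y \<in> V. \<omega> y = uminus ` \<omega>' y)"
proof -
  have xX: "x \<in> topspace X"
    using x by (simp add: manifold_interior_def)
  obtain V z where V: "openin X V" "x \<in> V"
    and z: "\<And>y. y \<in> V \<Longrightarrow> \<omega> y = homologous_rel_set n X (topspace X - {y}) z"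
    by (rule orientation_on_chain[OF \<omega> x]) blast
  obtain V' z' where V': "openin X V'" "x \<in> V'"
    and z': "\<And>y. y \<in> V' \<Longrightarrow> \<omega>' y = homologous_rel_set n X (topspace X - {y}) z'"
    by (rule orientation_on_chain[OF \<omega>' x]) blast
  have gen: "\<exists>W. openin X W \<and> x \<in> W \<and> (\<forall>y \<in> W. \<omega> y = homologous_rel_set n X (topspace X - {y}) c)"
    if c: "\<omega> x = homologous_rel_set n X (topspace X - {x}) c" for c
  proof -
    have "singular_relboundary n X (topspace X - {x}) (z - c)"
      using c z[OF V(2)] by (metis homologous_rel_def homologous_rel_set_eq)
    then obtain N where N: "openin X N" "x \<in> N"
      "\<And>y. y \<in> N \<Longrightarrow> singular_relboundary n X (topspace X - {y}) (z - c)"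
      using relboundary_near_point[OF X xX] by blast
    have "\<omega> y = homologous_rel_set n X (topspace X - {y}) c" if "y \<in> N \<inter> V" for y
    proof -
      have "homologous_rel n X (topspace X - {y}) z c"
        using N(3)[of y] that by (simp add: homologous_rel_def)
      then have "homologous_rel_set n X (topspace X - {y}) z = homologous_rel_set n X (topspace X - {y}) c"
        by (simp only: homologous_rel_set_eq)
      then show ?thesis
        using z[of y] that by simp
    qed
    then show ?thesis
      using N(1,2) V by (intro exI[of _ "N \<inter> V"]) auto
  qed
  show "\<exists>V. openin X V \<and> x \<in> V \<and> (\<forall>y \<in> V. \<omega> y = \<omega>' y)" if "\<omega> x = \<omega>' x"
  proof -
    have "\<omega> x = homologous_rel_set n X (topspace X - {x}) z'"
      using that z'[OF V'(2)] by simp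
    from gen[OF this] obtain W where "openin X W" "x \<in> W"
      "\<forall>y \<in> W. \<omega> y = homologous_rel_set n X (topspace X - {y}) z'"
      by blast
    then show ?thesis
      using V' z' by (intro exI[of _ "W \<inter> V'"]) auto
  qed
  show "\<exists>V. openin X V \<and> x \<in> V \<and> (\<forall>y \<in> V. \<omega> y = uminus ` \<omega>' y)" if "\<omega> x = uminus ` \<omega>' x"
  proof -
    have "\<omega> x = homologous_rel_set n X (topspace X - {x}) (- z')"
      using that z'[OF V'(2)] by (simp add: uminus_homologous_rel_set)
    from gen[OF this] obtain W where "openin X W" "x \<in> W"
      "\<forall>y \<in> W. \<omega> y = homologous_rel_set n X (topspace X - {y}) (- z')"
      by blast
    then show ?thesis
      using V' z' by (intro exI[of _ "W \<inter> V'"]) (auto simp: uminus_homologous_rel_set)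
  qed
qed

text \<open>The local homology at an interior point is infinite cyclic, and such a group has two
  distinct generators, inverse to each other.\<close>

lemma orientations_dichotomy:
  assumes X: "Hausdorff_space X"
    and \<omega>: "orientation_on n X U \<omega>" "x \<in> U" and \<omega>': "orientation_on n X U' \<omega>'" "x \<in> U'"
    and x: "x \<in> manifold_interior n X"
  shows "\<omega> x = \<omega>' x \<or> \<omega> x = uminus ` \<omega>' x" and "\<omega>' x \<noteq> uminus ` \<omega>' x"
proof -
  let ?G = "local_homology n X {x}"
  have G: "group ?G" "?G \<cong> integer_group"
    using local_homology_integers[OF X x] by (simp_all add: local_homology_def)
  have a: "\<omega>' x \<in> carrier ?G" "generate ?G {\<omega>' x} = carrier ?G"
    and b: "\<omega> x \<in> carrier ?G" "generate ?G {\<omega> x} = carrier ?G"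
    by (rule orientation_on_generator[OF \<omega>' x] orientation_on_generator[OF \<omega> x])+
  have "inv\<^bsub>?G\<^esub> (\<omega>' x) = uminus ` \<omega>' x"
    using a(1) unfolding local_homology_def by (rule inv_relative_homology_group)
  then show "\<omega> x = \<omega>' x \<or> \<omega> x = uminus ` \<omega>' x" "\<omega>' x \<noteq> uminus ` \<omega>' x"
    using infinite_cyclic_generators[OF G a] b by auto
qed

text \<open>The small neighborhoods of a point on which the interior is connected carry, up to sign, only one
  orientation.\<close>

locale oriented_paths =
  fixes n :: nat and X :: "'x topology"
  assumes Hausdorff: "Hausdorff_space X"
    and small: "openin X N \<Longrightarrow> x \<in> N \<Longrightarrow> \<exists>B. openin X B \<and> x \<in> B \<and> B \<subseteq> N \<and>
      connectedin X (B \<inter> manifold_interior n X) \<and> B \<inter> manifold_interior n X \<noteq> {}"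
begin

text \<open>On the connected interior part of a small neighborhood the places of agreement and of
  opposition are open, disjoint and exhaustive, so one of them is empty.\<close>

lemma agree_near_cases:
  assumes \<omega>: "openin X U" "orientation_on n X U \<omega>" "x \<in> U"
    and \<omega>': "openin X U'" "orientation_on n X U' \<omega>'" "x \<in> U'"
  shows "agree_near n X x \<omega> \<omega>' \<or> agree_near n X x \<omega> (opposite \<omega>')"
proof -
  have "openin X (U \<inter> U')" "x \<in> U \<inter> U'"
    using \<omega> \<omega>' by auto
  then obtain B where B: "openin X B" "x \<in> B" "B \<subseteq> U \<inter> U'" "connectedin X (B \<inter> manifold_interior n X)"
    using small by meson
  let ?I = "B \<inter> manifold_interior n X"
  define P where "P = {y \<in> ?I. \<omega> y = \<omega>' y}"
  define Q where "Q = {y \<in> ?I. \<omega> y = uminus ` \<omega>' y}"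
  have I: "openin X ?I"
    using B(1) openin_manifold_interior by blast
  have d: "\<omega> y = \<omega>' y \<or> \<omega> y = uminus ` \<omega>' y" "\<omega>' y \<noteq> uminus ` \<omega>' y" if "y \<in> ?I" for y
    using orientations_dichotomy[OF Hausdorff \<omega>(2) _ \<omega>'(2), of y] that B(3) by blast+
  have P: "openin X P"
  proof (subst openin_subopen, clarify)
    fix y assume y: "y \<in> P"
    then have y': "y \<in> U" "y \<in> U'" "y \<in> manifold_interior n X" "\<omega> y = \<omega>' y"
      using B(3) by (auto simp: P_def)
    from orientations_agree_near(1)[OF Hausdorff \<omega>(2) y'(1) \<omega>'(2) y'(2-4)]
    obtain V where "openin X V" "y \<in> V" "\<forall>y \<in> V. \<omega> y = \<omega>' y"
      by (elim exE conjE) (rule that)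
    then show "\<exists>T. openin X T \<and> y \<in> T \<and> T \<subseteq> P"
      using I y by (intro exI[of _ "V \<inter> ?I"]) (auto simp: P_def)
  qed
  have Q: "openin X Q"
  proof (subst openin_subopen, clarify)
    fix y assume y: "y \<in> Q"
    then have y': "y \<in> U" "y \<in> U'" "y \<in> manifold_interior n X" "\<omega> y = uminus ` \<omega>' y"
      using B(3) by (auto simp: Q_def)
    from orientations_agree_near(2)[OF Hausdorff \<omega>(2) y'(1) \<omega>'(2) y'(2-4)]
    obtain V where "openin X V" "y \<in> V" "\<forall>y \<in> V. \<omega> y = uminus ` \<omega>' y"
      by (elim exE conjE) (rule that)
    then show "\<exists>T. openin X T \<and> y \<in> T \<and> T \<subseteq> Q"
      using I y by (intro exI[of _ "V \<inter> ?I"]) (auto simp: Q_def)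
  qed
  have "?I \<subseteq> P \<union> Q" "P \<inter> Q \<inter> ?I = {}"
    using d(1) d(2)[symmetric] by (auto simp: P_def Q_def)
  then have "P \<inter> ?I = {} \<or> Q \<inter> ?I = {}"
    using B(4) P Q unfolding connectedin by blast
  then have "?I \<subseteq> Q \<or> ?I \<subseteq> P"
    using \<open>?I \<subseteq> P \<union> Q\<close> by blast
  then show ?thesis
    using B(1,2) unfolding agree_near_def P_def Q_def by blast
qed

text \<open>Every neighborhood contains interior points, so both relations would hold at some such
  point and make a local generator its own inverse.\<close>

lemma not_agree_near_both:
  assumes \<omega>': "openin X U'" "orientation_on n X U' \<omega>'" "x \<in> U'"
  shows "\<not> (agree_near n X x \<omega> \<omega>' \<and> agree_near n X x \<omega> (opposite \<omega>'))"
proof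
  assume "agree_near n X x \<omega> \<omega>' \<and> agree_near n X x \<omega> (opposite \<omega>')"
  then obtain V W where V: "openin X V" "x \<in> V" "\<forall>y \<in> V \<inter> manifold_interior n X. \<omega> y = \<omega>' y"
    and W: "openin X W" "x \<in> W" "\<forall>y \<in> W \<inter> manifold_interior n X. \<omega> y = uminus ` \<omega>' y"
    unfolding agree_near_def by blast
  have "openin X (V \<inter> W \<inter> U')" "x \<in> V \<inter> W \<inter> U'"
    using V W \<omega>' by auto
  then obtain B where "B \<subseteq> V \<inter> W \<inter> U'" "B \<inter> manifold_interior n X \<noteq> {}"
    using small by meson
  then obtain y where y: "y \<in> V" "y \<in> W" "y \<in> U'" "y \<in> manifold_interior n X"
    by blast
  then have "\<omega>' y = uminus ` \<omega>' y"
    using V(3) W(3) by (metis IntI)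
  then show False
    using orientations_dichotomy(2)[OF Hausdorff \<omega>'(2) y(3) \<omega>'(2) y(3,4)] by blast
qed

lemma agree_near_trans:
  assumes "agree_near n X x \<omega> \<omega>'" "agree_near n X x \<omega>' \<omega>''"
  shows "agree_near n X x \<omega> \<omega>''"
proof -
  obtain V W where "openin X V" "x \<in> V" "\<forall>y \<in> V \<inter> manifold_interior n X. \<omega> y = \<omega>' y"
    "openin X W" "x \<in> W" "\<forall>y \<in> W \<inter> manifold_interior n X. \<omega>' y = \<omega>'' y"
    using assms unfolding agree_near_def by blast
  then show ?thesis
    unfolding agree_near_def by (intro exI[of _ "V \<inter> W"]) auto
qed

lemma agree_near_sym: "agree_near n X x \<omega> \<omega>' \<Longrightarrow> agree_near n X x \<omega>' \<omega>"
  unfolding agree_near_def by metis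

lemma agree_near_opposite: "agree_near n X x \<omega> \<omega>' \<Longrightarrow> agree_near n X x (opposite \<omega>) (opposite \<omega>')"
  unfolding agree_near_def by metis

section \<open>Orientations along paths\<close>

lemma orientation_along_at:
  assumes "orientation_along n X \<alpha> \<omega>" "t \<in> {0..1}"
  obtains U where "openin X U" "orientation_on n X U (\<omega> t)" "\<alpha> t \<in> U"
proof -
  obtain \<epsilon> U where "\<epsilon> > 0" "openin X U" "orientation_on n X U (\<omega> t)"
    "\<forall>r \<in> {0..1}. \<bar>r - t\<bar> < \<epsilon> \<longrightarrow> \<alpha> r \<in> U \<and> agree_near n X (\<alpha> r) (\<omega> r) (\<omega> t)"
    using assms unfolding orientation_along_def by blast
  then show ?thesis
    using that[of U] assms(2) by auto
qed

text \<open>The parameter f stands for the identity or for \<open>opposite\<close>, so that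
  agreement and opposition are propagated by one argument: near t, both families agree with their
  members at t.\<close>

lemma agree_near_propagates:
  assumes \<alpha>: "pathin X \<alpha>"
    and \<omega>: "orientation_along n X \<alpha> \<omega>" and \<omega>': "orientation_along n X \<alpha> \<omega>'"
    and t: "t \<in> {0..1}" and f: "\<And>\<eta> \<eta>' x. agree_near n X x \<eta> \<eta>' \<Longrightarrow> agree_near n X x (f \<eta>) (f \<eta>')"
    and ag: "agree_near n X (\<alpha> t) (\<omega> t) (f (\<omega>' t))"
  obtains \<epsilon> where "\<epsilon> > 0" "\<And>r. r \<in> {0..1} \<Longrightarrow> \<bar>r - t\<bar> < \<epsilon> \<Longrightarrow> agree_near n X (\<alpha> r) (\<omega> r) (f (\<omega>' r))"
proof -
  obtain \<epsilon>1 U1 where 1: "\<epsilon>1 > 0"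
    "\<forall>r \<in> {0..1}. \<bar>r - t\<bar> < \<epsilon>1 \<longrightarrow> \<alpha> r \<in> U1 \<and> agree_near n X (\<alpha> r) (\<omega> r) (\<omega> t)"
    using \<omega> t unfolding orientation_along_def by blast
  obtain \<epsilon>2 U2 where 2: "\<epsilon>2 > 0"
    "\<forall>r \<in> {0..1}. \<bar>r - t\<bar> < \<epsilon>2 \<longrightarrow> \<alpha> r \<in> U2 \<and> agree_near n X (\<alpha> r) (\<omega>' r) (\<omega>' t)"
    using \<omega>' t unfolding orientation_along_def by blast
  obtain W where W: "openin X W" "\<alpha> t \<in> W" "\<forall>y \<in> W \<inter> manifold_interior n X. \<omega> t y = f (\<omega>' t) y"
    using ag unfolding agree_near_def by blast
  have "openin (top_of_set {0..1}) {r \<in> topspace (top_of_set {0..1}). \<alpha> r \<in> W}"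
    using \<alpha> W(1) unfolding pathin_def by (rule openin_continuous_map_preimage)
  then obtain \<epsilon>3 where 3: "\<epsilon>3 > 0" "\<And>r. r \<in> {0..1} \<Longrightarrow> dist r t < \<epsilon>3 \<Longrightarrow> \<alpha> r \<in> W"
    unfolding openin_euclidean_subtopology_iff using t W(2) by (auto; metis)
  show ?thesis
  proof (rule that[of "min \<epsilon>1 (min \<epsilon>2 \<epsilon>3)"])
    show "min \<epsilon>1 (min \<epsilon>2 \<epsilon>3) > 0"
      using 1 2 3 by simp
    fix r assume r: "r \<in> {0..1}" "\<bar>r - t\<bar> < min \<epsilon>1 (min \<epsilon>2 \<epsilon>3)"
    have "agree_near n X (\<alpha> r) (\<omega> r) (\<omega> t)" "agree_near n X (\<alpha> r) (\<omega>' t) (\<omega>' r)"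
      using 1(2) 2(2) r agree_near_sym by auto
    moreover have "agree_near n X (\<alpha> r) (\<omega> t) (f (\<omega>' t))"
      using W 3(2)[of r] r unfolding agree_near_def by (auto simp: dist_real_def)
    ultimately show "agree_near n X (\<alpha> r) (\<omega> r) (f (\<omega>' r))"
      using f agree_near_trans by blast
  qed
qed

text \<open>Agreement and opposition are open conditions on the parameter that exclude each other
  and exhaust [0, 1], so connectedness of the interval decides for the whole path.\<close>

lemma orientation_along_unique:
  assumes \<alpha>: "pathin X \<alpha>"
    and \<omega>: "orientation_along n X \<alpha> \<omega>" and \<omega>': "orientation_along n X \<alpha> \<omega>'"
  shows "(\<forall>t \<in> {0..1}. agree_near n X (\<alpha> t) (\<omega> t) (\<omega>' t)) \<or>
    (\<forall>t \<in> {0..1}. agree_near n X (\<alpha> t) (\<omega> t) (opposite (\<omega>' t)))"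
proof -
  define P where "P = {t \<in> {0..1}. agree_near n X (\<alpha> t) (\<omega> t) (\<omega>' t)}"
  define Q where "Q = {t \<in> {0..1}. agree_near n X (\<alpha> t) (\<omega> t) (opposite (\<omega>' t))}"
  have PQ: "P \<union> Q = {0..1}"
  proof -
    have "agree_near n X (\<alpha> t) (\<omega> t) (\<omega>' t) \<or> agree_near n X (\<alpha> t) (\<omega> t) (opposite (\<omega>' t))"
      if "t \<in> {0..1}" for t
      using orientation_along_at[OF \<omega> that] orientation_along_at[OF \<omega>' that] agree_near_cases by metis
    then show ?thesis
      unfolding P_def Q_def by blast
  qed
  have disj: "P \<inter> Q = {}"
  proof -
    have "\<not> (agree_near n X (\<alpha> t) (\<omega> t) (\<omega>' t) \<and> agree_near n X (\<alpha> t) (\<omega> t) (opposite (\<omega>' t)))"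
      if "t \<in> {0..1}" for t
      by (rule orientation_along_at[OF \<omega>' that]) (rule not_agree_near_both)
    then show ?thesis
      unfolding P_def Q_def by blast
  qed
  have "openin (top_of_set {0..1}) P"
    unfolding openin_euclidean_subtopology_iff
  proof (intro conjI ballI)
    fix t assume "t \<in> P"
    then have t: "t \<in> {0..1}" "agree_near n X (\<alpha> t) (\<omega> t) (\<omega>' t)"
      by (auto simp: P_def)
    obtain \<epsilon> where "\<epsilon> > 0" "\<And>r. r \<in> {0..1} \<Longrightarrow> \<bar>r - t\<bar> < \<epsilon> \<Longrightarrow> agree_near n X (\<alpha> r) (\<omega> r) (\<omega>' r)"
      by (rule agree_near_propagates[OF \<alpha> \<omega> \<omega>' t(1), of "\<lambda>\<eta>. \<eta>"]) (use t(2) in auto)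
    then show "\<exists>e>0. \<forall>r \<in> {0..1}. dist r t < e \<longrightarrow> r \<in> P"
      by (intro exI[of _ \<epsilon>]) (auto simp: P_def dist_real_def)
  qed (auto simp: P_def)
  moreover have "openin (top_of_set {0..1}) Q"
    unfolding openin_euclidean_subtopology_iff
  proof (intro conjI ballI)
    fix t assume "t \<in> Q"
    then have t: "t \<in> {0..1}" "agree_near n X (\<alpha> t) (\<omega> t) (opposite (\<omega>' t))"
      by (auto simp: Q_def)
    obtain \<epsilon> where "\<epsilon> > 0" "\<And>r. r \<in> {0..1} \<Longrightarrow> \<bar>r - t\<bar> < \<epsilon> \<Longrightarrow> agree_near n X (\<alpha> r) (\<omega> r) (opposite (\<omega>' r))"
      by (rule agree_near_propagates[OF \<alpha> \<omega> \<omega>' t(1), of opposite]) (use t(2) agree_near_opposite in auto)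
    then show "\<exists>e>0. \<forall>r \<in> {0..1}. dist r t < e \<longrightarrow> r \<in> Q"
      by (intro exI[of _ \<epsilon>]) (auto simp: Q_def dist_real_def)
  qed (auto simp: Q_def)
  ultimately have "P = {} \<or> Q = {}"
    using connected_Icc[of "0::real" 1] PQ disj unfolding connected_openin by blast
  then show ?thesis
  proof
    assume "P = {}"
    then have "Q = {0..1}"
      using PQ by simp
    then show ?thesis
      unfolding Q_def by blast
  next
    assume "Q = {}"
    then have "P = {0..1}"
      using PQ by simp
    then show ?thesis
      unfolding P_def by blast
  qed
qed

end

section \<open>The orientation character of a subsurface\<close>

context cut_subsurface begin

abbreviation interiorY where "interiorY \<equiv> X interior_of (\<kappa> ` part)"

section \<open>Interior points and one-sided ends of the subsurface\<close>

lemma manifold_interior_X: "manifold_interior 2 X = topspace X"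
  using Euclidean_X by (auto simp: manifold_interior_def)

text \<open>Regularity allows a neighborhood to be shrunk until its closure lies in the interior of
  the subsurface, as excision requires.\<close>

lemma regular_X: "regular_space X"
proof -
  have "compactin X (\<kappa> ` topspace C)"
    using image_compactin[OF _ \<kappa>_continuous] compact_C by (simp add: compact_space_def)
  then show ?thesis
    using compact_Hausdorff_imp_regular_space[OF _ Hausdorff_X] by (simp add: \<kappa>_surj compact_space_def)
qed

lemma interiorY_subset: "interiorY \<subseteq> \<kappa> ` part" "interiorY \<subseteq> topspace X"
  by (simp_all add: interior_of_subset interior_of_subset_topspace)

lemma openin_Y_if: "openin X U \<Longrightarrow> U \<subseteq> \<kappa> ` part \<Longrightarrow> openin Y U"
  unfolding Y_eq by (metis inf.absorb1 openin_subtopology_Int)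

lemma openin_X_if:
  assumes "openin Y U" "U \<subseteq> interiorY"
  shows "openin X U"
proof -
  obtain V where V: "openin X V" "U = V \<inter> \<kappa> ` part"
    using assms(1) unfolding Y_eq openin_subtopology by blast
  have U: "U = V \<inter> interiorY"
  proof (intro equalityI subsetI)
    fix y assume "y \<in> U"
    then show "y \<in> V \<inter> interiorY"
      using V(2) subsetD[OF assms(2)] by simp
  next
    fix y assume "y \<in> V \<inter> interiorY"
    then show "y \<in> U"
      using V(2) subsetD[OF interiorY_subset(1)] by simp
  qed
  show ?thesis
    unfolding U using V(1) by (intro openin_Int) simp_all
qed

text \<open>The images of the remaining pieces form a closed set; its complement is open in X and
  covered by \<open>part\<close>.\<close>

lemma preimages_in_part:
  assumes "y \<in> topspace X" "\<And>x. x \<in> topspace C \<Longrightarrow> \<kappa> x = y \<Longrightarrow> x \<in> part"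
  shows "y \<in> interiorY"
proof -
  have "closedin X (\<kappa> ` (topspace C - part))"
    using \<kappa>_closed part_open by (simp add: closed_map_def closedin_diff)
  then have "openin X (topspace X - \<kappa> ` (topspace C - part))"
    by (simp add: openin_diff)
  moreover have "topspace X - \<kappa> ` (topspace C - part) \<subseteq> \<kappa> ` part"
    unfolding \<kappa>_surj[symmetric] by auto
  ultimately have "topspace X - \<kappa> ` (topspace C - part) \<subseteq> interiorY"
    by (simp add: interior_of_maximal)
  then show ?thesis
    using assms by blast
qed

text \<open>For a point on a curve the opposite end decides: if it belongs to \<open>part\<close>
  too, the curve is interior to the subsurface, otherwise it is one of the boundary curves.\<close>

lemma part_point_cases:
  assumes "x \<in> part"
  obtains "\<kappa> x \<in> interiorY" | \<delta> where "\<delta> \<in> ends C" "x \<in> \<delta>" "\<delta> \<subseteq> part" "opp_end \<delta> \<inter> part = {}"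
proof (cases "\<kappa> x \<in> T")
  case False
  then have "x \<in> interiorC"
    using interior_iff assms part_subset by blast
  then have "\<kappa> x \<in> interiorY"
    using preimages_in_part[of "\<kappa> x"] interior_inj assms part_subset \<kappa>_in by (metis subsetD)
  then show ?thesis
    by (rule that(1))
next
  case True
  then obtain \<delta> where \<delta>: "\<delta> \<in> ends C" "x \<in> \<delta>"
    using boundary_in_end assms part_subset by blast
  then have \<delta>p: "\<delta> \<subseteq> part"
    using end_part_cases[OF \<delta>(1)] assms by blast
  show ?thesis
  proof (cases "opp_end \<delta> \<subseteq> part")
    case True
    have "z \<in> part" if "z \<in> topspace C" "\<kappa> z = \<kappa> x" for z
      using same_image_end[OF \<delta> that(1)] that(2) True assms by auto
    then have "\<kappa> x \<in> interiorY"
      using preimages_in_part[of "\<kappa> x"] \<kappa>_in assms part_subset by blast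
    then show ?thesis
      by (rule that(1))
  next
    case False
    then have "opp_end \<delta> \<inter> part = {}"
      using end_part_cases[OF opp_end(1)[OF \<delta>(1)]] by blast
    then show ?thesis
      using that(2) \<delta> \<delta>p by blast
  qed
qed

text \<open>Near an end whose opposite is missing nothing is glued. Within \<open>part\<close>, N is
  a saturated open set on which \<kappa> is injective, and an injective quotient map is a
  homeomorphism, so Y looks there like C, boundary included.\<close>

lemma one_sided_end:
  assumes \<delta>: "\<delta> \<in> ends C" "\<delta> \<subseteq> part" "opp_end \<delta> \<inter> part = {}"
  defines "N \<equiv> part - \<Union>(ends C - {\<delta>})"
  shows "openin C N" and "\<delta> \<subseteq> N"
    and "\<And>B. openin C B \<Longrightarrow> B \<subseteq> N \<Longrightarrow> openin Y (\<kappa> ` B)"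
    and "\<And>z. z \<in> N \<Longrightarrow> \<kappa> z \<in> manifold_interior 2 Y \<longleftrightarrow> z \<in> interiorC"
proof -
  have "closedin C (\<Union>(ends C - {\<delta>}))"
    using finite_ends ends_closed by (intro closedin_Union) auto
  then show N: "openin C N"
    unfolding N_def by (rule openin_diff[OF part_open])
  show "\<delta> \<subseteq> N"
    using \<delta>(2) ends_disjoint[OF \<delta>(1)] by (auto simp: N_def)
  have Np: "N \<subseteq> part"
    by (auto simp: N_def)
  have sep: "z = z'" if z: "z \<in> N" "z' \<in> part" "\<kappa> z = \<kappa> z'" for z z'
  proof (rule ccontr)
    assume "z \<noteq> z'"
    moreover have "z \<in> topspace C" "z' \<in> topspace C"
      using z Np part_subset by blast+
    ultimately obtain \<epsilon> where \<epsilon>: "\<epsilon> \<in> ends C" "z \<in> \<epsilon>" "z' \<in> opp_end \<epsilon>"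
      using same_image_cases z(3) by blast
    then have "\<epsilon> = \<delta>"
      using z(1) by (auto simp: N_def)
    then show False
      using \<epsilon>(3) z(2) \<delta>(3) by blast
  qed
  show op: "openin Y (\<kappa> ` B)" if B: "openin C B" "B \<subseteq> N" for B
  proof -
    have "\<kappa> ` B = topspace Y - \<kappa> ` (part \<inter> (topspace C - B))"
    proof (intro equalityI subsetI)
      fix y assume "y \<in> \<kappa> ` B"
      then obtain z where z: "z \<in> B" "y = \<kappa> z"
        by blast
      have "y \<notin> \<kappa> ` (part \<inter> (topspace C - B))"
        using sep[of z] z B(2) by auto
      moreover have "z \<in> part"
        using subsetD[OF Np subsetD[OF B(2) z(1)]] .
      ultimately show "y \<in> topspace Y - \<kappa> ` (part \<inter> (topspace C - B))"
        unfolding topspace_Y z(2) by (intro DiffI imageI)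
    next
      fix y assume "y \<in> topspace Y - \<kappa> ` (part \<inter> (topspace C - B))"
      then show "y \<in> \<kappa> ` B"
        using part_subset unfolding topspace_Y by blast
    qed
    then show ?thesis
      using openin_Y_complement[of "topspace C - B"] B(1) by (simp add: closedin_diff)
  qed
  have NY: "openin Y (\<kappa> ` N)"
    using op[OF N] by simp
  have tN: "topspace (subtopology C N) = N"
    using Np part_subset by auto
  have pre: "{x \<in> topspace (subtopology C part). \<kappa> x \<in> \<kappa> ` N} = N"
    using sep Np part_subset by (auto; metis)
  have "quotient_map (subtopology (subtopology C part) N) (subtopology Y (\<kappa> ` N)) \<kappa>"
    by (rule quotient_map_restriction[OF quotient_map_part pre]) (use NY in simp)
  moreover have "subtopology (subtopology C part) N = subtopology C N"
    using Np by (simp add: subtopology_subtopology Int_absorb1)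
  moreover have "inj_on \<kappa> N"
  proof (rule inj_onI)
    fix z z' assume "z \<in> N" "z' \<in> N" "\<kappa> z = \<kappa> z'"
    then show "z = z'"
      using sep[of z z'] subsetD[OF Np] by simp
  qed
  ultimately have homeo: "homeomorphic_map (subtopology C N) (subtopology Y (\<kappa> ` N)) \<kappa>"
    unfolding homeomorphic_map_def tN by simp
  then obtain g where "homeomorphic_maps (subtopology C N) (subtopology Y (\<kappa> ` N)) \<kappa> g"
    using homeomorphic_map_maps by blast
  then have g: "homeomorphic_map (subtopology Y (\<kappa> ` N)) (subtopology C N) g" "\<And>z. z \<in> N \<Longrightarrow> g (\<kappa> z) = z"
    using homeomorphic_maps_map homeomorphic_maps_sym tN unfolding homeomorphic_maps_def by metis+
  show "\<kappa> z \<in> manifold_interior 2 Y \<longleftrightarrow> z \<in> interiorC" if z: "z \<in> N" for z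
  proof -
    have zC: "z \<in> topspace C" and zY: "\<kappa> z \<in> topspace Y"
      using z Np part_subset topspace_Y by auto
    have "z \<in> interiorC \<longleftrightarrow> locally_Euclidean_at 2 (subtopology C N) z"
      using zC locally_Euclidean_at_open[OF N z] by (simp add: manifold_interior_def)
    also have "\<dots> \<longleftrightarrow> locally_Euclidean_at 2 (subtopology Y (\<kappa> ` N)) (\<kappa> z)"
    proof
      assume "locally_Euclidean_at 2 (subtopology C N) z"
      then show "locally_Euclidean_at 2 (subtopology Y (\<kappa> ` N)) (\<kappa> z)"
        by (rule locally_Euclidean_at_homeomorphic[OF homeo])
    next
      assume "locally_Euclidean_at 2 (subtopology Y (\<kappa> ` N)) (\<kappa> z)"
      from locally_Euclidean_at_homeomorphic[OF g(1) this]
      show "locally_Euclidean_at 2 (subtopology C N) z"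
        by (simp add: g(2)[OF z])
    qed
    also have "\<dots> \<longleftrightarrow> \<kappa> z \<in> manifold_interior 2 Y"
      using zY locally_Euclidean_at_open[OF NY imageI[OF z]] by (simp add: manifold_interior_def)
    finally show ?thesis
      by simp
  qed
qed

text \<open>At a one-sided end Y is locally homeomorphic to C, and by \<open>cut_along\<close> the
  points of C over a curve are boundary points, so no such point of Y is interior. All other points
  have a neighborhood in X that lies in the subsurface.\<close>

lemma manifold_interior_Y: "manifold_interior 2 Y = interiorY"
proof (intro equalityI subsetI)
  fix y assume y: "y \<in> interiorY"
  then have yX: "y \<in> topspace X" "y \<in> \<kappa> ` part"
    using interiorY_subset by blast+
  have O: "openin X interiorY" "openin Y interiorY"
    using openin_Y_if interiorY_subset by simp_all
  have "subtopology Y interiorY = subtopology X interiorY"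
    using interiorY_subset by (simp add: Y_eq subtopology_subtopology Int_absorb1)
  then have "locally_Euclidean_at 2 Y y"
    using locally_Euclidean_at_open[OF O(1) y] locally_Euclidean_at_open[OF O(2) y] Euclidean_X[OF yX(1)] by metis
  then show "y \<in> manifold_interior 2 Y"
    using yX by (simp add: manifold_interior_def topspace_Y)
next
  fix y assume y: "y \<in> manifold_interior 2 Y"
  then obtain x where x: "x \<in> part" "y = \<kappa> x"
    by (auto simp: manifold_interior_def topspace_Y)
  show "y \<in> interiorY"
  proof (rule part_point_cases[OF x(1)])
    fix \<delta> assume \<delta>: "\<delta> \<in> ends C" "x \<in> \<delta>" "\<delta> \<subseteq> part" "opp_end \<delta> \<inter> part = {}"
    have "x \<in> interiorC"
      using one_sided_end(4)[OF \<delta>(1,3,4) subsetD[OF one_sided_end(2)[OF \<delta>(1,3,4)] \<delta>(2)]] y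
      unfolding x(2) by simp
    moreover have "x \<notin> interiorC"
      using ends_subset[OF \<delta>(1)] \<delta>(2) by (auto simp: manifold_boundary_def)
    ultimately show ?thesis
      by blast
  qed (simp add: x)
qed

lemma oriented_paths_X:
  assumes "manifold_with_boundary 2 X"
  shows "oriented_paths 2 X"
  by unfold_locales
    (use Hausdorff_X in simp, rule manifold_small_neighbourhood[OF assms], simp, assumption, assumption, blast)

text \<open>Interior points borrow small neighborhoods from X; points on a one-sided end borrow them
  from C through \<kappa>, which is a homeomorphism there.\<close>

lemma oriented_paths_Y:
  assumes X: "manifold_with_boundary 2 X"
  shows "oriented_paths 2 Y"
proof
  show "Hausdorff_space Y"
    unfolding Y_eq using Hausdorff_X by (rule Hausdorff_space_subtopology)
  fix N0 p assume N0: "openin Y N0" "p \<in> N0"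
  then have "p \<in> topspace Y"
    using subsetD[OF openin_subset] by metis
  then obtain x where x: "x \<in> part" "p = \<kappa> x"
    unfolding topspace_Y by blast
  show "\<exists>B. openin Y B \<and> p \<in> B \<and> B \<subseteq> N0 \<and> connectedin Y (B \<inter> manifold_interior 2 Y) \<and>
      B \<inter> manifold_interior 2 Y \<noteq> {}"
  proof (rule part_point_cases[OF x(1)])
    assume p: "\<kappa> x \<in> interiorY"
    have "openin Y interiorY"
      using openin_Y_if interiorY_subset by simp
    then have op: "openin X (N0 \<inter> interiorY)"
      using N0(1) by (intro openin_X_if) auto
    have pin: "p \<in> N0 \<inter> interiorY"
      using p N0(2) x(2) by simp
    obtain B where B: "openin X B" "p \<in> B" "B \<subseteq> N0 \<inter> interiorY" "connectedin X B"
      by (rule manifold_small_neighbourhood[OF X _ op pin]) (simp, blast)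
    have BO: "B \<subseteq> interiorY"
      using B(3) by simp
    then have Bp: "B \<subseteq> \<kappa> ` part"
      using interiorY_subset(1) by (rule subset_trans)
    have "connectedin Y B"
      unfolding Y_eq connectedin_subtopology using B(4) Bp by simp
    moreover have "openin Y B" "B \<inter> manifold_interior 2 Y = B"
      using openin_Y_if[OF B(1) Bp] BO unfolding manifold_interior_Y by auto
    ultimately show ?thesis
      using B(2,3) by (intro exI[of _ B]) auto
  next
    fix \<delta> assume \<delta>: "\<delta> \<in> ends C" "x \<in> \<delta>" "\<delta> \<subseteq> part" "opp_end \<delta> \<inter> part = {}"
    define N where "N = part - \<Union>(ends C - {\<delta>})"
    note os = one_sided_end[OF \<delta>(1,3,4), folded N_def]
    have "openin (subtopology C part) {z \<in> topspace (subtopology C part). \<kappa> z \<in> N0}"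
      using quotient_imp_continuous_map[OF quotient_map_part] N0(1) by (rule openin_continuous_map_preimage)
    then have "openin C {z \<in> topspace (subtopology C part). \<kappa> z \<in> N0}"
      using part_open openin_trans_full by blast
    then have op: "openin C (N \<inter> {z \<in> topspace (subtopology C part). \<kappa> z \<in> N0})"
      using os(1) by (intro openin_Int)
    have xin: "x \<in> N \<inter> {z \<in> topspace (subtopology C part). \<kappa> z \<in> N0}"
      using N0(2) x subsetD[OF os(2) \<delta>(2)] subsetD[OF part_subset x(1)] by simp
    obtain B where B: "openin C B" "x \<in> B" "B \<subseteq> N \<inter> {z \<in> topspace (subtopology C part). \<kappa> z \<in> N0}"
        "connectedin C (B \<inter> interiorC)" "B \<inter> interiorC \<noteq> {}"
      by (rule manifold_small_neighbourhood[OF manifold_C _ op xin]) (simp, blast)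
    have BN: "B \<subseteq> N"
      using B(3) by blast
    have img: "\<kappa> ` B \<inter> manifold_interior 2 Y = \<kappa> ` (B \<inter> interiorC)"
    proof (intro equalityI subsetI)
      fix y assume "y \<in> \<kappa> ` B \<inter> manifold_interior 2 Y"
      then obtain z where "z \<in> B" "y = \<kappa> z" "\<kappa> z \<in> manifold_interior 2 Y"
        by blast
      then show "y \<in> \<kappa> ` (B \<inter> interiorC)"
        using os(4)[of z] subsetD[OF BN] by simp
    next
      fix y assume "y \<in> \<kappa> ` (B \<inter> interiorC)"
      then obtain z where "z \<in> B" "z \<in> interiorC" "y = \<kappa> z"
        by blast
      then show "y \<in> \<kappa> ` B \<inter> manifold_interior 2 Y"
        using os(4)[of z] subsetD[OF BN] by simp
    qed
    have "B \<inter> interiorC \<subseteq> part"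
      using BN by (auto simp: N_def)
    then have "\<kappa> ` (B \<inter> interiorC) \<subseteq> \<kappa> ` part"
      by (rule image_mono)
    then have "connectedin Y (\<kappa> ` B \<inter> manifold_interior 2 Y)"
      using connectedin_continuous_map_image[OF \<kappa>_continuous B(4)]
      unfolding img unfolding Y_eq connectedin_subtopology by simp
    then show ?thesis
      using os(3)[OF B(1) BN] B(2,3,5) x(2) img by (intro exI[of _ "\<kappa> ` B"]) auto
  qed
qed

section \<open>Restricting orientations by excision\<close>

abbreviation incl where
  "incl V \<equiv> hom_induced (int 2) Y (topspace Y - V) X (topspace X - V) id"

text \<open>The complement of the subsurface is excised; taking complements turns the hypothesis on
  V into the closure condition of the excision axiom.\<close>

lemma incl_iso:
  assumes "X closure_of V \<subseteq> interiorY"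
  shows "incl V \<in> iso (local_homology 2 Y V) (local_homology 2 X V)"
proof -
  have "\<kappa> ` part \<subseteq> topspace X"
    using part_subset \<kappa>_in by blast
  moreover have "X closure_of (topspace X - \<kappa> ` part) \<subseteq> X interior_of (topspace X - V)"
    using assms by (auto simp: closure_of_complement interior_of_complement)
  ultimately show ?thesis
    using excision_complements[of "\<kappa> ` part" X V "int 2"] unfolding local_homology_def topspace_Y
    by (simp add: Y_eq)
qed

lemma incl_point_iso:
  assumes "y \<in> interiorY"
  shows "incl {y} \<in> iso (local_homology 2 Y {y}) (local_homology 2 X {y})"
proof (rule incl_iso)
  have "closedin X {y}"
    using Hausdorff_X assms interiorY_subset by (simp add: closedin_Hausdorff_sing_eq subset_iff)
  then show "X closure_of {y} \<subseteq> interiorY"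
    using assms by (simp add: closure_of_closedin)
qed

text \<open>The preimage under the excision isomorphism. It is meaningful at the points of
  \<open>interiorY\<close>, where \<open>incl {y}\<close> is bijective.\<close>

definition restrict_orientation :: "('x \<Rightarrow> 'x chain set) \<Rightarrow> 'x \<Rightarrow> 'x chain set" where
  "restrict_orientation \<omega> y = inv_into (carrier (local_homology 2 Y {y})) (incl {y}) (\<omega> y)"

lemma restrict_orientation:
  assumes "y \<in> interiorY" "\<omega> y \<in> carrier (local_homology 2 X {y})"
  shows "restrict_orientation \<omega> y \<in> carrier (local_homology 2 Y {y})"
    and "incl {y} (restrict_orientation \<omega> y) = \<omega> y"
    and "A \<in> carrier (local_homology 2 Y {y}) \<Longrightarrow> incl {y} A = \<omega> y \<Longrightarrow> restrict_orientation \<omega> y = A"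
proof -
  have bij: "bij_betw (incl {y}) (carrier (local_homology 2 Y {y})) (carrier (local_homology 2 X {y}))"
    using incl_point_iso[OF assms(1)] by (simp add: iso_def)
  then have im: "\<omega> y \<in> incl {y} ` carrier (local_homology 2 Y {y})"
    using assms(2) by (simp add: bij_betw_def)
  show "restrict_orientation \<omega> y \<in> carrier (local_homology 2 Y {y})" "incl {y} (restrict_orientation \<omega> y) = \<omega> y"
    unfolding restrict_orientation_def by (rule inv_into_into[OF im], rule f_inv_into_f[OF im])
  show "restrict_orientation \<omega> y = A" if "A \<in> carrier (local_homology 2 Y {y})" "incl {y} A = \<omega> y"
    unfolding restrict_orientation_def that(2)[symmetric]
    by (rule inv_into_f_f[OF bij_betw_imp_inj_on[OF bij] that(1)])
qed

lemma hom_induced_id_id: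
  assumes "continuous_map X1 X2 id" "continuous_map X2 X3 id" "A1 \<subseteq> A2" "A2 \<subseteq> A3"
  shows "hom_induced p X2 A2 X3 A3 id (hom_induced p X1 A1 X2 A2 id c) = hom_induced p X1 A1 X3 A3 id c"
proof -
  have "id \<in> A1 \<rightarrow> A2" "id \<in> A2 \<rightarrow> A3"
    using assms(3,4) by (simp_all add: Pi_iff subset_iff)
  then show ?thesis
    using hom_induced_compose'[OF assms(1) _ assms(2)] by simp
qed

text \<open>Pointwise the generators are pulled back by an isomorphism. For coherence, the class on
  V need not have a counterpart in Y: V is replaced by a smaller V' with closure in the interior,
  where excision applies, and the class pulled back there is tested after mapping to X.\<close>

lemma orientation_on_restrict:
  assumes \<omega>: "orientation_on 2 X U \<omega>"
  shows "orientation_on 2 Y (U \<inter> topspace Y) (restrict_orientation \<omega>)"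
  unfolding orientation_on_def
proof (intro ballI conjI)
  fix y assume y: "y \<in> U \<inter> topspace Y \<inter> manifold_interior 2 Y"
  then have yU: "y \<in> U" and yO: "y \<in> interiorY" and yX: "y \<in> manifold_interior 2 X"
    using interiorY_subset unfolding manifold_interior_Y manifold_interior_X by blast+
  note gen = orientation_on_generator[OF \<omega> yU yX]
  note r = restrict_orientation[where \<omega> = \<omega>, OF yO gen(1)]
  show "restrict_orientation \<omega> y \<in> carrier (local_homology 2 Y {y})"
    by (rule r(1))
  have iso: "incl {y} \<in> iso (local_homology 2 Y {y}) (local_homology 2 X {y})"
    by (rule incl_point_iso[OF yO])
  interpret h: group_hom "local_homology 2 Y {y}" "local_homology 2 X {y}" "incl {y}"
    using iso by (simp add: group_hom_def group_hom_axioms_def iso_def local_homology_def)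
  have inj: "inj_on (incl {y}) (carrier (local_homology 2 Y {y}))"
    and surj: "incl {y} ` carrier (local_homology 2 Y {y}) = carrier (local_homology 2 X {y})"
    using iso by (auto simp: iso_def bij_betw_def)
  show "generate (local_homology 2 Y {y}) {restrict_orientation \<omega> y} = carrier (local_homology 2 Y {y})"
  proof -
    have sub: "{restrict_orientation \<omega> y} \<subseteq> carrier (local_homology 2 Y {y})"
      using r(1) by simp
    have "incl {y} ` generate (local_homology 2 Y {y}) {restrict_orientation \<omega> y} =
        generate (local_homology 2 X {y}) (incl {y} ` {restrict_orientation \<omega> y})"
      by (rule h.generate_img[OF sub, symmetric])
    also have "\<dots> = incl {y} ` carrier (local_homology 2 Y {y})"
      by (simp only: image_insert image_empty r(2) gen(2) surj)
    finally show ?thesis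
      using inj_on_image_eq_iff[OF inj h.G.generate_incl[OF sub] subset_refl] by blast
  qed
  obtain V \<mu> where V: "openin X V" "y \<in> V" "V \<subseteq> U \<inter> manifold_interior 2 X"
    and \<mu>: "\<mu> \<in> carrier (local_homology 2 X V)"
    and \<omega>V: "\<forall>z \<in> V. hom_induced (int 2) X (topspace X - V) X (topspace X - {z}) id \<mu> = \<omega> z"
    using conjunct2[OF conjunct2[OF bspec[OF \<omega>[unfolded orientation_on_def] IntI[OF yU yX]]]]
    by (elim exE conjE) (rule that)
  have "openin X (V \<inter> interiorY)" "y \<in> V \<inter> interiorY"
    using V yO by auto
  then obtain V' K where V': "openin X V'" "closedin X K" "y \<in> V'" "V' \<subseteq> K" "K \<subseteq> V \<inter> interiorY"
    using regular_X unfolding neighbourhood_base_of_closedin[symmetric] neighbourhood_base_of by meson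
  then have clV': "X closure_of V' \<subseteq> interiorY"
    using closure_of_minimal by blast
  have V'V: "V' \<subseteq> V" "V' \<subseteq> interiorY"
    using V' by blast+
  have cX: "continuous_map X X id" and cY: "continuous_map Y Y id" and cYX: "continuous_map Y X id"
    by (simp_all add: Y_eq continuous_map_from_subtopology)
  have topYX: "topspace Y \<subseteq> topspace X"
    unfolding topspace_Y using part_subset \<kappa>_in by blast
  define \<mu>1 where "\<mu>1 = hom_induced (int 2) X (topspace X - V) X (topspace X - V') id \<mu>"
  have "\<mu>1 \<in> carrier (local_homology 2 X V')"
    unfolding \<mu>1_def local_homology_def by (rule hom_induced_carrier)
  moreover have "incl V' ` carrier (local_homology 2 Y V') = carrier (local_homology 2 X V')"
    using incl_iso[OF clV'] unfolding iso_def bij_betw_def by blast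
  ultimately have "\<mu>1 \<in> incl V' ` carrier (local_homology 2 Y V')"
    by (simp only:)
  then obtain \<mu>2 where "\<mu>1 = incl V' \<mu>2" and \<mu>2_in: "\<mu>2 \<in> carrier (local_homology 2 Y V')"
    by (rule imageE)
  then have \<mu>2: "\<mu>2 \<in> carrier (local_homology 2 Y V')" "incl V' \<mu>2 = \<mu>1"
    by (simp_all only:)
  \<comment> \<open>All inclusions of pairs commute, so the image of \<mu>2 at z becomes \<omega> z
    in X; injectivity of \<open>incl {z}\<close> identifies it.\<close>
  have coh: "hom_induced (int 2) Y (topspace Y - V') Y (topspace Y - {z}) id \<mu>2 = restrict_orientation \<omega> z"
    if z: "z \<in> V'" for z
  proof -
    have zV: "z \<in> V" "z \<in> interiorY" "z \<in> U" "z \<in> manifold_interior 2 X"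
      using z V'V V(3) by blast+
    have "incl {z} (hom_induced (int 2) Y (topspace Y - V') Y (topspace Y - {z}) id \<mu>2) =
        hom_induced (int 2) Y (topspace Y - V') X (topspace X - {z}) id \<mu>2"
      using z topYX by (intro hom_induced_id_id cY cYX) auto
    also have "\<dots> = hom_induced (int 2) X (topspace X - V') X (topspace X - {z}) id (incl V' \<mu>2)"
      using z topYX by (intro hom_induced_id_id[symmetric] cX cYX) auto
    also have "\<dots> = hom_induced (int 2) X (topspace X - V) X (topspace X - {z}) id \<mu>"
      unfolding \<mu>2(2) \<mu>1_def using z V'V by (intro hom_induced_id_id cX) auto
    also have "\<dots> = \<omega> z"
      using \<omega>V zV(1) by blast
    finally have e: "incl {z} (hom_induced (int 2) Y (topspace Y - V') Y (topspace Y - {z}) id \<mu>2) = \<omega> z" .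
    have "hom_induced (int 2) Y (topspace Y - V') Y (topspace Y - {z}) id \<mu>2 \<in> carrier (local_homology 2 Y {z})"
      unfolding local_homology_def by (rule hom_induced_carrier)
    from restrict_orientation(3)[where \<omega> = \<omega>, OF zV(2) orientation_on_generator(1)[OF \<omega> zV(3,4)] this e]
    show ?thesis
      by (rule sym)
  qed
  show "\<exists>V \<mu>. openin Y V \<and> y \<in> V \<and> V \<subseteq> U \<inter> topspace Y \<inter> manifold_interior 2 Y \<and>
      \<mu> \<in> carrier (local_homology 2 Y V) \<and>
      (\<forall>z \<in> V. hom_induced (int 2) Y (topspace Y - V) Y (topspace Y - {z}) id \<mu> = restrict_orientation \<omega> z)"
  proof (intro exI conjI ballI)
    show "openin Y V'"
      using V'(1) V'V(2) interiorY_subset(1) by (intro openin_Y_if) auto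
    show "V' \<subseteq> U \<inter> topspace Y \<inter> manifold_interior 2 Y"
    proof
      fix v assume v: "v \<in> V'"
      have "v \<in> U" "v \<in> interiorY" "v \<in> \<kappa> ` part"
        using subsetD[OF V(3) subsetD[OF V'V(1) v]] subsetD[OF V'V(2) v]
          subsetD[OF interiorY_subset(1) subsetD[OF V'V(2) v]] by simp_all
      then show "v \<in> U \<inter> topspace Y \<inter> manifold_interior 2 Y"
        unfolding manifold_interior_Y topspace_Y by simp
    qed
  qed (use V'(3) \<mu>2(1) coh in auto)
qed

lemma agree_near_restrict:
  assumes "agree_near 2 X p \<omega> \<omega>'" "p \<in> topspace Y"
  shows "agree_near 2 Y p (restrict_orientation \<omega>) (restrict_orientation \<omega>')"
proof -
  obtain W where W: "openin X W" "p \<in> W" "\<forall>y \<in> W \<inter> manifold_interior 2 X. \<omega> y = \<omega>' y"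
    using assms(1) unfolding agree_near_def by blast
  have "openin Y (W \<inter> \<kappa> ` part)"
    unfolding Y_eq using W(1) by (rule openin_subtopology_Int)
  moreover have "restrict_orientation \<omega> y = restrict_orientation \<omega>' y" if "y \<in> W \<inter> \<kappa> ` part" for y
    using W(3) that part_subset \<kappa>_in unfolding manifold_interior_X restrict_orientation_def by fastforce
  ultimately show ?thesis
    using W(2) assms(2) unfolding agree_near_def topspace_Y by (intro exI[of _ "W \<inter> \<kappa> ` part"]) auto
qed

lemma orientation_along_restrict:
  assumes \<omega>: "orientation_along 2 X \<alpha> \<omega>" and \<alpha>: "\<And>t. t \<in> {0..1} \<Longrightarrow> \<alpha> t \<in> topspace Y"
  shows "orientation_along 2 Y \<alpha> (\<lambda>t. restrict_orientation (\<omega> t))"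
  unfolding orientation_along_def
proof
  fix t :: real assume t: "t \<in> {0..1}"
  obtain \<epsilon> U where \<epsilon>: "\<epsilon> > 0" "openin X U" "orientation_on 2 X U (\<omega> t)"
    "\<forall>r \<in> {0..1}. \<bar>r - t\<bar> < \<epsilon> \<longrightarrow> \<alpha> r \<in> U \<and> agree_near 2 X (\<alpha> r) (\<omega> r) (\<omega> t)"
    using \<omega> t unfolding orientation_along_def by blast
  have "openin Y (U \<inter> topspace Y)"
    unfolding topspace_Y unfolding Y_eq using \<epsilon>(2) by (rule openin_subtopology_Int)
  moreover have "\<forall>r \<in> {0..1}. \<bar>r - t\<bar> < \<epsilon> \<longrightarrow> \<alpha> r \<in> U \<inter> topspace Y \<and>
      agree_near 2 Y (\<alpha> r) (restrict_orientation (\<omega> r)) (restrict_orientation (\<omega> t))"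
    using \<epsilon>(4) \<alpha> agree_near_restrict by blast
  ultimately show "\<exists>\<epsilon>>0. \<exists>U. openin Y U \<and> orientation_on 2 Y U (restrict_orientation (\<omega> t)) \<and>
        (\<forall>r \<in> {0..1}. \<bar>r - t\<bar> < \<epsilon> \<longrightarrow> \<alpha> r \<in> U \<and>
          agree_near 2 Y (\<alpha> r) (restrict_orientation (\<omega> r)) (restrict_orientation (\<omega> t)))"
    using \<epsilon>(1) orientation_on_restrict[OF \<epsilon>(3)] by (intro exI[of _ \<epsilon>] exI[of _ "U \<inter> topspace Y"] conjI)
qed

text \<open>Restriction carries an orientation of X along \<alpha> to one of Y, which settles the
  value 1. For the value -1, an orientation of Y along \<alpha> that closes up would force the
  restricted orientation to close up as well, while in X its two ends are opposite.\<close>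

lemma orientation_character_part:
  assumes X: "manifold_with_boundary 2 X" and \<alpha>: "loop_in Y \<alpha>"
    and ex: "\<exists>\<omega>. orientation_along 2 X \<alpha> \<omega>"
  shows "orientation_character 2 Y \<alpha> = orientation_character 2 X \<alpha>"
proof -
  interpret X: oriented_paths 2 X
    by (rule oriented_paths_X[OF X])
  interpret Y: oriented_paths 2 Y
    by (rule oriented_paths_Y[OF X])
  have \<alpha>Y: "pathin Y \<alpha>" "\<alpha> 0 = \<alpha> 1"
    using \<alpha> by (simp_all add: loop_in_def)
  have \<alpha>in: "\<alpha> t \<in> topspace Y" if "t \<in> {0..1}" for t
    using continuous_map_funspace[OF \<alpha>Y(1)[unfolded pathin_def]] that by auto
  have 01: "0 \<in> {0..1::real}" "1 \<in> {0..1::real}"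
    by simp_all
  show ?thesis
  proof (cases "\<exists>\<omega>. orientation_along 2 X \<alpha> \<omega> \<and> agree_near 2 X (\<alpha> 0) (\<omega> 0) (\<omega> 1)")
    case True
    then obtain \<omega> where \<omega>: "orientation_along 2 X \<alpha> \<omega>" "agree_near 2 X (\<alpha> 0) (\<omega> 0) (\<omega> 1)"
      by blast
    have "orientation_along 2 Y \<alpha> (\<lambda>t. restrict_orientation (\<omega> t))"
      using \<omega>(1) \<alpha>in by (rule orientation_along_restrict)
    moreover have "agree_near 2 Y (\<alpha> 0) (restrict_orientation (\<omega> 0)) (restrict_orientation (\<omega> 1))"
      using \<omega>(2) \<alpha>in[OF 01(1)] by (rule agree_near_restrict)
    ultimately have "\<exists>\<omega>. orientation_along 2 Y \<alpha> \<omega> \<and> agree_near 2 Y (\<alpha> 0) (\<omega> 0) (\<omega> 1)"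
      by (intro exI[of _ "\<lambda>t. restrict_orientation (\<omega> t)"] conjI)
    then show ?thesis
      using True by (simp add: orientation_character_def)
  next
    case False
    obtain \<omega> where \<omega>: "orientation_along 2 X \<alpha> \<omega>"
      using ex by blast
    have \<omega>Y: "orientation_along 2 Y \<alpha> (\<lambda>t. restrict_orientation (\<omega> t))"
      using \<omega> \<alpha>in by (rule orientation_along_restrict)
    have "\<not> (orientation_along 2 Y \<alpha> \<omega>' \<and> agree_near 2 Y (\<alpha> 0) (\<omega>' 0) (\<omega>' 1))" for \<omega>'
    proof
      assume \<omega>': "orientation_along 2 Y \<alpha> \<omega>' \<and> agree_near 2 Y (\<alpha> 0) (\<omega>' 0) (\<omega>' 1)"
      let ?r0 = "restrict_orientation (\<omega> 0)" and ?r1 = "restrict_orientation (\<omega> 1)"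
      have r01: "agree_near 2 Y (\<alpha> 0) ?r0 ?r1"
        using Y.orientation_along_unique[OF \<alpha>Y(1) \<omega>Y conjunct1[OF \<omega>']]
      proof
        assume a: "\<forall>t \<in> {0..1}. agree_near 2 Y (\<alpha> t) (restrict_orientation (\<omega> t)) (\<omega>' t)"
        have 0: "agree_near 2 Y (\<alpha> 0) ?r0 (\<omega>' 0)" and 1: "agree_near 2 Y (\<alpha> 0) (\<omega>' 1) ?r1"
          using bspec[OF a 01(1)] bspec[OF a 01(2)] Y.agree_near_sym \<alpha>Y(2) by simp_all
        show ?thesis
          by (rule Y.agree_near_trans[OF Y.agree_near_trans[OF 0 conjunct2[OF \<omega>']] 1])
      next
        \<comment> \<open>Both ends undergo the same change of sign, so the restricted orientation
          still closes up.\<close>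
        assume a: "\<forall>t \<in> {0..1}. agree_near 2 Y (\<alpha> t) (restrict_orientation (\<omega> t)) (opposite (\<omega>' t))"
        have 0: "agree_near 2 Y (\<alpha> 0) ?r0 (opposite (\<omega>' 0))" and 1: "agree_near 2 Y (\<alpha> 0) (opposite (\<omega>' 1)) ?r1"
          using bspec[OF a 01(1)] bspec[OF a 01(2)] Y.agree_near_sym \<alpha>Y(2) by simp_all
        show ?thesis
          by (rule Y.agree_near_trans[OF Y.agree_near_trans[OF 0 Y.agree_near_opposite[OF conjunct2[OF \<omega>']]] 1])
      qed
      obtain U0 where U0: "openin X U0" "orientation_on 2 X U0 (\<omega> 0)" "\<alpha> 0 \<in> U0"
        by (rule X.orientation_along_at[OF \<omega> 01(1)])
      obtain U1 where U1: "openin X U1" "orientation_on 2 X U1 (\<omega> 1)" "\<alpha> 1 \<in> U1"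
        by (rule X.orientation_along_at[OF \<omega> 01(2)])
      have "agree_near 2 X (\<alpha> 0) (\<omega> 0) (\<omega> 1) \<or> agree_near 2 X (\<alpha> 0) (\<omega> 0) (opposite (\<omega> 1))"
        using X.agree_near_cases[OF U0 U1(1,2)] U1(3) \<alpha>Y(2) by simp
      then have "agree_near 2 X (\<alpha> 0) (\<omega> 0) (opposite (\<omega> 1))"
        using False \<omega> by blast
      then obtain W where W: "openin X W" "\<alpha> 0 \<in> W" "\<forall>y \<in> W \<inter> manifold_interior 2 X. \<omega> 0 y = uminus ` \<omega> 1 y"
        unfolding agree_near_def by blast
      obtain W' where W': "openin Y W'" "\<alpha> 0 \<in> W'" "\<forall>y \<in> W' \<inter> manifold_interior 2 Y. ?r0 y = ?r1 y"
        using r01 unfolding agree_near_def by blast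
      have "openin Y ((W \<inter> U0 \<inter> U1) \<inter> \<kappa> ` part)"
        unfolding Y_eq using W(1) U0(1) U1(1) by (intro openin_subtopology_Int) auto
      then have "openin Y (W' \<inter> ((W \<inter> U0 \<inter> U1) \<inter> \<kappa> ` part))"
        using W'(1) by blast
      moreover have "\<alpha> 0 \<in> W' \<inter> ((W \<inter> U0 \<inter> U1) \<inter> \<kappa> ` part)"
        using W(2) W'(2) U0(3) U1(3) \<alpha>Y(2) \<alpha>in[OF 01(1)] topspace_Y by auto
      \<comment> \<open>The base point may lie on the boundary of Y, where an orientation has no
        value of its own, so the comparison takes place at an interior point nearby.\<close>
      ultimately obtain B where "B \<subseteq> W' \<inter> ((W \<inter> U0 \<inter> U1) \<inter> \<kappa> ` part)" "B \<inter> manifold_interior 2 Y \<noteq> {}"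
        using Y.small by meson
      then obtain y where y: "y \<in> W'" "y \<in> W" "y \<in> U0" "y \<in> U1" "y \<in> manifold_interior 2 Y"
        by blast
      have yO: "y \<in> interiorY" and yX: "y \<in> manifold_interior 2 X"
        using y(5) interiorY_subset unfolding manifold_interior_Y manifold_interior_X by blast+
      have "\<omega> 0 y = \<omega> 1 y"
        using bspec[OF W'(3) IntI[OF y(1,5)]]
          restrict_orientation(2)[where \<omega> = "\<omega> 0", OF yO orientation_on_generator(1)[OF U0(2) y(3) yX]]
          restrict_orientation(2)[where \<omega> = "\<omega> 1", OF yO orientation_on_generator(1)[OF U1(2) y(4) yX]] by simp
      moreover have "\<omega> 0 y = uminus ` \<omega> 1 y"
        using W(3) y(2) yX by blast
      ultimately show False
        using orientations_dichotomy(2)[OF Hausdorff_X U1(2) y(4) U1(2) y(4) yX] by simp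
    qed
    then show ?thesis
      using False by (simp add: orientation_character_def)
  qed
qed

end

section \<open>The holonomy of the bundle\<close>

lemma orientation_character_cases: "orientation_character n X \<alpha> \<in> {1, - 1}"
  by (simp add: orientation_character_def)

lemma rat_bundle_orientation_double_cover:
  assumes "orientation_double_cover X Q"
  shows "rat_bundle {1, - 1} X Q"
  using assms unfolding orientation_double_cover_def
  by (intro rat_bundle_principal_bundle) auto

text \<open>A path followed by its reverse lifts to a closed path, so by the defining property of the double
  cover an orientation can be carried along it.\<close>

lemma orientation_along_exists:
  assumes Q: "orientation_double_cover X Q" and \<alpha>: "pathin X \<alpha>"
  shows "\<exists>\<omega>. orientation_along 2 X \<alpha> \<omega>"
proof -
  interpret Q: rat_bundle "{1, - 1}" X Q
    using Q by (rule rat_bundle_orientation_double_cover)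
  \<comment> \<open>The tent map: \<open>\<alpha> \<circ> \<phi>\<close> runs along \<alpha> at
    double speed and back.\<close>
  define \<phi> where "\<phi> t = 1 - \<bar>1 - 2 * t\<bar>" for t :: real
  have \<phi>: "continuous_map (top_of_set {0..1}) (top_of_set {0..1}) \<phi>"
    unfolding \<phi>_def by (auto intro!: continuous_intros)
  have \<phi>01: "\<phi> 0 = 0" "\<phi> 1 = 0"
    by (simp_all add: \<phi>_def)
  have "\<alpha> 0 \<in> topspace X"
    using continuous_map_funspace[OF \<alpha>[unfolded pathin_def]] by auto
  then obtain e where e: "e \<in> topspace (total Q)" "proj Q e = \<alpha> 0"
    by (rule Q.fibre_nonempty)
  obtain \<delta> where \<delta>: "is_lift Q \<alpha> \<delta>" "\<delta> 0 = e"
    using Q.path_lift[OF \<alpha> e] .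
  have loop: "loop_in X (\<alpha> \<circ> \<phi>)"
    using continuous_map_compose[OF \<phi> \<alpha>[unfolded pathin_def]]
    unfolding loop_in_def pathin_def by (simp add: \<phi>01)
  have lift: "is_lift Q (\<alpha> \<circ> \<phi>) (\<delta> \<circ> \<phi>)"
    unfolding is_lift_def pathin_def
  proof (intro conjI ballI)
    show "continuous_map (top_of_set {0..1}) (total Q) (\<delta> \<circ> \<phi>)"
      using \<delta>(1) unfolding is_lift_def pathin_def by (intro continuous_map_compose[OF \<phi>]) simp
    show "proj Q ((\<delta> \<circ> \<phi>) t) = (\<alpha> \<circ> \<phi>) t" if "t \<in> {0..1}" for t
      using Q.is_lift_proj[OF \<delta>(1), of "\<phi> t"] that by (simp add: \<phi>_def abs_le_iff)
  qed
  have "(\<delta> \<circ> \<phi>) 1 = act Q (orientation_character 2 X (\<alpha> \<circ> \<phi>)) ((\<delta> \<circ> \<phi>) 0)"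
    using Q loop lift unfolding orientation_double_cover_def by metis
  then have "act Q 1 e = act Q (orientation_character 2 X (\<alpha> \<circ> \<phi>)) e"
    using e(1) by (simp add: \<phi>01 \<delta>(2) Q.act_one)
  \<comment> \<open>The default value of the character is -1, so the value 1 certifies that an
    orientation exists; its first half serves \<alpha>.\<close>
  then have "orientation_character 2 X (\<alpha> \<circ> \<phi>) = 1"
    using Q.act_cancel[OF e(1) _ orientation_character_cases] by (metis insertI1)
  then obtain \<omega> where \<omega>: "orientation_along 2 X (\<alpha> \<circ> \<phi>) \<omega>"
    unfolding orientation_character_def by (auto split: if_splits)
  have "orientation_along 2 X \<alpha> (\<lambda>t. \<omega> (t / 2))"
    unfolding orientation_along_def
  proof
    fix t :: real assume t: "t \<in> {0..1}"
    then have "t / 2 \<in> {0..1}"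
      by simp
    from bspec[OF \<omega>[unfolded orientation_along_def] this]
    obtain \<epsilon> U where \<epsilon>: "\<epsilon> > 0" "openin X U" "orientation_on 2 X U (\<omega> (t / 2))"
      and near: "\<forall>r \<in> {0..1}. \<bar>r - t / 2\<bar> < \<epsilon> \<longrightarrow> (\<alpha> \<circ> \<phi>) r \<in> U \<and>
        agree_near 2 X ((\<alpha> \<circ> \<phi>) r) (\<omega> r) (\<omega> (t / 2))"
      by (elim exE conjE) (rule that)
    have half: "(\<alpha> \<circ> \<phi>) (r / 2) = \<alpha> r" if "r \<in> {0..1}" for r
      using that by (simp add: \<phi>_def)
    have "\<forall>r \<in> {0..1}. \<bar>r - t\<bar> < 2 * \<epsilon> \<longrightarrow> \<alpha> r \<in> U \<and> agree_near 2 X (\<alpha> r) (\<omega> (r / 2)) (\<omega> (t / 2))"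
    proof (intro ballI impI)
      fix r assume r: "r \<in> {0..1}" "\<bar>r - t\<bar> < 2 * \<epsilon>"
      then have "r / 2 \<in> {0..1}" "\<bar>r / 2 - t / 2\<bar> < \<epsilon>"
        by (auto simp: abs_less_iff)
      then show "\<alpha> r \<in> U \<and> agree_near 2 X (\<alpha> r) (\<omega> (r / 2)) (\<omega> (t / 2))"
        using bspec[OF near, of "r / 2"] half[OF r(1)] by simp
    qed
    then show "\<exists>\<epsilon>>0. \<exists>U. openin X U \<and> orientation_on 2 X U (\<omega> (t / 2)) \<and>
        (\<forall>r \<in> {0..1}. \<bar>r - t\<bar> < \<epsilon> \<longrightarrow> \<alpha> r \<in> U \<and> agree_near 2 X (\<alpha> r) (\<omega> (r / 2)) (\<omega> (t / 2)))"
      using \<epsilon> by (intro exI[of _ "2 * \<epsilon>"] exI[of _ U] conjI) simp_all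
  qed
  then show ?thesis
    by (rule exI[where x = "\<lambda>t. \<omega> (t / 2)"])
qed

section \<open>Positivity of the numbers h, and the lift of a dual loop\<close>

context cut_subsurface begin

text \<open>The elevation E lies over an end, so it consists of boundary points of S'. The proper
  homotopy keeps the boundary of S' over the boundary of J, hence the copy of E at height 0 in the
  mapping torus is a connected set of boundary points and lies in exactly one boundary component.
  This is the component named by \<open>boundary_torus\<close>, and both covering degrees are
  positive.\<close>

lemma h_number_pos:
  assumes D: "valid_setup_data CM C \<kappa> gc \<Phi> D" and \<delta>: "\<delta> \<in> fiber_ends C \<kappa> \<Phi>"
  shows "h_number C D \<delta> > 0"
proof -
  define v where "v = vertex_of C \<delta>"
  define S' where "S' = cover D v"
  define p where "p = cover_proj D v"
  define J' where "J' = mtorus D v"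
  define q where "q = mtorus_quot D v"
  define J where "J = subtopology CM (carrier_piece CM gc v)"
  define P where "P = mtorus_proj D v"
  define E where "E = elevation D \<delta>"
  have \<delta>e: "\<delta> \<in> ends C" and v: "v \<in> \<Phi>"
    using \<delta> by (simp_all add: fiber_ends_def v_def)
  have p: "finite_covering S' (subtopology C v) p" and P: "finite_covering J' J P"
    and q: "mapping_torus S' (monodromy D v) J' q"
    and hom: "properly_homotopic S' J (gc \<circ> p) (\<lambda>x. P (q (x, 0)))"
    using conjunct1[OF D[unfolded valid_setup_data_def Let_def], rule_format, OF v]
    unfolding S'_def p_def J'_def q_def J_def P_def by simp_all
  have E: "E \<in> connected_components_of (subtopology S' {x \<in> topspace S'. p x \<in> \<delta>})"
    using conjunct2[OF D[unfolded valid_setup_data_def Let_def], rule_format, OF \<delta>]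
    unfolding S'_def p_def E_def v_def .
  have E_sub: "E \<subseteq> topspace S'" "\<And>x. x \<in> E \<Longrightarrow> p x \<in> \<delta>" and E_ne: "E \<noteq> {}"
    using connected_components_of_subset[OF E] nonempty_connected_components_of[OF E] by auto
  have E_conn: "connectedin S' E"
    using connectedin_connected_components_of[OF E] by (simp add: connectedin_subtopology)
  have v_open: "openin C v"
    using v \<Phi> component_open by blast
  have bS: "x \<in> manifold_boundary 2 S'" if x: "x \<in> E" for x
  proof -
    have "p x \<notin> interiorC"
      using E_sub(2)[OF x] ends_subset[OF \<delta>e] by (auto simp: manifold_boundary_def)
    then have "x \<notin> manifold_interior 2 S'"
      using finite_covering_interior[OF p, of x 2] manifold_interior_open_subset[OF v_open, of 2] by auto
    then show ?thesis
      using x E_sub(1) by (auto simp: manifold_boundary_def)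
  qed
  have quo: "quotient_map (prod_topology S' (top_of_set {0..1})) J' q"
    using q by (simp add: mapping_torus_def)
  have "continuous_map S' (prod_topology S' (top_of_set {0..1})) (\<lambda>x. (x, 0::real))"
    by (simp add: continuous_map_pairwise o_def)
  from continuous_map_compose[OF this quotient_imp_continuous_map[OF quo]]
  have q0: "continuous_map S' J' (\<lambda>x. q (x, 0))"
    by (simp add: o_def)
  have q0_eq: "q ` (E \<times> {0}) = (\<lambda>x. q (x, 0)) ` E"
    by auto
  \<comment> \<open>A homotopy through maps of pairs has maps of pairs at both of its ends; the
    terminal one is used.\<close>
  have "(\<lambda>x. P (q (x, 0))) ` manifold_boundary 2 S' \<subseteq> manifold_boundary 3 J"
    using homotopic_with_imp_property[OF hom[unfolded properly_homotopic_def]] by simp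
  then have PJ: "P (q (x, 0)) \<notin> manifold_interior 3 J" if "x \<in> E" for x
    using bS[OF that] by (auto simp: manifold_boundary_def)
  have bJ: "q ` (E \<times> {0}) \<subseteq> manifold_boundary 3 J'"
  proof
    fix y assume "y \<in> q ` (E \<times> {0})"
    then obtain x where x: "x \<in> E" "y = q (x, 0)"
      by blast
    have "y \<in> topspace J'"
      using continuous_map_funspace[OF q0] subsetD[OF E_sub(1) x(1)] x(2) by auto
    moreover have "y \<notin> manifold_interior 3 J'"
      using finite_covering_interior[OF P, of y 3] PJ[OF x(1)] x(2) by auto
    ultimately show "y \<in> manifold_boundary 3 J'"
      by (simp add: manifold_boundary_def)
  qed
  have "connectedin J' (q ` (E \<times> {0}))"
    unfolding q0_eq by (rule connectedin_continuous_map_image[OF q0 E_conn])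
  then have conn: "connectedin (subtopology J' (manifold_boundary 3 J')) (q ` (E \<times> {0}))"
    using bJ by (simp add: connectedin_subtopology)
  have ne: "q ` (E \<times> {0}) \<noteq> {}"
    using E_ne by simp
  have "subtopology J' (manifold_boundary 3 J') \<noteq> trivial_topology"
  proof
    assume eq: "subtopology J' (manifold_boundary 3 J') = trivial_topology"
    have "q ` (E \<times> {0}) \<subseteq> topspace trivial_topology"
      using connectedin_subset_topspace[OF conn] unfolding eq .
    then show False
      using ne by simp
  qed
  then obtain B where B: "B \<in> boundary_components 3 J'" "q ` (E \<times> {0}) \<subseteq> B"
    using exists_connected_component_of_superset[OF conn] unfolding boundary_components_def by blast
  have bt: "boundary_torus C D \<delta> = B"
    unfolding boundary_torus_def v_def[symmetric] J'_def[symmetric] q_def[symmetric] E_def[symmetric]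
  proof (rule the_equality)
    show "B \<in> boundary_components 3 J' \<and> q ` (E \<times> {0}) \<subseteq> B"
      using B by blast
    fix B' assume B': "B' \<in> boundary_components 3 J' \<and> q ` (E \<times> {0}) \<subseteq> B'"
    then have "B' \<inter> B \<noteq> {}"
      using B ne by blast
    then show "B' = B"
      using connected_components_of_overlap B B' unfolding boundary_components_def by blast
  qed
  have "B \<subseteq> topspace J'" "B \<noteq> {}"
    using B(1) connected_components_of_subset nonempty_connected_components_of
    unfolding boundary_components_def by fastforce+
  then have "covering_degree B P > 0"
    by (rule covering_degree_pos[OF P])
  moreover have "covering_degree E p > 0"
    by (rule covering_degree_pos[OF p E_sub(1) E_ne])
  ultimately show ?thesis
    unfolding h_number_def bt v_def[symmetric] P_def[symmetric] E_def[symmetric] p_def[symmetric] by simp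
qed

lemma directed_edge:
  assumes "e \<in> directed_edges C \<kappa> \<Phi>"
  shows "fst e \<in> fiber_ends C \<kappa> \<Phi>" "snd e \<in> fiber_ends C \<kappa> \<Phi>"
    and "snd e = opp_end (fst e)" "fst e = opp_end (snd e)"
proof -
  show 1: "fst e \<in> fiber_ends C \<kappa> \<Phi>" and 2: "snd e = opp_end (fst e)"
    using assms by (auto simp: directed_edges_def)
  show "snd e \<in> fiber_ends C \<kappa> \<Phi>" "fst e = opp_end (snd e)"
    using fiber_ends_opp[OF 1] opp_opp_end 1 unfolding 2 by (simp_all add: fiber_ends_iff)
qed

text \<open>\<open>dual_to_edges\<close> lifts the loop piecewise to C, before any gluing, so each
  value of the lift has an explicit representative. There is one more subpath than there are
  crossings, and subpath k carries \<open>c k\<close>, the product over the crossings already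
  made.\<close>

lemma dual_loop_lift:
  assumes h: "\<forall>\<delta> \<in> fiber_ends C \<kappa> \<Phi>. h_number C D \<delta> \<noteq> 0"
    and es: "set es \<subseteq> directed_edges C \<kappa> \<Phi>" and dual: "dual_to_edges C \<kappa> \<Phi> \<alpha> es"
  defines "c \<equiv> \<lambda>k. prod_list (map (\<lambda>e. s_number C \<kappa> D (snd e)) (take k es))"
  shows "\<exists>\<beta>. is_lift (H_plus C \<kappa> \<Phi> D) \<alpha> \<beta> \<and> \<beta> 1 = act (H_plus C \<kappa> \<Phi> D) (c (length es)) (\<beta> 0)"
proof -
  let ?H = "H_plus C \<kappa> \<Phi> D"
  let ?cls = "\<lambda>z. gluing_rel C \<kappa> \<Phi> D `` {z}"
  let ?n = "length es"
  note H = rat_bundle_H_plus[OF h]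
  obtain t :: "nat \<Rightarrow> real" and a where t0: "t 0 = 0" and t1: "t (Suc ?n) = 1"
    and seg: "\<forall>i \<le> ?n. t i \<le> t (Suc i) \<and>
           continuous_map (top_of_set {t i..t (Suc i)}) (subtopology C part) (a i) \<and>
           (\<forall>r \<in> {t i..t (Suc i)}. \<kappa> (a i r) = \<alpha> r)"
    and cross: "\<forall>i < ?n. a i (t (Suc i)) \<in> fst (es ! i) \<and> a (Suc i) (t (Suc i)) \<in> snd (es ! i)"
    and close: "a ?n 1 = a 0 0"
    using dual unfolding dual_to_edges_def by (elim exE conjE) (rule that)
  have t_mono: "t k \<le> t (Suc k)" and a_cont: "continuous_map (top_of_set {t k..t (Suc k)}) (subtopology C part) (a k)"
    and a_\<alpha>: "\<And>r. r \<in> {t k..t (Suc k)} \<Longrightarrow> \<kappa> (a k r) = \<alpha> r" if "k \<le> ?n" for k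
    using seg that by blast+
  have edge: "es ! k \<in> directed_edges C \<kappa> \<Phi>" if "k < ?n" for k
    using es that nth_mem by blast
  have s0: "s_number C \<kappa> D (snd e) \<noteq> 0" if "e \<in> set es" for e
    using directed_edge(2) es that s_number_nonzero[OF h] by blast
  have c0: "c k \<noteq> 0" for k
    unfolding c_def prod_list_zero_iff using s0 by (auto dest: in_set_takeD)
  have cSuc: "c (Suc k) = s_number C \<kappa> D (snd (es ! k)) * c k" if "k < ?n" for k
    using that by (simp add: c_def take_Suc_conv_app_nth)
  have piece: "continuous_map (top_of_set {t k..t (Suc k)}) (total ?H) (\<lambda>r. ?cls (a k r, c k))" if k: "k \<le> ?n" for k
  proof -
    have "continuous_map (top_of_set {t k..t (Suc k)})
        (prod_topology (subtopology C part) (discrete_topology {q. q \<noteq> 0})) (\<lambda>r. (a k r, c k))"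
      using a_cont[OF k] c0 by (simp add: continuous_map_pairwise o_def)
    from continuous_map_compose[OF this H(2)] show ?thesis
      by (simp add: o_def)
  qed
  \<comment> \<open>The path leaves through the initial end, which is the opposite of the terminal
    end \<delta>, so the relation applies with the factor of \<delta> and not with its
    inverse.\<close>
  have match: "?cls (a k (t (Suc k)), c k) = ?cls (a (Suc k) (t (Suc k)), c (Suc k))" if k: "k < ?n" for k
  proof (rule equiv_class_eq[OF equiv_gluing_rel[OF h]])
    let ?\<delta> = "snd (es ! k)"
    have "a k (t (Suc k)) \<in> opp_end ?\<delta>" "a (Suc k) (t (Suc k)) \<in> ?\<delta>"
      using cross k directed_edge(4)[OF edge[OF k]] by auto
    moreover have "\<kappa> (a k (t (Suc k))) = \<kappa> (a (Suc k) (t (Suc k)))"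
      using a_\<alpha>[of k "t (Suc k)"] a_\<alpha>[of "Suc k" "t (Suc k)"] t_mono[of k] t_mono[of "Suc k"] k by simp
    ultimately show "((a k (t (Suc k)), c k), (a (Suc k) (t (Suc k)), c (Suc k))) \<in> gluing_rel C \<kappa> \<Phi> D"
      unfolding gluing_rel_iff[OF h] cSuc[OF k] using directed_edge(2)[OF edge[OF k]] by blast
  qed
  have tk: "0 \<le> t k" if "k \<le> Suc ?n" for k
    using that by (induction k) (use t0 t_mono in \<open>auto intro: order_trans\<close>)
  have "\<exists>F. continuous_map (top_of_set {0..t (Suc k)}) (total ?H) F \<and>
      (\<forall>r \<in> {0..t (Suc k)}. proj ?H (F r) = \<alpha> r) \<and> F 0 = ?cls (a 0 0, 1) \<and>
      F (t (Suc k)) = ?cls (a k (t (Suc k)), c k)" if "k \<le> ?n" for k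
    using that
  proof (induction k)
    case 0
    have "c 0 = 1"
      by (simp add: c_def)
    then show ?case
      using piece[of 0] a_\<alpha>[of 0] t0 by (intro exI[of _ "\<lambda>r. ?cls (a 0 r, c 0)"]) (simp add: H(3))
  next
    case (Suc k)
    then obtain F where F: "continuous_map (top_of_set {0..t (Suc k)}) (total ?H) F"
      "\<forall>r \<in> {0..t (Suc k)}. proj ?H (F r) = \<alpha> r" "F 0 = ?cls (a 0 0, 1)"
      "F (t (Suc k)) = ?cls (a k (t (Suc k)), c k)"
      by (auto simp: Suc_leD)
    define F1 where "F1 r = ?cls (a (Suc k) r, c (Suc k))" for r
    define F2 where "F2 r = (if r \<le> t (Suc k) then F r else F1 r)" for r
    have F1: "continuous_map (top_of_set {t (Suc k)..t (Suc (Suc k))}) (total ?H) F1"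
      unfolding F1_def using piece[OF Suc.prems] .
    have m: "F (t (Suc k)) = F1 (t (Suc k))"
      using match[of k] Suc.prems F(4) by (simp add: F1_def)
    have t: "0 \<le> t (Suc k)" "t (Suc k) \<le> t (Suc (Suc k))"
      using tk[of "Suc k"] t_mono[of "Suc k"] Suc.prems by auto
    have "continuous_map (top_of_set {0..t (Suc (Suc k))}) (total ?H) F2"
    proof (rule pasting_lemma_closed[where I = "{True, False}"
          and T = "\<lambda>b. if b then {0..t (Suc k)} else {t (Suc k)..t (Suc (Suc k))}"
          and f = "\<lambda>b. if b then F else F1"])
      show "closedin (top_of_set {0..t (Suc (Suc k))}) (if b then {0..t (Suc k)} else {t (Suc k)..t (Suc (Suc k))})" for b
        using t by (auto intro: closed_subset)
      show "continuous_map (subtopology (top_of_set {0..t (Suc (Suc k))})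
          (if b then {0..t (Suc k)} else {t (Suc k)..t (Suc (Suc k))})) (total ?H) (if b then F else F1)" for b
        using F(1) F1 t by (auto simp: subtopology_subtopology Int_absorb1)
      show "(if i then F else F1) r = (if j then F else F1) r"
        if "r \<in> topspace (top_of_set {0..t (Suc (Suc k))}) \<inter>
            (if i then {0..t (Suc k)} else {t (Suc k)..t (Suc (Suc k))}) \<inter>
            (if j then {0..t (Suc k)} else {t (Suc k)..t (Suc (Suc k))})" for i j r
      proof (cases "i = j")
        case False
        then have "r = t (Suc k)"
          using that by (cases i; cases j) auto
        then show ?thesis
          using m by auto
      qed simp
      show "\<exists>j. j \<in> {True, False} \<and> r \<in> (if j then {0..t (Suc k)} else {t (Suc k)..t (Suc (Suc k))}) \<and>
          F2 r = (if j then F else F1) r" if "r \<in> topspace (top_of_set {0..t (Suc (Suc k))})" for r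
        using that by (cases "r \<le> t (Suc k)") (auto simp: F2_def)
    qed simp
    moreover have "proj ?H (F2 r) = \<alpha> r" if "r \<in> {0..t (Suc (Suc k))}" for r
      using F(2) a_\<alpha>[OF Suc.prems, of r] that by (simp add: F2_def F1_def H(3))
    moreover have "F2 0 = ?cls (a 0 0, 1)"
      using F(3) t by (simp add: F2_def)
    \<comment> \<open>On a subpath with equal end parameters F2 takes its value from F, which agrees
      there with F1.\<close>
    moreover have "F2 (t (Suc (Suc k))) = ?cls (a (Suc k) (t (Suc (Suc k))), c (Suc k))"
      using m t by (cases "t (Suc (Suc k)) = t (Suc k)") (auto simp: F2_def F1_def)
    ultimately show ?case
      by (intro exI[of _ F2] conjI ballI)
  qed
  from this[OF order_refl] obtain F where F: "continuous_map (top_of_set {0..1}) (total ?H) F"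
      "\<forall>r \<in> {0..1}. proj ?H (F r) = \<alpha> r" "F 0 = ?cls (a 0 0, 1)" "F 1 = ?cls (a ?n 1, c ?n)"
    unfolding t1 by (elim exE conjE) (rule that)
  \<comment> \<open>The last subpath ends in C where the initial one begins, so the two classes
    differ only in the rational coordinate.\<close>
  have "F 1 = act ?H (c ?n) (F 0)"
    using F(3,4) H(4)[OF c0] by (simp add: close)
  then show ?thesis
    using F(1,2) by (intro exI[of _ F]) (simp add: is_lift_def pathin_def)
qed

text \<open>A lift to the twisted product is the class of a pair of lifts. After one turn the pair
  is multiplied by the gluing product in one factor and by the orientation sign in the other, and
  the twist gathers both in a single rational.\<close>

theorem spirality_of_dual_loop:
  assumes X: "manifold_with_boundary 2 X"
    and h: "\<forall>\<delta> \<in> fiber_ends C \<kappa> \<Phi>. h_number C D \<delta> \<noteq> 0"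
    and Q: "orientation_double_cover X Q"
    and es: "set es \<subseteq> directed_edges C \<kappa> \<Phi>" and \<alpha>: "loop_in Y \<alpha>" and dual: "dual_to_edges C \<kappa> \<Phi> \<alpha> es"
  shows "spirality_character Y (twisted_product (H_plus C \<kappa> \<Phi> D) Q) (loop_class Y \<alpha>) =
    orientation_character 2 Y \<alpha> * prod_list (map (\<lambda>e. s_number C \<kappa> D (snd e)) es)"
proof -
  let ?H = "H_plus C \<kappa> \<Phi> D"
  let ?R = "twisted_product ?H Q"
  let ?s = "prod_list (map (\<lambda>e. s_number C \<kappa> D (snd e)) es)"
  note HP = rat_bundle_H_plus(1)[OF h]
  interpret H: rat_bundle "{q. q \<noteq> 0}" Y ?H
    by (rule HP)
  interpret Q: rat_bundle "{1, - 1}" X Q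
    using Q by (rule rat_bundle_orientation_double_cover)
  define cls where "cls z = {((a, b), (act ?H \<epsilon> a, act Q \<epsilon> b)) | a b \<epsilon>. \<epsilon> \<in> {1, - 1}} `` {z}" for z
  note R = rat_bundle_twisted_product[OF HP[unfolded Y_eq] Q.rat_bundle_axioms, folded cls_def, folded Y_eq]
  have \<alpha>Y: "pathin Y \<alpha>" "\<alpha> 0 = \<alpha> 1"
    using \<alpha> by (simp_all add: loop_in_def)
  then have \<alpha>X: "pathin X \<alpha>"
    unfolding Y_eq by (simp add: pathin_subtopology)
  obtain \<beta> where \<beta>: "is_lift ?H \<alpha> \<beta>" "\<beta> 1 = act ?H ?s (\<beta> 0)"
    using dual_loop_lift[OF h es dual] by auto
  have "\<alpha> 0 \<in> topspace X"
    using continuous_map_funspace[OF \<alpha>X[unfolded pathin_def]] by auto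
  then obtain e where e: "e \<in> topspace (total Q)" "proj Q e = \<alpha> 0"
    by (rule Q.fibre_nonempty)
  obtain \<gamma> where \<gamma>: "is_lift Q \<alpha> \<gamma>" "\<gamma> 0 = e"
    using Q.path_lift[OF \<alpha>X e] .
  define \<epsilon> where "\<epsilon> = orientation_character 2 X \<alpha>"
  have \<epsilon>: "\<epsilon> \<in> {1, - 1}"
    unfolding \<epsilon>_def by (rule orientation_character_cases)
  have \<gamma>1: "\<gamma> 1 = act Q \<epsilon> (\<gamma> 0)"
    using Q \<gamma>(1) \<alpha>X \<alpha>Y(2) unfolding orientation_double_cover_def \<epsilon>_def loop_in_def by metis
  have s0: "?s \<noteq> 0"
    unfolding prod_list_zero_iff using directed_edge(2) es s_number_nonzero[OF h] by force
  have b0: "\<beta> 0 \<in> topspace (total ?H)" and g0: "\<gamma> 0 \<in> topspace (total Q)"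
    using H.is_lift_total[OF \<beta>(1)] Q.is_lift_total[OF \<gamma>(1)] by simp_all
  have lift: "is_lift ?R \<alpha> (\<lambda>t. cls (\<beta> t, \<gamma> t))"
    unfolding is_lift_def pathin_def
  proof (intro conjI ballI)
    have eq: "proj ?H (\<beta> t) = proj Q (\<gamma> t)" if "t \<in> {0..1}" for t
      using H.is_lift_proj[OF \<beta>(1) that] Q.is_lift_proj[OF \<gamma>(1) that] by simp
    have "continuous_map (top_of_set {0..1}) (total ?H) \<beta>" "continuous_map (top_of_set {0..1}) (total Q) \<gamma>"
      using \<beta>(1) \<gamma>(1) by (simp_all add: is_lift_def pathin_def)
    then have "continuous_map (top_of_set {0..1})
        (subtopology (prod_topology (total ?H) (total Q)) {(a, b). proj ?H a = proj Q b}) (\<lambda>t. (\<beta> t, \<gamma> t))"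
      using eq by (simp add: continuous_map_in_subtopology continuous_map_pairwise o_def Pi_iff)
    from continuous_map_compose[OF this R(2)]
    show "continuous_map (top_of_set {0..1}) (total ?R) (\<lambda>t. cls (\<beta> t, \<gamma> t))"
      by (simp add: o_def)
    show "proj ?R (cls (\<beta> t, \<gamma> t)) = \<alpha> t" if "t \<in> {0..1}" for t
      using R(3)[OF H.is_lift_total[OF \<beta>(1) that] Q.is_lift_total[OF \<gamma>(1) that]]
        H.is_lift_proj[OF \<beta>(1) that] by simp
  qed
  have \<epsilon>0: "\<epsilon> \<noteq> 0" and \<epsilon>\<epsilon>: "\<epsilon> * (\<epsilon> * ?s) = ?s"
    using \<epsilon> by auto
  have b1: "act ?H (\<epsilon> * ?s) (\<beta> 0) \<in> topspace (total ?H)"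
    using H.act_total(1)[OF b0] \<epsilon>0 s0 by simp
  \<comment> \<open>As \<epsilon> squares to 1, one \<epsilon> can be split off in the factor of
    \<open>H_plus\<close>; paired with the sign of \<gamma> it is absorbed by the twist.\<close>
  have "\<beta> 1 = act ?H \<epsilon> (act ?H (\<epsilon> * ?s) (\<beta> 0))"
    using H.act_act[OF b0, of \<epsilon> "\<epsilon> * ?s"] \<epsilon>0 s0 \<beta>(2) \<epsilon>\<epsilon> by simp
  then have "cls (\<beta> 1, \<gamma> 1) = cls (act ?H (\<epsilon> * ?s) (\<beta> 0), \<gamma> 0)"
    using R(5)[OF b1 g0 \<epsilon>] \<gamma>1 by simp
  also have "\<dots> = act ?R (\<epsilon> * ?s) (cls (\<beta> 0, \<gamma> 0))"
    using R(4)[OF b0 g0, of "\<epsilon> * ?s"] \<epsilon>0 s0 by simp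
  finally have "spirality_character Y ?R (loop_class Y \<alpha>) = \<epsilon> * ?s"
    using spirality_character_loop[OF R(1) \<alpha> lift] \<epsilon>0 s0 by simp
  moreover have "\<epsilon> = orientation_character 2 Y \<alpha>"
    unfolding \<epsilon>_def using orientation_character_part[OF X \<alpha> orientation_along_exists[OF Q \<alpha>X]] by simp
  ultimately show ?thesis
    by simp
qed

end

theorem mainTheorem6:
  fixes M :: "'m topology" and T :: "'m set" and CM :: "'d topology" and \<kappa>M :: "'d \<Rightarrow> 'm"
    and S :: "'s topology" and f g :: "'s \<Rightarrow> 'm"
    and CS :: "'c topology" and \<kappa>S :: "'c \<Rightarrow> 's" and gc :: "'c \<Rightarrow> 'd"
    and D :: "('c, 'd, 'p, 'j) setup_data"
    and S_tilde :: "('o, 's) Q_bundle"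
    and \<alpha> :: "real \<Rightarrow> 's" and es :: "('c set \<times> 'c set) list"
  defines "\<Phi> \<equiv> fiber_vertices CM CS gc"
  defines "PhiS \<equiv> almost_fiber_part S \<kappa>S \<Phi>"
  defines "h \<equiv> h_number CS D" and "s \<equiv> s_number CS \<kappa>S D"
  defines "\<H> \<equiv> twisted_product (H_plus CS \<kappa>S \<Phi> D) S_tilde"
  assumes "closed_manifold 3 M" and "orientable 3 M" and "aspherical M"
    and "closed_manifold 2 S" and "essentially_immersed S M f"
    and "induced_JSJ_decomposition M T CM \<kappa>M S f g CS \<kappa>S gc"
    and "valid_setup_data CM CS \<kappa>S gc \<Phi> D"
    and "orientation_double_cover S S_tilde"
    and "directed_edge_cycle CS \<kappa>S \<Phi> es"
    and "loop_in PhiS \<alpha>" and "dual_to_edges CS \<kappa>S \<Phi> \<alpha> es"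
  shows "\<bar>spirality_character PhiS \<H> (loop_class PhiS \<alpha>)\<bar> = (\<Prod>(ini, ter)\<leftarrow>es. s ter) \<and>
    (\<Prod>(ini, ter)\<leftarrow>es. s ter) = (\<Prod>(ini, ter)\<leftarrow>es. inverse (s ini)) \<and>
    (\<Prod>(ini, ter)\<leftarrow>es. inverse (s ini)) = (\<Prod>(ini, ter)\<leftarrow>es. h ini / h ter) \<and>
    sgn (spirality_character PhiS \<H> (loop_class PhiS \<alpha>)) = orientation_character 2 PhiS \<alpha>"
proof -
  have S: "manifold_with_boundary 2 S" "manifold_boundary 2 S = {}"
    using \<open>closed_manifold 2 S\<close> by (simp_all add: closed_manifold_def)
  have cut: "cut_along 2 S (JSJ_curves S T g) CS \<kappa>S" and pos: "JSJ_position S M T f g"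
    using \<open>induced_JSJ_decomposition M T CM \<kappa>M S f g CS \<kappa>S gc\<close> by (simp_all add: induced_JSJ_decomposition_def)
  interpret cut_subsurface S "JSJ_curves S T g" CS \<kappa>S \<Phi>
  proof
    show "Hausdorff_space S"
      using S(1) by (simp add: manifold_with_boundary_def)
    show "locally_Euclidean_at 2 S x" if "x \<in> topspace S" for x
      using S(2) that by (auto simp: manifold_boundary_def manifold_interior_def)
    show "finite (connected_components_of (subtopology S (JSJ_curves S T g)))"
      using pos by (simp add: JSJ_position_def)
    show "JSJ_curves S T g \<subseteq> topspace S" "\<Phi> \<subseteq> connected_components_of CS"
      by (auto simp: JSJ_curves_def \<Phi>_def fiber_vertices_def)
  qed (rule cut)
  have es: "set es \<subseteq> directed_edges CS \<kappa>S \<Phi>"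
    using \<open>directed_edge_cycle CS \<kappa>S \<Phi> es\<close> by (simp add: directed_edge_cycle_def)
  have h_pos: "h \<delta> > 0" if "\<delta> \<in> fiber_ends CS \<kappa>S \<Phi>" for \<delta>
    unfolding h_def using h_number_pos[OF \<open>valid_setup_data CM CS \<kappa>S gc \<Phi> D\<close> that] .
  \<comment> \<open>Opposition is an involution on ends, so the quotient defining s at one end of an
    edge is the inverse of the one at the other end; the three products agree factor by
    factor.\<close>
  have s_eq: "s (snd e) = h (fst e) / h (snd e)" "s (snd e) = inverse (s (fst e))" "s (snd e) > 0"
    if "e \<in> set es" for e
  proof -
    note e = directed_edge[OF subsetD[OF es that]]
    have "s (snd e) = h (fst e) / h (snd e)" "s (fst e) = h (snd e) / h (fst e)"
      unfolding s_def s_number_def h_def e(3)[symmetric] e(4)[symmetric] by (rule refl)+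
    then show "s (snd e) = h (fst e) / h (snd e)" "s (snd e) = inverse (s (fst e))" "s (snd e) > 0"
      using h_pos[OF e(1)] h_pos[OF e(2)] by simp_all
  qed
  define p where "p = (\<Prod>(ini, ter)\<leftarrow>es. s ter)"
  have p: "p = prod_list (map (\<lambda>e. s (snd e)) es)"
    by (simp add: p_def case_prod_unfold)
  have p1: "p = (\<Prod>(ini, ter)\<leftarrow>es. inverse (s ini))" and p2: "p = (\<Prod>(ini, ter)\<leftarrow>es. h ini / h ter)"
    unfolding p case_prod_unfold
    by (intro arg_cong[where f = prod_list] map_cong refl s_eq; assumption)+
  \<comment> \<open>Positivity identifies p with the absolute value and leaves the sign to the
    orientation character. The induction runs over lists xs with members in \<open>es\<close>, since
    the facts about s are known only for those edges.\<close>
  have "p > 0"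
  proof -
    have "prod_list (map (\<lambda>e. s (snd e)) xs) > 0" if "set xs \<subseteq> set es" for xs
      using that by (induction xs) (auto simp: s_eq(3))
    then show ?thesis
      unfolding p by blast
  qed
  have char: "spirality_character PhiS \<H> (loop_class PhiS \<alpha>) = orientation_character 2 PhiS \<alpha> * p"
    unfolding p s_def \<H>_def PhiS_def
  proof (rule spirality_of_dual_loop[OF S(1) _ \<open>orientation_double_cover S S_tilde\<close> es])
    show "\<forall>\<delta> \<in> fiber_ends CS \<kappa>S \<Phi>. h_number CS D \<delta> \<noteq> 0"
      using h_pos unfolding h_def by fastforce
    show "loop_in (almost_fiber_part S \<kappa>S \<Phi>) \<alpha>"
      using \<open>loop_in PhiS \<alpha>\<close> by (simp add: PhiS_def)
  qed fact
  have \<epsilon>: "orientation_character 2 PhiS \<alpha> = 1 \<or> orientation_character 2 PhiS \<alpha> = - 1"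
    using orientation_character_cases[of 2 PhiS \<alpha>] by simp
  have "\<bar>spirality_character PhiS \<H> (loop_class PhiS \<alpha>)\<bar> = p"
    and "sgn (spirality_character PhiS \<H> (loop_class PhiS \<alpha>)) = orientation_character 2 PhiS \<alpha>"
    using \<epsilon> \<open>p > 0\<close> unfolding char by (auto simp: abs_mult sgn_mult)
  then show ?thesis
    using p1 p2 unfolding p_def by simp
qed

end
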